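(* Let $1<m<2$, let $N\geq 1$, and let $\gamma_1,\dots,\gamma_N\in\mathbb{R}$ satisfy \[ \sum_{j\in J}\gamma_j\neq 0\qquad\text{for every nonempty } J\subset\{1,2,\dots,N\}. \] Consider the point vortex system \[ \dot X_j=\sum_{k\neq j}\gamma_k\nabla^\perp G_m(X_j-X_k),\qquad X_j(0)=x_j,\qquad j=1,\dots,N, \] with $X_j(t)\in\mathbb{R}^2$. Then there is a set $\mathcal N\subset(\mathbb{R}^2)^N$ of Lebesgue measure zero such that for every initial condition $(x_1,\dots,x_N)\in(\mathbb{R}^2)^N\setminus\mathcal N$ this initial value problem has a global (defined for all $t\geq0$) smooth solution.
   Context: $G_m$ is the Green function of the fractional Laplacian $(-\Delta)^{m/2}$ on $\mathbb{R}^2$, given by $G_m(x)=\frac{\Gamma(\frac{2-m}{2})}{2^{m/2}\pi|\Gamma(\frac m2)|}|x|^{m-2}$, and $\nabla^\perp=(-\partial_{x_2},\partial_{x_1})$. A solution is global in particular means that no two vortices collide ($X_i(t)\neq X_j(t)$ for $i\ne j$) and none escapes to infinity at any finite time. *)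

theory Defs
  imports "HOL-Analysis.Analysis"
begin

text \<open>Green function of the fractional Laplacian (-Delta)^(m/2) on R^2.\<close>
definition G_frac :: "real \<Rightarrow> real^2 \<Rightarrow> real" where
  "G_frac m x = Gamma ((2 - m) / 2) / (2 powr (m / 2) * pi * \<bar>Gamma (m / 2)\<bar>) * norm x powr (m - 2)"

definition partial2 :: "(real^2 \<Rightarrow> real) \<Rightarrow> 2 \<Rightarrow> real^2 \<Rightarrow> real" where
  "partial2 f i x = frechet_derivative f (at x) (axis i 1)"

definition nabla_perp :: "(real^2 \<Rightarrow> real) \<Rightarrow> real^2 \<Rightarrow> real^2" where
  "nabla_perp f x = (\<chi> i. if i = 1 then - partial2 f 2 x else partial2 f 1 x)"

definition vortex_field :: "real \<Rightarrow> ('n::finite \<Rightarrow> real) \<Rightarrow> (real^2)^'n \<Rightarrow> (real^2)^'n" where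
  "vortex_field m \<gamma> X = (\<chi> j. \<Sum>k\<in>UNIV - {j}. \<gamma> k *\<^sub>R nabla_perp (G_frac m) (X $ j - X $ k))"

definition smooth_on_halfline :: "(real \<Rightarrow> 'a::real_normed_vector) \<Rightarrow> bool" where
  "smooth_on_halfline X \<longleftrightarrow> (\<exists>D::nat \<Rightarrow> real \<Rightarrow> 'a. D 0 = X \<and>
     (\<forall>k. \<forall>t\<ge>0. (D k has_vector_derivative D (Suc k) t) (at t within {0..})))"

end

theory Submission
  imports Defs
begin

text \<open>
  The kernel is replaced at distances below \<open>sqrt e\<close> by a \<open>C\<^sup>1\<close> kernel that is still odd, divergence free
  and bounded by the original one. The regularised flow is global, preserves Lebesgue measure, and, since
  no cluster has vanishing total intensity, moves every vortex on \<open>[0, T]\<close> by a distance bounded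
  independently of \<open>e\<close>. Along the flow the potential \<open>|X_i - X_j|^(m - 2)\<close> grows at most at the rate
  of a sum of terms \<open>|X_i - X_j|^(m - 3) |X_i - X_k|^(m - 3)\<close> with \<open>i, j, k\<close> distinct, which are locally
  integrable because \<open>m > 1\<close>. By invariance of the measure, the integral over initial data of the total
  growth is bounded uniformly in \<open>e\<close>, so the set of data for which two vortices come as close as \<open>sqrt e\<close>
  before time \<open>T\<close> has measure tending to zero with \<open>e\<close>. For all other data the regularised solution
  solves the original system.
\<close>

section \<open>Flows of Lipschitz vector fields\<close>

text \<open>Put \<open>a = (4 - m) / 2\<close>. The kernel is then a constant times
  \<open>norm y powr (- 2 * a)\<close> times \<open>rot y\<close>, the range of \<open>m\<close>
  becomes \<open>1 < a < 3/2\<close>, the potential has exponent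
  \<open>m - 2 = - 2 * (a - 1)\<close> and the speed has exponent
  \<open>m - 3 = - (2 * a - 1)\<close>. With intensities of both signs the Hamiltonian gives no
  lower bound for the distances, since large terms may cancel in it; collisions are therefore
  excluded only statistically. The square of a single factor,
  \<open>norm y powr (2 * (m - 3))\<close>, would not be integrable near 0 in the plane; it never
  occurs because the kernel is perpendicular to its argument. The measure is transported by a
  one-sided inequality, obtained without differentiating the flow in the initial data: an Euler step
  of length \<open>h\<close> has Jacobian at least \<open>1 - O(h^2)\<close>, and over
  \<open>t / h\<close> steps the loss is \<open>O(h)\<close>. The \<open>C^1\<close> regularisation
  makes this Jacobian available. The displacement bound keeps all integrals in a fixed ball, the
  triple interaction being integrable only locally.\<close>

lemma vector_derivative_bound:
  fixes f :: "real \<Rightarrow> 'a::real_normed_vector"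
  assumes "convex S" "\<And>x. x \<in> S \<Longrightarrow> (f has_vector_derivative f' x) (at x within S)"
    and B: "\<And>x. x \<in> S \<Longrightarrow> norm (f' x) \<le> B" and xy: "x \<in> S" "y \<in> S"
  shows "norm (f x - f y) \<le> B * norm (x - y)"
proof (rule differentiable_bound[OF assms(1) _ _ xy])
  show "(f has_derivative (\<lambda>h. h *\<^sub>R f' z)) (at z within S)" if "z \<in> S" for z
    using assms(2)[OF that] by (simp add: has_vector_derivative_def)
  show "onorm (\<lambda>h. h *\<^sub>R f' z) \<le> B" if "z \<in> S" for z
    using B[OF that] by (intro onorm_le) (auto simp: mult.commute[of B] intro!: mult_left_mono)
qed

lemma continuous_on_of_norm_lipschitz:
  fixes V :: "'a::real_normed_vector \<Rightarrow> 'b::real_normed_vector"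
  assumes "L > 0" and "\<And>x y. norm (V x - V y) \<le> L * norm (x - y)"
  shows "continuous_on A V"
  using assms by (intro lipschitz_on_continuous_on[of L] lipschitz_onI) (auto simp: dist_norm)

text \<open>Picard iteration. The weight \<open>exp (2*L*t)\<close> makes each iteration halve the
  error, so the series of increments converges uniformly on every \<open>{0..T}\<close> and a global
  solution arises without continuation from short intervals.\<close>

lemma lipschitz_flow_exists:
  fixes V :: "'a::euclidean_space \<Rightarrow> 'a"
  assumes L: "L > 0" and lip: "\<And>x y. norm (V x - V y) \<le> L * norm (x - y)"
  shows "\<exists>X. X 0 = x0 \<and> (\<forall>t\<ge>0. (X has_vector_derivative V (X t)) (at t within {0..}))"
proof -
  define P where "P = rec_nat (\<lambda>t::real. x0) (\<lambda>n q t. x0 + integral {0..t} (\<lambda>s. V (q s)))"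
  have P0: "P 0 = (\<lambda>t. x0)" and PS: "P (Suc n) = (\<lambda>t. x0 + integral {0..t} (\<lambda>s. V (P n s)))" for n
    by (simp_all add: P_def)
  have contV: "continuous_on A V" for A
    by (rule continuous_on_of_norm_lipschitz[OF L lip])
  have contVf: "continuous_on A f \<Longrightarrow> continuous_on A (\<lambda>s. V (f s))" for f :: "real \<Rightarrow> 'a" and A
    using continuous_on_compose2[OF contV[of UNIV], of A f] by auto
  have contP: "continuous_on {0..T} (P n)" for n T
  proof (induction n)
    case (Suc n)
    show ?case unfolding PS
      by (intro continuous_intros indefinite_integral_continuous_1 integrable_continuous_interval contVf Suc)
  qed (simp add: P0)
  define C where "C = norm (V x0) / L"
  have C: "C \<ge> 0" using L by (simp add: C_def)
  have bd: "norm (P (Suc n) t - P n t) \<le> C * (1/2)^n * exp (2*L*t)" if "t \<ge> 0" for n t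
    using that
  proof (induction n arbitrary: t)
    case 0
    have "norm (P (Suc 0) t - P 0 t) = C * (L*t)"
      using 0 L by (simp add: PS P0 C_def)
    also have "\<dots> \<le> C * exp (2*L*t)"
    proof (intro mult_left_mono C)
      have "0 \<le> L * t" using 0 L by simp
      then show "L * t \<le> exp (2*L*t)" using exp_ge_add_one_self[of "2*L*t"] by linarith
    qed
    finally show ?case by simp
  next
    case (Suc n)
    have i: "(\<lambda>s. V (P k s)) integrable_on {0..t}" for k
      by (intro integrable_continuous_interval contVf contP)
    have "norm (P (Suc (Suc n)) t - P (Suc n) t) =
        norm (integral {0..t} (\<lambda>s. V (P (Suc n) s) - V (P n s)))"
      by (subst integral_diff[OF i i]) (simp add: PS)
    also have "\<dots> \<le> integral {0..t} (\<lambda>s. L * (C * (1/2)^n * exp (2*L * s)))"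
    proof (rule integral_norm_bound_integral)
      show "(\<lambda>s. V (P (Suc n) s) - V (P n s)) integrable_on {0..t}"
        by (intro integrable_diff i)
      show "(\<lambda>s. L * (C * (1/2)^n * exp (2*L * s))) integrable_on {0..t}"
        by (intro integrable_continuous_interval continuous_intros)
      fix s assume "s \<in> {0..t}"
      then show "norm (V (P (Suc n) s) - V (P n s)) \<le> L * (C * (1/2)^n * exp (2*L * s))"
        using Suc.IH[of s] L by (intro order_trans[OF lip] mult_left_mono) auto
    qed
    also have "((\<lambda>s. L * (C * (1/2)^n * exp (2*L * s))) has_integral
       (C * (1/2)^n * exp (2*L*t) / 2 - C * (1/2)^n * exp (2*L*0) / 2)) {0..t}"
      by (rule fundamental_theorem_of_calculus)
        (use Suc.prems in \<open>auto intro!: derivative_eq_intros simp: has_real_derivative_iff_has_vector_derivative[symmetric]\<close>)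
    then have "integral {0..t} (\<lambda>s. L * (C * (1/2)^n * exp (2*L * s))) =
       (C * (1/2)^n * exp (2*L*t) / 2 - C * (1/2)^n * exp (2*L*0) / 2)"
      by (rule integral_unique)
    also have "\<dots> \<le> C * (1/2)^(Suc n) * exp (2*L*t)" using C by simp
    finally show ?case .
  qed
  define X where "X t = x0 + suminf (\<lambda>i. P (Suc i) t - P i t)" for t
  have Psum: "P n t = x0 + (\<Sum>i<n. P (Suc i) t - P i t)" for n t
    by (subst sum_lessThan_telescope) (simp add: P0)
  have unif: "uniform_limit {0..T} P X sequentially" for T
  proof -
    have "uniform_limit {0..T} (\<lambda>n t. \<Sum>i<n. P (Suc i) t - P i t)
        (\<lambda>t. suminf (\<lambda>i. P (Suc i) t - P i t)) sequentially"
    proof (rule Weierstrass_m_test)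
      fix n t assume t: "t \<in> {0..T}"
      then have "norm (P (Suc n) t - P n t) \<le> C * (1/2)^n * exp (2*L*t)" by (intro bd) auto
      also have "\<dots> \<le> C * (1/2)^n * exp (2*L*T)" using t C L by (intro mult_left_mono) auto
      finally show "norm (P (Suc n) t - P n t) \<le> C * (1/2)^n * exp (2*L*T)" .
    next
      show "summable (\<lambda>n. C * (1/2)^n * exp (2*L*T))"
        by (intro summable_mult summable_mult2 summable_geometric) auto
    qed
    then have "uniform_limit {0..T} (\<lambda>n t. x0 + (\<Sum>i<n. P (Suc i) t - P i t)) X sequentially"
      unfolding X_def by (intro uniform_limit_intros)
    then show ?thesis by (simp add: Psum[symmetric])
  qed
  have contX: "continuous_on {0..T} X" for T
    using uniform_limit_theorem[OF _ unif] contP by (simp add: eventually_sequentially)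
  have Xint: "X t = x0 + integral {0..t} (\<lambda>s. V (X s))" if "t \<ge> 0" for t
  proof -
    have "uniform_limit {0..t} (\<lambda>n s. V (P n s)) (\<lambda>s. V (X s)) sequentially"
    proof (rule uniform_limitI)
      fix e :: real assume e: "e > 0"
      have "\<forall>\<^sub>F n in sequentially. \<forall>x\<in>{0..t}. dist (P n x) (X x) < e / L"
        using e L by (intro uniform_limitD[OF unif]) auto
      then show "\<forall>\<^sub>F n in sequentially. \<forall>x\<in>{0..t}. dist (V (P n x)) (V (X x)) < e"
        by eventually_elim (use L in \<open>auto simp: dist_norm field_simps intro!: le_less_trans[OF lip]\<close>)
    qed
    then obtain I J where IJ: "\<And>n. ((\<lambda>s. V (P n s)) has_integral I n) {0..t}"
      "((\<lambda>s. V (X s)) has_integral J) {0..t}" "I \<longlonglongrightarrow> J"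
      by (rule uniform_limit_integral[where F=sequentially]) (auto intro: contVf contP)
    have "P (Suc n) t = x0 + I n" for n using integral_unique[OF IJ(1)] by (simp add: PS)
    then have "(\<lambda>n. P (Suc n) t) \<longlonglongrightarrow> x0 + J" by (simp add: tendsto_add IJ(3))
    moreover have "(\<lambda>n. P (Suc n) t) \<longlonglongrightarrow> X t"
      using tendsto_uniform_limitI[OF unif[of t], of t] that by (intro LIMSEQ_Suc) auto
    ultimately have "X t = x0 + J" using LIMSEQ_unique by blast
    then show ?thesis using integral_unique[OF IJ(2)] by simp
  qed
  have "(X has_vector_derivative V (X t)) (at t within {0..})" if t: "t \<ge> 0" for t
  proof -
    \<comment> \<open>The interval reaches beyond \<open>t\<close>, so that near \<open>t\<close> it
      agrees with the half-line.\<close>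
    have "((\<lambda>u. x0 + integral {0..u} (\<lambda>s. V (X s))) has_vector_derivative V (X t)) (at t within {0..t+1})"
      using integral_has_vector_derivative[OF contVf[OF contX], of t "t+1"] t
      by (auto intro!: derivative_eq_intros)
    then have "(X has_vector_derivative V (X t)) (at t within {0..t+1})"
      by (rule has_vector_derivative_transform[rotated 2]) (use t Xint in auto)
    moreover have "at t within {0..t+1} = at t within {0..}"
      by (rule at_within_nhd[of _ "{..<t+1}"]) auto
    ultimately show ?thesis by simp
  qed
  moreover have "X 0 = x0" using Xint[of 0] by simp
  ultimately show ?thesis by blast
qed

text \<open>Gronwall's inequality: the squared distance times \<open>exp (-2*L*s)\<close> has
  nonpositive derivative. With equal initial values it is the uniqueness statement by which
  solutions on different time intervals are glued.\<close>

lemma lipschitz_flow_dependence: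
  fixes V :: "'a::euclidean_space \<Rightarrow> 'a"
  assumes lip: "\<And>t. t \<in> {0..T} \<Longrightarrow> norm (V (x t) - V (y t)) \<le> L * norm (x t - y t)"
    and x: "\<And>t. t \<in> {0..T} \<Longrightarrow> (x has_vector_derivative V (x t)) (at t within {0..T})"
    and y: "\<And>t. t \<in> {0..T} \<Longrightarrow> (y has_vector_derivative V (y t)) (at t within {0..T})"
    and t: "t \<in> {0..T}"
  shows "norm (x t - y t) \<le> exp (L * t) * norm (x 0 - y 0)"
proof -
  define u where "u s = ((x s - y s) \<bullet> (x s - y s)) * exp (-2*L * s)" for s
  define u' where "u' s = 2 * ((x s - y s) \<bullet> (V (x s) - V (y s))) * exp (-2*L * s)
      - 2*L*exp (-2*L * s) * ((x s - y s) \<bullet> (x s - y s))" for s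
  have du: "(u has_real_derivative u' s) (at s within {0..T})" if "s \<in> {0..T}" for s
  proof -
    note [derivative_intros] = x[OF that, unfolded has_vector_derivative_def]
      y[OF that, unfolded has_vector_derivative_def]
    show ?thesis
      unfolding u_def u'_def has_field_derivative_def
      by (rule derivative_eq_intros | rule refl)+
        (auto simp: fun_eq_iff algebra_simps inner_commute)
  qed
  have neg: "u' s \<le> 0" if "s \<in> {0..T}" for s
  proof -
    have "(x s - y s) \<bullet> (V (x s) - V (y s)) \<le> norm (x s - y s) * norm (V (x s) - V (y s))"
      by (rule norm_cauchy_schwarz)
    also have "\<dots> \<le> norm (x s - y s) * (L * norm (x s - y s))"
      by (intro mult_left_mono lip that) auto
    also have "\<dots> = L * ((x s - y s) \<bullet> (x s - y s))" by (simp add: power2_norm_eq_inner[symmetric] power2_eq_square)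
    finally have "(2 * exp (-2*L * s)) * ((x s - y s) \<bullet> (V (x s) - V (y s)) - L * ((x s - y s) \<bullet> (x s - y s))) \<le> 0"
      by (intro mult_nonneg_nonpos) auto
    then show ?thesis unfolding u'_def by (simp only: right_diff_distrib) (simp only: ac_simps)
  qed
  have "\<exists>s\<in>{0..t}. u t - u 0 = (t - 0) * u' s"
  proof -
    have "(u has_derivative (*) (u' s)) (at s within {0..t})" if "0 \<le> s" "s \<le> t" for s
    proof (rule has_derivative_subset[of u _ s "{0..T}"])
      show "(u has_derivative (*) (u' s)) (at s within {0..T})"
        using du[of s] that t unfolding has_field_derivative_def by auto
    qed (use t in auto)
    then obtain s where "s \<in> {0..t}" "u t - u 0 = u' s * (t - 0)"
      using mvt_very_simple[of 0 t u "\<lambda>s. (*) (u' s)"] t by auto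
    then show ?thesis by (metis mult.commute)
  qed
  then have "u t \<le> u 0"
  proof
    fix s assume "s \<in> {0..t}" "u t - u 0 = (t - 0) * u' s"
    then show ?thesis using neg[of s] t mult_nonneg_nonpos[of t "u' s"] by auto
  qed
  then have "(norm (x t - y t))\<^sup>2 * exp (-2*L*t) \<le> (norm (x 0 - y 0))\<^sup>2"
    by (simp add: u_def power2_norm_eq_inner)
  then have "(norm (x t - y t))\<^sup>2 * exp (-2*L*t) * (exp (L * t))\<^sup>2 \<le> (norm (x 0 - y 0))\<^sup>2 * (exp (L * t))\<^sup>2"
    by (rule mult_right_mono) simp
  moreover have "exp (-2*L*t) * (exp (L * t))\<^sup>2 = 1"
    by (simp add: power2_eq_square mult_exp_exp)
  ultimately have "(norm (x t - y t))\<^sup>2 \<le> (norm (x 0 - y 0) * exp (L * t))\<^sup>2"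
    by (simp only: mult.assoc mult_1_right power_mult_distrib)
  then have "norm (x t - y t) \<le> norm (x 0 - y 0) * exp (L * t)"
    by (rule power2_le_imp_le) simp
  then show ?thesis by (simp only: mult.commute)
qed

section \<open>Flows of divergence free fields do not increase Lebesgue measure\<close>

text \<open>The library's change of variables formula requires a wellordered index type, which the
  coordinates of \<open>(real^2)^'n\<close> do not have; hence this copy with an arbitrary enumeration order.\<close>

typedef 'a wo = "UNIV :: 'a set" by auto

instance wo :: (finite) finite
proof
  have "finite (Rep_wo ` (UNIV :: 'a wo set))" by simp
  then show "finite (UNIV :: 'a wo set)"
    by (rule finite_imageD) (simp add: inj_on_def Rep_wo_inject)
qed

instantiation wo :: (finite) wellorder
begin

definition less_eq_wo :: "'a wo \<Rightarrow> 'a wo \<Rightarrow> bool" where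
  "less_eq_wo x y \<longleftrightarrow> to_nat (Rep_wo x) \<le> to_nat (Rep_wo y)"

definition less_wo :: "'a wo \<Rightarrow> 'a wo \<Rightarrow> bool" where
  "less_wo x y \<longleftrightarrow> to_nat (Rep_wo x) < to_nat (Rep_wo y)"

instance
proof
  fix P :: "'a wo \<Rightarrow> bool" and a
  assume step: "\<And>x. (\<And>y. y < x \<Longrightarrow> P y) \<Longrightarrow> P x"
  show "P a"
    by (rule measure_induct_rule[of "\<lambda>x. to_nat (Rep_wo x)"]) (use step less_wo_def in blast)
qed (auto simp: less_eq_wo_def less_wo_def Rep_wo_inject)

end

text \<open>There is no term of first order in \<delta>. In the Leibniz formula a permutation other
  than \<open>id\<close> moves at least two indices and so contributes two small factors; for
  \<open>id\<close>, the vanishing trace removes the linear part of the logarithm of the diagonal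
  product.\<close>

lemma det_one_plus_traceless_ge:
  fixes A :: "real^'d^'d" and \<delta> :: real
  assumes bd: "\<And>i j. \<bar>A$i$j\<bar> \<le> \<delta>" and small: "\<delta> \<le> 1/2" and tr: "(\<Sum>i\<in>UNIV. A$i$i) = 0"
  shows "det (mat 1 + A) \<ge> 1 - (2 * CARD('d) + card {p. p permutes (UNIV::'d set)} * 2 ^ CARD('d)) * \<delta>\<^sup>2"
proof -
  let ?B = "mat 1 + A" and ?P = "{p. p permutes (UNIV::'d set)}"
  let ?t = "\<lambda>p. of_int (sign p) * (\<Prod>i\<in>UNIV. ?B$i$p i)"
  have \<delta>: "\<delta> \<ge> 0" using bd[of undefined undefined] by linarith
  have finP: "finite ?P" by (simp add: finite_permutations)
  have off: "\<bar>?t p\<bar> \<le> 2 ^ CARD('d) * \<delta>\<^sup>2" if p: "p \<in> ?P" "p \<noteq> id" for p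
  proof -
    obtain i where i: "p i \<noteq> i" using p(2) by (auto simp: fun_eq_iff)
    have "inj p" using p(1) by (simp add: permutes_inj)
    then have j: "p (p i) \<noteq> p i" using i by (auto dest: injD)
    let ?S = "{i, p i}"
    have "\<bar>?t p\<bar> = (\<Prod>k\<in>UNIV. \<bar>?B$k$p k\<bar>)" by (simp add: abs_mult abs_prod sign_def)
    also have "\<dots> \<le> (\<Prod>k\<in>UNIV. if k \<in> ?S then \<delta> else 2)"
    proof (rule prod_mono, safe)
      fix k :: 'd
      show "\<bar>?B$k$p k\<bar> \<le> (if k \<in> ?S then \<delta> else 2)"
        using bd[of k "p k"] small i j by (auto simp: mat_def)
    qed auto
    also have "\<dots> = \<delta> ^ card ?S * 2 ^ card (- ?S)"
    proof -
      have "{x. x = i \<or> x = p i} = ?S" by auto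
      then show ?thesis by (subst prod.If_cases) (auto simp: Collect_neg_eq)
    qed
    also have "\<dots> \<le> \<delta>\<^sup>2 * 2 ^ CARD('d)"
    proof -
      have "card ?S = 2" using i by auto
      moreover have "(2::real) ^ card (- ?S) \<le> 2 ^ CARD('d)" by (intro power_increasing card_mono) auto
      ultimately show ?thesis by (simp only:) (intro mult_left_mono, auto)
    qed
    finally show ?thesis by (simp add: mult.commute)
  qed
  have "(\<Prod>i\<in>UNIV. ?B$i$i) = exp (\<Sum>i\<in>UNIV. ln (1 + A$i$i))"
  proof -
    have "exp (ln (1 + A$i$i)) = ?B$i$i" for i
      using bd[of i i] small by (auto simp: mat_def)
    then show ?thesis by (simp add: exp_sum)
  qed
  also have "\<dots> \<ge> exp (\<Sum>i\<in>(UNIV::'d set). A$i$i - 2 * \<delta>\<^sup>2)"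
  proof -
    have "A$i$i - 2 * \<delta>\<^sup>2 \<le> ln (1 + A$i$i)" for i
    proof -
      have "\<bar>ln (1 + A$i$i) - A$i$i\<bar> \<le> 2 * (A$i$i)\<^sup>2"
        using bd[of i i] small by (intro abs_ln_one_plus_x_minus_x_bound) auto
      moreover have "(A$i$i)\<^sup>2 \<le> \<delta>\<^sup>2" using bd[of i i] by (metis abs_ge_zero power2_abs power_mono)
      ultimately show ?thesis by linarith
    qed
    then show ?thesis by (simp add: sum_mono)
  qed
  also have "(\<Sum>i\<in>(UNIV::'d set). A$i$i - 2 * \<delta>\<^sup>2) = - (2 * CARD('d) * \<delta>\<^sup>2)"
    by (simp add: sum_subtractf tr)
  finally have "(\<Prod>i\<in>UNIV. ?B$i$i) \<ge> 1 - 2 * CARD('d) * \<delta>\<^sup>2"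
    using exp_ge_add_one_self[of "- (2 * CARD('d) * \<delta>\<^sup>2)"] by linarith
  moreover have "det ?B = ?t id + sum ?t (?P - {id})"
    unfolding det_def by (rule sum.remove) (auto simp: finP permutes_id)
  moreover have "\<bar>sum ?t (?P - {id})\<bar> \<le> card ?P * (2 ^ CARD('d) * \<delta>\<^sup>2)"
  proof -
    have "\<bar>sum ?t (?P - {id})\<bar> \<le> (\<Sum>p\<in>?P - {id}. 2 ^ CARD('d) * \<delta>\<^sup>2)"
      by (rule order_trans[OF sum_abs]) (intro sum_mono off, auto)
    also have "\<dots> \<le> (\<Sum>p\<in>?P. 2 ^ CARD('d) * \<delta>\<^sup>2)"
      by (rule sum_mono2) (auto simp: finP)
    finally show ?thesis by simp
  qed
  ultimately show ?thesis by (simp add: sign_id algebra_simps)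
qed

text \<open>The injective Euler map sends the preimage of \<open>B\<close> into \<open>B\<close>
  and, by the determinant estimate for the traceless matrix of \<open>h\<close> times the
  derivative, shrinks volumes at most by the stated factor.\<close>

lemma euler_step_emeasure_vec:
  fixes V :: "real^('d::{finite,wellorder}) \<Rightarrow> real^('d::_)"
  defines "c \<equiv> 2 * CARD('d::{finite,wellorder}) + card {p. p permutes (UNIV::('d::{finite,wellorder}) set)} * 2 ^ CARD('d::{finite,wellorder})"
  assumes der: "\<And>x. (V has_derivative V' x) (at x)"
    and bd: "\<And>x i j. \<bar>V' x (axis j 1) $ i\<bar> \<le> L"
    and tr: "\<And>x. (\<Sum>i\<in>UNIV. V' x (axis i 1) $ i) = 0"
    and h: "h \<ge> 0" "h * L \<le> 1/2"
    and inj: "inj (\<lambda>x. x + h *\<^sub>R V x)"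
    and B: "B \<in> sets borel"
  shows "ennreal (1 - c * (h * L)\<^sup>2) * emeasure lborel ((\<lambda>x. x + h *\<^sub>R V x) -` B) \<le> emeasure lborel B"
proof (cases "1 - c * (h * L)\<^sup>2 \<ge> 0")
  case False
  then show ?thesis by (simp add: ennreal_neg)
next
  case True
  let ?E = "\<lambda>x. x + h *\<^sub>R V x" and ?c = "1 - c * (h * L)\<^sup>2"
  let ?E' = "\<lambda>x v. v + h *\<^sub>R V' x v"
  have dE: "(?E has_derivative ?E' x) (at x)" for x
    by (auto intro!: derivative_eq_intros der)
  have contE: "continuous_on UNIV ?E"
    using has_derivative_continuous[OF dE] by (auto simp: continuous_on_eq_continuous_at)
  then have [measurable]: "?E \<in> borel_measurable borel"
    by (rule borel_measurable_continuous_onI)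
  have det: "\<bar>det (matrix (?E' x))\<bar> \<ge> ?c" for x
  proof -
    have "matrix (?E' x) = mat 1 + (\<chi> i j. h * V' x (axis j 1) $ i)"
      by (auto simp: matrix_def vec_eq_iff mat_def axis_def)
    moreover have "det (mat 1 + (\<chi> i j. h * V' x (axis j 1) $ i)) \<ge> ?c"
      unfolding c_def
    proof (rule det_one_plus_traceless_ge)
      show "\<bar>(\<chi> i j. h * V' x (axis j 1) $ i) $ i $ j\<bar> \<le> h * L" for i j
        using bd[of x j i] h(1) by (simp add: abs_mult mult_left_mono)
      show "(\<Sum>i\<in>UNIV. (\<chi> i j. h * V' x (axis j 1) $ i) $ i $ i) = 0"
        using tr[of x] by (simp add: sum_distrib_left[symmetric])
    qed (use h in auto)
    ultimately show ?thesis by simp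
  qed
  \<comment> \<open>Bounded pieces have finite measure, which the change of variables works with;
    they exhaust the preimage.\<close>
  define S where "S n = ?E -` B \<inter> cball 0 (real n)" for n :: nat
  have Sb[measurable]: "S n \<in> sets borel" for n
    unfolding S_def using measurable_sets[OF \<open>?E \<in> _\<close> B] by auto
  have Sl: "S n \<in> lmeasurable" for n
  proof (intro bounded_set_imp_lmeasurable)
    show "bounded (S n)" by (rule bounded_subset[OF bounded_cball[of 0 "real n"]]) (auto simp: S_def)
    show "S n \<in> sets lebesgue" using Sb[of n] by auto
  qed
  have "ennreal ?c * emeasure lborel (S n) \<le> emeasure lborel B" for n
  proof -
    have leb: "?E ` S n \<in> sets lebesgue"
      using Sl dE by (intro differentiable_image_in_sets_lebesgue)
        (auto simp: differentiable_on_def differentiable_def intro: has_derivative_at_withinI)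
    have "bounded (?E ` S n)"
      by (rule bounded_subset[of "?E ` cball 0 (real n)"])
        (auto simp: S_def intro!: compact_imp_bounded compact_continuous_image continuous_on_subset[OF contE])
    with leb have im: "?E ` S n \<in> lmeasurable" by (intro bounded_set_imp_lmeasurable)
    have "((\<lambda>x. \<bar>det (matrix (?E' x))\<bar>) has_integral measure lebesgue (?E ` S n)) (S n)"
      using has_measure_differentiable_image[of "S n" ?E ?E' "measure lebesgue (?E ` S n)"] im Sl dE inj
      by (auto intro: has_derivative_at_withinI inj_on_subset)
    then have "?c * measure lebesgue (S n) \<le> measure lebesgue (?E ` S n)"
      if "((\<lambda>x. ?c * 1) has_integral ?c * measure lebesgue (S n)) (S n)"
      by (rule has_integral_le[OF that]) (use det in simp)
    moreover have "((\<lambda>x. ?c * 1) has_integral ?c * measure lebesgue (S n)) (S n)"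
      using Sl[of n] lmeasure_integral[OF Sl[of n]] by (intro has_integral_mult_right)
        (simp add: has_integral_iff lmeasurable_iff_integrable_on)
    ultimately have "ennreal ?c * emeasure lebesgue (S n) \<le> emeasure lebesgue (?E ` S n)"
      using im Sl True
      by (simp add: emeasure_eq_measure2 ennreal_mult[symmetric] emeasure_eq_ennreal_measure fmeasurableD2)
    also have "\<dots> \<le> emeasure lebesgue B"
      using B by (intro emeasure_mono) (auto simp: S_def)
    finally show ?thesis using B by simp
  qed
  moreover have sup: "(SUP n. emeasure lborel (S n)) = emeasure lborel (\<Union>n. S n)"
  proof (rule SUP_emeasure_incseq)
    show "incseq S" by (force simp: S_def incseq_def)
  qed (use Sb in auto)
  moreover have un: "(\<Union>n. S n) = ?E -` B"
    using real_arch_simple by (auto simp: S_def)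
  moreover have "ennreal ?c * emeasure lborel (?E -` B) = (SUP n. ennreal ?c * emeasure lborel (S n))"
    by (simp only: un[symmetric] sup[symmetric] SUP_mult_left_ennreal)
  ultimately show ?thesis by (simp only:) (rule SUP_least)
qed

text \<open>Each step commits an error of at most \<open>L * M * h * h\<close>, because the solution
  moves by at most \<open>M * h\<close> in that time, and earlier errors grow by the factor
  \<open>exp (L * h)\<close>. Over \<open>n\<close> steps of length \<open>t / n\<close> the total
  is of order \<open>1 / n\<close>.\<close>

lemma euler_converges:
  fixes V :: "'a::euclidean_space \<Rightarrow> 'a"
  assumes lip: "\<And>x y. norm (V x - V y) \<le> L * norm (x - y)" and L: "L > 0"
    and bnd: "\<And>x. norm (V x) \<le> M"
    and X: "\<And>s. s \<ge> 0 \<Longrightarrow> (X has_vector_derivative V (X s)) (at s within {0..})"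
    and t: "t > 0"
  shows "(\<lambda>n. ((\<lambda>x. x + (t / real n) *\<^sub>R V x) ^^ n) (X 0)) \<longlonglongrightarrow> X t"
proof -
  have Xlip: "norm (X v - X u) \<le> M * (v - u)" if "0 \<le> u" "u \<le> v" for u v
  proof -
    have "norm (X v - X u) \<le> M * norm (v - u)"
      using that by (intro vector_derivative_bound[where S="{0..}" and f'="\<lambda>s. V (X s)"] X bnd) auto
    then show ?thesis using that by simp
  qed
  have M: "M \<ge> 0" using bnd[of 0] norm_ge_zero order_trans by blast
  have loc: "norm (X (s + h) - (X s + h *\<^sub>R V (X s))) \<le> L * M * h * h" if "0 \<le> s" "0 \<le> h" for s h
  proof -
    have "norm ((X (s+h) - (s+h) *\<^sub>R V (X s)) - (X s - s *\<^sub>R V (X s))) \<le> (L * M * h) * norm ((s+h) - s)"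
    proof (rule vector_derivative_bound[where S="{s..s+h}" and f="\<lambda>u. X u - u *\<^sub>R V (X s)" and f'="\<lambda>u. V (X u) - V (X s)"])
      fix u assume u: "u \<in> {s..s+h}"
      show "((\<lambda>u. X u - u *\<^sub>R V (X s)) has_vector_derivative V (X u) - V (X s)) (at u within {s..s+h})"
        using u that by (auto intro!: derivative_eq_intros has_vector_derivative_within_subset[OF X])
      have "norm (V (X u) - V (X s)) \<le> L * norm (X u - X s)" by (rule lip)
      also have "\<dots> \<le> L * (M * (u - s))" using u that L by (intro mult_left_mono Xlip) auto
      also have "\<dots> \<le> L * (M * h)" using u L M by (intro mult_left_mono) auto
      finally show "norm (V (X u) - V (X s)) \<le> L * M * h" by (simp add: mult.assoc)
    qed (use that in auto)
    then show ?thesis using that by (simp add: algebra_simps)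
  qed
  have err: "norm (X (real k * h) - ((\<lambda>x. x + h *\<^sub>R V x) ^^ k) (X 0)) \<le> real k * exp (L * h * k) * (L * M * h * h)"
    if h: "h \<ge> 0" for k h
  proof (induction k)
    case (Suc k)
    let ?E = "\<lambda>x. x + h *\<^sub>R V x"
    let ?y = "(?E ^^ k) (X 0)" and ?x = "X (real k * h)"
    have E: "norm (?E ?x - ?E ?y) \<le> exp (L * h) * norm (?x - ?y)"
    proof -
      have "norm (?E ?x - ?E ?y) = norm ((?x - ?y) + h *\<^sub>R (V ?x - V ?y))" by (simp add: algebra_simps)
      also have "\<dots> \<le> norm (?x - ?y) + h * (L * norm (?x - ?y))"
        using h by (intro norm_triangle_le add_mono) (auto intro!: mult_left_mono lip)
      also have "\<dots> = (1 + L * h) * norm (?x - ?y)" by (simp add: algebra_simps)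
      also have "\<dots> \<le> exp (L * h) * norm (?x - ?y)"
        by (intro mult_right_mono exp_ge_add_one_self) auto
      finally show ?thesis .
    qed
    have "norm (X (real (Suc k) * h) - ?E ?y) \<le> norm (X (real k * h + h) - ?E ?x) + norm (?E ?x - ?E ?y)"
      by (rule order_trans[OF _ norm_triangle_ineq]) (simp add: algebra_simps)
    also have "\<dots> \<le> L * M * h * h + exp (L * h) * (real k * exp (L * h * k) * (L * M * h * h))"
      using h by (intro add_mono loc order_trans[OF E] mult_left_mono Suc) auto
    also have "\<dots> = L * M * h * h + real k * exp (L * h * Suc k) * (L * M * h * h)"
      by (simp add: exp_add[symmetric] algebra_simps)
    also have "\<dots> \<le> exp (L * h * Suc k) * (L * M * h * h) + real k * exp (L * h * Suc k) * (L * M * h * h)"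
    proof -
      have "1 * (L * M * h * h) \<le> exp (L * h * Suc k) * (L * M * h * h)"
        using L M h by (intro mult_right_mono) auto
      then show ?thesis by simp
    qed
    also have "\<dots> = real (Suc k) * exp (L * h * Suc k) * (L * M * h * h)" by (simp add: algebra_simps)
    finally show ?case by simp
  qed simp
  have "(\<lambda>n. ((\<lambda>x. x + (t / real n) *\<^sub>R V x) ^^ n) (X 0) - X t) \<longlonglongrightarrow> 0"
  proof (rule Lim_null_comparison)
    show "(\<lambda>n. (exp (L * t) * L * M * t * t) * (1 / real n)) \<longlonglongrightarrow> 0"
      by (intro tendsto_mult_right_zero lim_1_over_n)
    show "\<forall>\<^sub>F n in sequentially. norm (((\<lambda>x. x + (t / real n) *\<^sub>R V x) ^^ n) (X 0) - X t)
        \<le> (exp (L * t) * L * M * t * t) * (1 / real n)"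
      using eventually_gt_at_top[of 0]
    proof eventually_elim
      case (elim n)
      then show ?case using err[of "t / real n" n] t by (simp add: norm_minus_commute field_simps)
    qed
  qed
  then show ?thesis by (simp add: LIM_zero_iff)
qed

text \<open>The iterated Euler maps enlarge the measure of preimages at most by a factor tending to
  1, but they converge only pointwise. Fatou's lemma handles open sets, whose indicators are lower
  semicontinuous, and outer regularity then handles all Borel sets.\<close>

lemma flow_emeasure_le:
  fixes V :: "'a::euclidean_space \<Rightarrow> 'a" and \<phi> :: "real \<Rightarrow> 'a \<Rightarrow> 'a"
  assumes lip: "\<And>x y. norm (V x - V y) \<le> L * norm (x - y)" and L: "L > 0"
    and bnd: "\<And>x. norm (V x) \<le> M"
    and \<phi>0: "\<And>x. \<phi> 0 x = x"
    and \<phi>: "\<And>x s. s \<ge> 0 \<Longrightarrow> ((\<lambda>s. \<phi> s x) has_vector_derivative V (\<phi> s x)) (at s within {0..})"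
    and step: "\<And>h B. 0 < h \<Longrightarrow> h < h0 \<Longrightarrow> B \<in> sets borel \<Longrightarrow>
       ennreal (1 - c * h\<^sup>2) * emeasure lborel ((\<lambda>x. x + h *\<^sub>R V x) -` B) \<le> emeasure lborel B"
    and h0: "h0 > 0" and c: "c \<ge> 0" and t: "t \<ge> 0"
    and meas[measurable]: "\<phi> t \<in> borel_measurable borel"
    and B: "B \<in> sets borel"
  shows "emeasure lborel (\<phi> t -` B) \<le> emeasure lborel B"
proof (cases "t = 0")
  case True
  then have "\<phi> t -` B = B" using \<phi>0 by auto
  then show ?thesis by simp
next
  case False
  then have t: "t > 0" using t by simp
  define E where "E h x = x + h *\<^sub>R V x" for h x
  have "continuous_on UNIV V"
    by (rule continuous_on_of_norm_lipschitz[OF L lip])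
  then have [measurable]: "E h \<in> borel_measurable borel" for h
    unfolding E_def by (intro borel_measurable_continuous_onI continuous_intros)
  have [measurable]: "(E h ^^ k) \<in> borel_measurable borel" for h k
    by (induction k) (auto intro: measurable_compose)
  have iter: "ennreal ((1 - c * h\<^sup>2) ^ k) * emeasure lborel ((E h ^^ k) -` B) \<le> emeasure lborel B"
    if h: "0 < h" "h < h0" "c * h\<^sup>2 \<le> 1" and B: "B \<in> sets borel" for h k B
  proof (induction k)
    case (Suc k)
    have 1: "(E h ^^ Suc k) -` B = E h -` ((E h ^^ k) -` B)"
      by (simp add: vimage_comp funpow_swap1 comp_def)
    have 2: "(E h ^^ k) -` B \<in> sets borel"
      using measurable_sets[OF \<open>(E h ^^ k) \<in> _\<close> B] by simp
    have "ennreal ((1 - c * h\<^sup>2) ^ Suc k) * emeasure lborel ((E h ^^ Suc k) -` B)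
      = ennreal ((1 - c * h\<^sup>2) ^ k) * (ennreal (1 - c * h\<^sup>2) * emeasure lborel (E h -` ((E h ^^ k) -` B)))"
      unfolding 1 using h by (simp add: ennreal_mult mult_ac)
    also have "\<dots> \<le> ennreal ((1 - c * h\<^sup>2) ^ k) * emeasure lborel ((E h ^^ k) -` B)"
      using step[OF h(1,2) 2] unfolding E_def by (intro mult_left_mono) auto
    also note Suc
    finally show ?case .
  qed simp
  \<comment> \<open>The lower bound that Bernoulli's inequality gives for the accumulated factor
    \<open>(1 - c * (t / n)\<^sup>2) ^ n\<close>; it tends to 1.\<close>
  define q where "q n = 1 - c * t\<^sup>2 * (1 / real n)" for n :: nat
  have q1: "q \<longlonglongrightarrow> 1"
    unfolding q_def by (rule tendsto_eq_intros tendsto_mult_right_zero lim_1_over_n refl | simp)+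
  have ev: "\<forall>\<^sub>F n in sequentially. \<forall>U\<in>sets borel. ennreal (q n) * emeasure lborel ((E (t / real n) ^^ n) -` U) \<le> emeasure lborel U"
  proof -
    have "\<forall>\<^sub>F n in sequentially. t * (1 / real n) < h0"
      by (rule order_tendstoD(2)[OF tendsto_mult_right_zero[OF lim_1_over_n] h0])
    moreover have "\<forall>\<^sub>F n in sequentially. c * t\<^sup>2 * (1 / real n) < 1"
      by (rule order_tendstoD(2)[OF tendsto_mult_right_zero[OF lim_1_over_n]]) simp
    ultimately show ?thesis using eventually_gt_at_top[of 0]
    proof eventually_elim
      case (elim n)
      let ?h = "t / real n"
      have ch: "c * ?h\<^sup>2 \<le> c * t\<^sup>2 * (1 / real n)"
      proof -
        have "(1 / real n)\<^sup>2 \<le> 1 / real n" using elim by (simp add: power2_eq_square field_simps)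
        from mult_left_mono[OF this, of "c * t\<^sup>2"] c show ?thesis by (simp add: power_divide)
      qed
      have ch1: "c * ?h\<^sup>2 \<le> 1" using order_trans[OF ch less_imp_le[OF elim(2)]] .
      have "q n = 1 + real n * (- (c * ?h\<^sup>2))"
        using elim by (simp add: q_def power2_eq_square field_simps)
      also have "\<dots> \<le> (1 + - (c * ?h\<^sup>2)) ^ n"
        using ch1 by (intro Bernoulli_inequality) linarith
      finally have qn: "q n \<le> (1 - c * ?h\<^sup>2) ^ n" by simp
      show ?case
      proof
        fix U :: "'a set" assume "U \<in> sets borel"
        then have "ennreal ((1 - c * ?h\<^sup>2) ^ n) * emeasure lborel ((E ?h ^^ n) -` U) \<le> emeasure lborel U"
          using elim(1,3) t by (intro iter[OF _ _ ch1]) simp_all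
        then show "ennreal (q n) * emeasure lborel ((E ?h ^^ n) -` U) \<le> emeasure lborel U"
          by (rule order_trans[rotated]) (intro mult_right_mono ennreal_leI qn, simp)
      qed
    qed
  qed
  have op: "emeasure lborel (\<phi> t -` U) \<le> emeasure lborel U" if U: "open U" for U
  proof -
    have Ub[measurable]: "U \<in> sets borel" using U by auto
    have "emeasure lborel (\<phi> t -` U) = (\<integral>\<^sup>+x. indicator (\<phi> t -` U) x \<partial>lborel)"
      using measurable_sets[OF meas Ub] by simp
    also have "\<dots> \<le> (\<integral>\<^sup>+x. liminf (\<lambda>n. ennreal (q n) * indicator U ((E (t / real n) ^^ n) x)) \<partial>lborel)"
    proof (rule nn_integral_mono)
      fix x
      show "indicator (\<phi> t -` U) x \<le> liminf (\<lambda>n. ennreal (q n) * indicator U ((E (t / real n) ^^ n) x))"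
      proof (cases "\<phi> t x \<in> U")
        case True
        have "(\<lambda>n. (E (t / real n) ^^ n) x) \<longlonglongrightarrow> \<phi> t x"
          using euler_converges[OF lip L bnd \<phi>[where x=x] t] by (simp add: E_def[abs_def] \<phi>0)
        then have "\<forall>\<^sub>F n in sequentially. (E (t / real n) ^^ n) x \<in> U"
          by (rule topological_tendstoD[OF _ U True])
        then have "\<forall>\<^sub>F n in sequentially. ennreal (q n) = ennreal (q n) * indicator U ((E (t / real n) ^^ n) x)"
          by eventually_elim simp
        with tendsto_ennrealI[OF q1] have "(\<lambda>n. ennreal (q n) * indicator U ((E (t / real n) ^^ n) x)) \<longlonglongrightarrow> ennreal 1"
          by (rule Lim_transform_eventually)
        then show ?thesis using True by (simp add: lim_imp_Liminf)
      qed simp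
    qed
    also have "\<dots> \<le> liminf (\<lambda>n. \<integral>\<^sup>+x. ennreal (q n) * indicator U ((E (t / real n) ^^ n) x) \<partial>lborel)"
      by (rule nn_integral_liminf) measurable
    also have "\<dots> = liminf (\<lambda>n. ennreal (q n) * emeasure lborel ((E (t / real n) ^^ n) -` U))"
    proof -
      have "(\<integral>\<^sup>+x. ennreal (q n) * indicator U ((E (t / real n) ^^ n) x) \<partial>lborel)
        = ennreal (q n) * emeasure lborel ((E (t / real n) ^^ n) -` U)" for n
      proof -
        have "(E (t / real n) ^^ n) -` U \<in> sets borel"
          using measurable_sets[OF \<open>\<And>h k. (E h ^^ k) \<in> _\<close> Ub] by simp
        then show ?thesis
          by (subst nn_integral_cmult_indicator[symmetric]) (auto intro!: nn_integral_cong simp: indicator_def)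
      qed
      then show ?thesis by simp
    qed
    also have "\<dots> \<le> emeasure lborel U"
    proof -
      have "\<forall>\<^sub>F n in sequentially. ennreal (q n) * emeasure lborel ((E (t / real n) ^^ n) -` U) \<le> emeasure lborel U"
        using ev by eventually_elim (use Ub in auto)
      then show ?thesis
        using Liminf_mono[of _ "\<lambda>n. emeasure lborel U" sequentially] by (simp add: Liminf_const)
    qed
    finally show ?thesis .
  qed
  show ?thesis
  proof (rule ennreal_le_epsilon)
    fix e :: real assume "e > 0"
    then obtain U where U: "open U" "B \<subseteq> U" "emeasure lborel (U - B) < ennreal e"
      using outer_regular_lborel[OF B] by metis
    have "emeasure lborel (\<phi> t -` B) \<le> emeasure lborel (\<phi> t -` U)"
      using measurable_sets[OF meas, of U] U by (intro emeasure_mono) auto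
    also have "\<dots> \<le> emeasure lborel U" using op U by simp
    also have "\<dots> = emeasure lborel B + emeasure lborel (U - B)"
      using U B by (subst plus_emeasure) (auto simp: Un_absorb1)
    also have "\<dots> \<le> emeasure lborel B + ennreal e" using U by (intro add_left_mono) auto
    finally show "emeasure lborel (\<phi> t -` B) \<le> emeasure lborel B + ennreal e" .
  qed
qed

lemma flow_nn_integral_le:
  assumes "\<And>B. B \<in> sets borel \<Longrightarrow> emeasure lborel (\<phi> -` B) \<le> emeasure lborel B"
    and [measurable]: "\<phi> \<in> borel_measurable borel" "f \<in> borel_measurable borel"
  shows "(\<integral>\<^sup>+x. f (\<phi> x) \<partial>lborel) \<le> (\<integral>\<^sup>+x. f x \<partial>lborel)"
proof -
  have "(\<integral>\<^sup>+x. f (\<phi> x) \<partial>lborel) = (\<integral>\<^sup>+x. f x \<partial>distr lborel borel \<phi>)"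
    by (subst nn_integral_distr) auto
  also have "\<dots> \<le> (\<integral>\<^sup>+x. f x \<partial>lborel)"
  proof (rule nn_integral_mono_measure)
    have "emeasure (distr lborel borel \<phi>) B \<le> emeasure lborel B" for B
      by (cases "B \<in> sets borel") (simp_all add: emeasure_distr assms emeasure_notin_sets)
    then show "distr lborel borel \<phi> \<le> lborel"
      by (simp add: le_measure_iff le_fun_def)
  qed simp
  finally show ?thesis .
qed

section \<open>Displacement of clusters\<close>

lemma first_hitting_time:
  fixes f :: "'p \<Rightarrow> real \<Rightarrow> real"
  assumes fin: "finite P" and cont: "\<And>p. p \<in> P \<Longrightarrow> continuous_on {s..v} (f p)"
    and s: "\<And>p. p \<in> P \<Longrightarrow> f p s > c"
    and p: "p \<in> P" and t: "t \<in> {s..v}" "f p t \<le> c"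
  shows "\<exists>\<tau>\<in>{s..v}. \<exists>q\<in>P. f q \<tau> = c \<and> (\<forall>r\<in>P. \<forall>u\<in>{s..\<tau>}. f r u \<ge> c)"
proof -
  define Z where "Z = (\<Union>p\<in>P. {t\<in>{s..v}. f p t \<le> c})"
  have "closed Z" unfolding Z_def
    by (intro closed_UN fin continuous_on_closed_Collect_le ballI continuous_on_const cont closed_atLeastAtMost) auto
  moreover have "bounded Z"
    by (rule bounded_subset[of "{s..v}"]) (auto simp: Z_def)
  ultimately have "compact Z" by (simp add: compact_eq_bounded_closed)
  moreover have "Z \<noteq> {}" using p t by (auto simp: Z_def)
  ultimately have "\<exists>\<tau>\<in>Z. \<forall>u\<in>Z. \<tau> \<le> u" by (rule compact_attains_inf)
  then obtain \<tau> where \<tau>: "\<tau> \<in> Z" "\<And>u. u \<in> Z \<Longrightarrow> \<tau> \<le> u" by blast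
  have \<tau>v: "\<tau> \<in> {s..v}" using \<tau>(1) by (auto simp: Z_def)
  have before: "f r u > c" if "r \<in> P" "s \<le> u" "u < \<tau>" for r u
    using \<tau>(2)[of u] that \<tau>v by (force simp: Z_def not_le[symmetric])
  \<comment> \<open>By the intermediate value theorem, a value below \<open>c\<close> at \<tau>
    would be preceded by the value \<open>c\<close>, against the minimality of \<tau>.\<close>
  have at: "f r \<tau> \<ge> c" if r: "r \<in> P" for r
  proof (rule ccontr)
    assume neg: "\<not> f r \<tau> \<ge> c"
    have "\<exists>u\<ge>s. u \<le> \<tau> \<and> f r u = c"
      using neg s[OF r] \<tau>v by (intro IVT2' continuous_on_subset[OF cont[OF r]]) auto
    then show False using before[OF r] neg by (metis less_irrefl order_refl order_less_le)
  qed
  obtain q where q: "q \<in> P" "f q \<tau> \<le> c" using \<tau>(1) by (auto simp: Z_def)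
  have "f q \<tau> = c" using at[OF q(1)] q(2) by simp
  moreover have "f r u \<ge> c" if "r \<in> P" "u \<in> {s..\<tau>}" for r u
    using before[of r u] at[of r] that by (cases "u = \<tau>") auto
  ultimately show ?thesis using \<tau>v q(1) by blast
qed

text \<open>Bootstrap: the weak bound 1 up to time \<open>b\<close> implies the strong bound 2 at
  \<open>b\<close>, so a first time with value exactly 1 cannot exist.\<close>

lemma barrier_forward:
  fixes f :: "'p \<Rightarrow> real \<Rightarrow> real"
  assumes fin: "finite P" and cont: "\<And>p. p \<in> P \<Longrightarrow> continuous_on {s..v} (f p)"
    and s: "\<And>p. p \<in> P \<Longrightarrow> f p s \<ge> 2"
    and step: "\<And>b p. s \<le> b \<Longrightarrow> b \<le> v \<Longrightarrow> p \<in> P \<Longrightarrow> (\<forall>q\<in>P. \<forall>t\<in>{s..b}. f q t \<ge> 1) \<Longrightarrow> f p b \<ge> 2"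
    and p: "p \<in> P" and t: "t \<in> {s..v}"
  shows "f p t \<ge> 1"
proof (rule ccontr)
  assume neg: "\<not> f p t \<ge> 1"
  have "\<exists>\<tau>\<in>{s..v}. \<exists>q\<in>P. f q \<tau> = 1 \<and> (\<forall>r\<in>P. \<forall>u\<in>{s..\<tau>}. f r u \<ge> 1)"
  proof (rule first_hitting_time[OF fin cont _ p t])
    show "f p s > 1" if "p \<in> P" for p using s[OF that] by simp
  qed (use neg in simp_all)
  then obtain \<tau> q where "\<tau> \<in> {s..v}" "q \<in> P" "f q \<tau> = 1" "\<forall>r\<in>P. \<forall>u\<in>{s..\<tau>}. f r u \<ge> 1"
    by blast
  then show False using step[of \<tau> q] by auto
qed

text \<open>The time \<open>s\<close> of known separation may lie anywhere in the interval, so the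
  bootstrap runs forwards from \<open>s\<close> and, after time reversal, backwards from
  \<open>s\<close>.\<close>

lemma barrier:
  fixes f :: "'p \<Rightarrow> real \<Rightarrow> real"
  assumes fin: "finite P" and cont: "\<And>p. p \<in> P \<Longrightarrow> continuous_on {u..v} (f p)"
    and su: "s \<in> {u..v}" and s: "\<And>p. p \<in> P \<Longrightarrow> f p s \<ge> 2"
    and step: "\<And>a b p t. u \<le> a \<Longrightarrow> a \<le> s \<Longrightarrow> s \<le> b \<Longrightarrow> b \<le> v \<Longrightarrow> p \<in> P \<Longrightarrow> t \<in> {a..b} \<Longrightarrow>
        (\<forall>q\<in>P. \<forall>t\<in>{a..b}. f q t \<ge> 1) \<Longrightarrow> f p t \<ge> 2"
    and p: "p \<in> P" and t: "t \<in> {u..v}"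
  shows "f p t \<ge> 1"
proof (cases "t \<ge> s")
  case True
  show ?thesis
  proof (rule barrier_forward[where f=f and P=P and s=s and v=v, OF fin _ s])
    show "continuous_on {s..v} (f p)" if "p \<in> P" for p
      using su by (intro continuous_on_subset[OF cont[OF that]]) auto
    show "f p b \<ge> 2" if "s \<le> b" "b \<le> v" "p \<in> P" "\<forall>q\<in>P. \<forall>t\<in>{s..b}. f q t \<ge> 1" for b p
      using step[of s b p b] that su by auto
  qed (use True t p in auto)
next
  case False
  have "(\<lambda>p t. f p (-t)) p (-t) \<ge> 1"
  proof (rule barrier_forward[where f="\<lambda>p t. f p (-t)" and s="-s" and v="-u", OF fin])
    show "continuous_on {- s..- u} (\<lambda>t. f p (-t))" if "p \<in> P" for p
      using su by (intro continuous_on_compose2[OF cont[OF that]] continuous_intros) auto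
    show "f p (-b) \<ge> 2" if "-s \<le> b" "b \<le> -u" "p \<in> P" "\<forall>q\<in>P. \<forall>t\<in>{-s..b}. f q (-t) \<ge> 1" for b p
    proof (rule step[of "-b" s p "-b"])
      show "\<forall>q\<in>P. \<forall>t\<in>{-b..s}. f q t \<ge> 1"
      proof (intro ballI)
        fix q t assume "q \<in> P" "t \<in> {-b..s}"
        then show "f q t \<ge> 1" using that(4)[rule_format, of q "-t"] by auto
      qed
    qed (use that su in auto)
  qed (use False t s p in auto)
  then show ?thesis by simp
qed

text \<open>No cut of \<open>J\<close> leaves a gap of width \<open>D\<close>, so the points of
  \<open>J\<close> within \<open>k * D\<close> of \<open>i\<close> increase in number with
  \<open>k\<close> until they exhaust \<open>J\<close>.\<close>

lemma connected_cluster_diameter: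
  fixes x :: "'n \<Rightarrow> 'a::real_normed_vector" and D :: real
  assumes fin: "finite J" and D: "D \<ge> 0" and ij: "i \<in> J" "j \<in> J"
    and conn: "\<And>A. A \<subset> J \<Longrightarrow> A \<noteq> {} \<Longrightarrow> \<exists>a\<in>A. \<exists>b\<in>J - A. norm (x a - x b) < D"
  shows "norm (x i - x j) \<le> card J * D"
proof -
  define A where "A k = {l\<in>J. norm (x i - x l) \<le> real k * D}" for k
  have sub: "A k \<subseteq> J" for k by (auto simp: A_def)
  have finA: "finite (A k)" for k using fin sub finite_subset by blast
  have mono: "A k \<subseteq> A (Suc k)" for k
    using D by (auto simp: A_def algebra_simps intro: order_trans)
  have "card (A k) \<ge> k + 1 \<or> A k = J" for k
  proof (induction k)
    case 0
    have "i \<in> A 0" using ij by (simp add: A_def)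
    then have "card (A 0) > 0" using finA by (auto simp: card_gt_0_iff)
    then show ?case by simp
  next
    case (Suc k)
    show ?case
    proof (cases "A k = J")
      case True
      then show ?thesis using mono[of k] sub[of "Suc k"] by auto
    next
      case False
      have "i \<in> A k" using ij D by (simp add: A_def)
      with False sub[of k] conn[of "A k"] obtain a b where
        ab: "a \<in> A k" "b \<in> J - A k" "norm (x a - x b) < D" by blast
      have "norm (x i - x b) \<le> norm (x i - x a) + norm (x a - x b)"
        using norm_triangle_ineq[of "x i - x a" "x a - x b"] by simp
      also have "\<dots> \<le> real k * D + D" using ab by (auto simp: A_def)
      finally have "b \<in> A (Suc k)" using ab by (simp add: A_def algebra_simps)
      then have "insert b (A k) \<subseteq> A (Suc k)" using mono by auto
      then have "card (insert b (A k)) \<le> card (A (Suc k))" by (rule card_mono[OF finA])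
      then show ?thesis using Suc False ab finA[of k] by auto
    qed
  qed
  from this[of "card J"] have "j \<in> A (card J)"
  proof
    assume "card J + 1 \<le> card (A (card J))"
    then show ?thesis using card_mono[OF fin sub[of "card J"]] by linarith
  next
    assume "A (card J) = J"
    then show ?thesis using ij(2) by simp
  qed
  then show ?thesis by (simp add: A_def)
qed

text \<open>Newton's third law for the forces inside a cluster. Antisymmetry makes the diagonal
  vanish, so the inner sum can be completed to all of \<open>J\<close> before the order of summation
  is exchanged.\<close>

lemma antisymmetric_double_sum:
  fixes h :: "'n \<Rightarrow> 'n \<Rightarrow> 'a::real_vector"
  assumes "finite J" "\<And>j k. h k j = - h j k"
  shows "(\<Sum>j\<in>J. \<Sum>k\<in>J - {j}. h j k) = 0"
proof -
  have self: "x = 0" if "x = - x" for x :: 'a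
    using that by (metis add_eq_0_iff scaleR_2 scaleR_eq_0_iff zero_neq_numeral)
  have "(\<Sum>j\<in>J. \<Sum>k\<in>J - {j}. h j k) = (\<Sum>j\<in>J. \<Sum>k\<in>J. h j k)"
    using assms(1) self[OF assms(2)] by (intro sum.cong refl sum.mono_neutral_left) auto
  also have "\<dots> = (\<Sum>k\<in>J. \<Sum>j\<in>J. h j k)" by (rule sum.swap)
  also have "\<dots> = - (\<Sum>k\<in>J. \<Sum>j\<in>J. h k j)"
    by (simp add: sum_negf[symmetric] assms(2)[symmetric])
  finally show ?thesis
    using self \<open>(\<Sum>j\<in>J. \<Sum>k\<in>J - {j}. h j k) = (\<Sum>j\<in>J. \<Sum>k\<in>J. h j k)\<close> by metis
qed

text \<open>The vortices in \<open>J\<close> interact among themselves and are subject to an external velocity of size at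
  most \<open>C\<close>. In the applications the latter is produced by vortices at distance at least 1.\<close>

definition driven_cluster ::
  "('n \<Rightarrow> real) \<Rightarrow> 'n set \<Rightarrow> ('a::euclidean_space \<Rightarrow> 'a) \<Rightarrow> real \<Rightarrow> ('n \<Rightarrow> real \<Rightarrow> 'a) \<Rightarrow> real \<Rightarrow> real \<Rightarrow> bool" where
  "driven_cluster g J K C X u v \<longleftrightarrow> (\<forall>j\<in>J. \<forall>t\<in>{u..v}. \<exists>F. norm F \<le> C \<and>
     (X j has_vector_derivative (\<Sum>k\<in>J - {j}. g k *\<^sub>R K (X j t - X k t)) + F) (at t within {u..v}))"

lemma driven_cluster_subinterval:
  assumes "driven_cluster g J K C X u v" "u \<le> a" "b \<le> v"
  shows "driven_cluster g J K C X a b"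
  unfolding driven_cluster_def
proof (intro ballI)
  fix j t assume "j \<in> J" "t \<in> {a..b}"
  then obtain F where "norm F \<le> C"
    "(X j has_vector_derivative (\<Sum>k\<in>J - {j}. g k *\<^sub>R K (X j t - X k t)) + F) (at t within {u..v})"
    using assms unfolding driven_cluster_def by fastforce
  then show "\<exists>F. norm F \<le> C \<and> (X j has_vector_derivative
      (\<Sum>k\<in>J - {j}. g k *\<^sub>R K (X j t - X k t)) + F) (at t within {a..b})"
    using assms by (intro exI[of _ F]) (auto intro: has_vector_derivative_within_subset)
qed

text \<open>The vortices of \<open>J\<close> outside \<open>A\<close> act on those in
  \<open>A\<close> from distance at least 1, hence with speed at most \<open>C0\<close> per unit of
  intensity; their contribution is moved into the external velocity.\<close>

lemma driven_cluster_subset: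
  fixes K :: "'a::euclidean_space \<Rightarrow> 'a"
  assumes drv: "driven_cluster g J K C X u v" and fin: "finite J" and A: "A \<subseteq> J"
    and far: "\<And>y. norm y \<ge> 1 \<Longrightarrow> norm (K y) \<le> C0" and C0: "C0 \<ge> 0"
    and sep: "\<And>a b t. a \<in> A \<Longrightarrow> b \<in> J - A \<Longrightarrow> t \<in> {u..v} \<Longrightarrow> norm (X a t - X b t) \<ge> 1"
  shows "driven_cluster g A K (C + C0 * (\<Sum>j\<in>J. \<bar>g j\<bar>)) X u v"
  unfolding driven_cluster_def
proof (intro ballI)
  fix j t assume j: "j \<in> A" and t: "t \<in> {u..v}"
  then obtain F where F: "norm F \<le> C"
    "(X j has_vector_derivative (\<Sum>k\<in>J - {j}. g k *\<^sub>R K (X j t - X k t)) + F) (at t within {u..v})"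
    using drv A unfolding driven_cluster_def by blast
  let ?e = "\<Sum>k\<in>J - A. g k *\<^sub>R K (X j t - X k t)"
  have "J - {j} = (A - {j}) \<union> (J - A)" using A j by auto
  then have eq: "(\<Sum>k\<in>J - {j}. g k *\<^sub>R K (X j t - X k t)) = (\<Sum>k\<in>A - {j}. g k *\<^sub>R K (X j t - X k t)) + ?e"
    using fin A by (simp only:) (rule sum.union_disjoint, auto intro: finite_subset)
  have "norm ?e \<le> (\<Sum>k\<in>J - A. \<bar>g k\<bar> * C0)"
    by (rule sum_norm_le) (use far sep j t in \<open>auto intro!: mult_left_mono\<close>)
  also have "\<dots> \<le> (\<Sum>k\<in>J. \<bar>g k\<bar> * C0)" using fin C0 by (intro sum_mono2) auto
  finally have "norm (?e + F) \<le> C + C0 * (\<Sum>j\<in>J. \<bar>g j\<bar>)"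
    using F(1) norm_triangle_ineq[of ?e F] by (simp add: sum_distrib_left mult.commute)
  then show "\<exists>F. norm F \<le> C + C0 * (\<Sum>j\<in>J. \<bar>g j\<bar>) \<and> (X j has_vector_derivative
      (\<Sum>k\<in>A - {j}. g k *\<^sub>R K (X j t - X k t)) + F) (at t within {u..v})"
    using F(2) unfolding eq by (intro exI[of _ "?e + F"]) (simp add: add.assoc)
qed

lemma driven_cluster_continuous:
  "driven_cluster g J K C X u v \<Longrightarrow> j \<in> J \<Longrightarrow> continuous_on {u..v} (X j)"
  unfolding driven_cluster_def continuous_on_eq_continuous_within
  using has_vector_derivative_continuous by blast

text \<open>Weighted by the intensities, the internal velocities cancel in pairs because the kernel
  is odd, and only the external velocities move the centre of vorticity.\<close>

lemma centre_of_vorticity_displacement: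
  fixes K :: "'a::euclidean_space \<Rightarrow> 'a"
  assumes drv: "driven_cluster g J K C X u v" and fin: "finite J"
    and odd: "\<And>y. K (- y) = - K y" and st: "s \<in> {u..v}" "t \<in> {u..v}"
  shows "norm ((\<Sum>j\<in>J. g j *\<^sub>R X j t) - (\<Sum>j\<in>J. g j *\<^sub>R X j s)) \<le> (C * (\<Sum>j\<in>J. \<bar>g j\<bar>)) * norm (t - s)"
proof -
  obtain F where F: "\<And>j t. j \<in> J \<Longrightarrow> t \<in> {u..v} \<Longrightarrow> norm (F j t) \<le> C"
    "\<And>j t. j \<in> J \<Longrightarrow> t \<in> {u..v} \<Longrightarrow> (X j has_vector_derivative (\<Sum>k\<in>J - {j}. g k *\<^sub>R K (X j t - X k t)) + F j t) (at t within {u..v})"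
  proof -
    define Q where "Q j t F \<longleftrightarrow> norm F \<le> C \<and> (X j has_vector_derivative
      (\<Sum>k\<in>J - {j}. g k *\<^sub>R K (X j t - X k t)) + F) (at t within {u..v})" for j t F
    have "Q j t (SOME F. Q j t F)" if "j \<in> J" "t \<in> {u..v}" for j t
      using drv that unfolding driven_cluster_def Q_def[symmetric] by (auto intro: someI_ex)
    then show ?thesis using that[of "\<lambda>j t. SOME F. Q j t F"] unfolding Q_def by blast
  qed
  show ?thesis
  proof (rule vector_derivative_bound[where S="{u..v}" and f'="\<lambda>t. \<Sum>j\<in>J. g j *\<^sub>R F j t"])
    fix t assume t: "t \<in> {u..v}"
    have "(\<Sum>j\<in>J. \<Sum>k\<in>J - {j}. (g j * g k) *\<^sub>R K (X j t - X k t)) = 0"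
    proof (rule antisymmetric_double_sum[OF fin])
      fix j k
      show "(g k * g j) *\<^sub>R K (X k t - X j t) = - ((g j * g k) *\<^sub>R K (X j t - X k t))"
        using odd[of "X j t - X k t"] by (simp add: mult.commute)
    qed
    then have "(\<Sum>j\<in>J. g j *\<^sub>R ((\<Sum>k\<in>J - {j}. g k *\<^sub>R K (X j t - X k t)) + F j t)) = (\<Sum>j\<in>J. g j *\<^sub>R F j t)"
      by (simp add: scaleR_add_right sum.distrib scaleR_sum_right)
    moreover have "((\<lambda>t. \<Sum>j\<in>J. g j *\<^sub>R X j t) has_vector_derivative
        (\<Sum>j\<in>J. g j *\<^sub>R ((\<Sum>k\<in>J - {j}. g k *\<^sub>R K (X j t - X k t)) + F j t))) (at t within {u..v})"
      using F(2) t
      by (intro has_vector_derivative_sum bounded_linear.has_vector_derivative[OF bounded_linear_scaleR_right]) auto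
    ultimately show "((\<lambda>t. \<Sum>j\<in>J. g j *\<^sub>R X j t) has_vector_derivative (\<Sum>j\<in>J. g j *\<^sub>R F j t)) (at t within {u..v})"
      by simp
    have "norm (\<Sum>j\<in>J. g j *\<^sub>R F j t) \<le> (\<Sum>j\<in>J. \<bar>g j\<bar> * C)"
      by (rule sum_norm_le) (use F(1) t in \<open>auto intro!: mult_left_mono\<close>)
    then show "norm (\<Sum>j\<in>J. g j *\<^sub>R F j t) \<le> C * (\<Sum>j\<in>J. \<bar>g j\<bar>)"
      by (simp add: sum_distrib_left mult.commute)
  qed (use st in auto)
qed

text \<open>By induction on the cluster. If at some time the cluster splits into two parts that are much
  farther apart than either part can move, then they stay apart for all times and both parts are
  driven clusters. Otherwise the diameter is always bounded, and the cluster cannot leave its centre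
  of vorticity, which exists because the total intensity does not vanish and which moves slowly since
  the internal forces cancel. The bound does not depend on the kernel.\<close>

lemma cluster_displacement_bounded:
  fixes g :: "'n::finite \<Rightarrow> real"
  assumes nz: "\<And>J. J \<noteq> {} \<Longrightarrow> (\<Sum>j\<in>J. g j) \<noteq> 0" and C0: "C0 \<ge> 0" and T: "T \<ge> 0"
  shows "C \<ge> 0 \<Longrightarrow> \<exists>R\<ge>0. \<forall>(K :: 'a::euclidean_space \<Rightarrow> 'a) X u v. (\<forall>y. K (- y) = - K y) \<longrightarrow>
     (\<forall>y. norm y \<ge> 1 \<longrightarrow> norm (K y) \<le> C0) \<longrightarrow> v - u \<le> T \<longrightarrow> driven_cluster g J K C X u v \<longrightarrow>
     (\<forall>j\<in>J. \<forall>s\<in>{u..v}. \<forall>t\<in>{u..v}. norm (X j t - X j s) \<le> R)"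
  using finite[of J]
proof (induction J arbitrary: C rule: finite_psubset_induct)
  case (psubset J)
  show ?case
  proof (cases "J = {}")
    case True
    then show ?thesis by auto
  next
    case False
    define G where "G = (\<Sum>j\<in>J. \<bar>g j\<bar>)"
    have G: "G \<ge> 0" by (auto simp: G_def intro: sum_nonneg)
    \<comment> \<open>The external bound for a subcluster, enlarged by the interaction with the rest
      of \<open>J\<close>; this is why the induction is uniform in \<open>C\<close>.\<close>
    let ?C = "C + C0 * G"
    have C': "?C \<ge> 0" using C0 G psubset.prems by simp
    define Q where "Q A r \<longleftrightarrow> r \<ge> 0 \<and> (\<forall>(K :: 'a \<Rightarrow> 'a) X u v. (\<forall>y. K (- y) = - K y) \<longrightarrow>
     (\<forall>y. norm y \<ge> 1 \<longrightarrow> norm (K y) \<le> C0) \<longrightarrow> v - u \<le> T \<longrightarrow> driven_cluster g A K ?C X u v \<longrightarrow>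
     (\<forall>j\<in>A. \<forall>s\<in>{u..v}. \<forall>t\<in>{u..v}. norm (X j t - X j s) \<le> r))" for A r
    \<comment> \<open>One constant for each proper subcluster. The value 0 elsewhere merely allows
      the sum over \<open>Pow J\<close> that dominates them all.\<close>
    define R where "R A = (if A \<subset> J then SOME r. Q A r else 0)" for A
    have RR: "Q A (R A)" if "A \<subset> J" for A
      using psubset.IH[OF that C'] that unfolding R_def Q_def[symmetric] by (auto intro: someI_ex)
    have R0: "R A \<ge> 0" for A using RR[of A] by (cases "A \<subset> J") (auto simp: Q_def R_def)
    have R: "norm (X j t - X j s) \<le> R A"
      if "A \<subset> J" "\<And>y. K (- y) = - K y" "\<And>y. norm y \<ge> 1 \<Longrightarrow> norm (K y) \<le> C0" "v - u \<le> T"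
        "driven_cluster g A K ?C X u v" "j \<in> A" "s \<in> {u..v}" "t \<in> {u..v}"
      for A and K :: "'a \<Rightarrow> 'a" and X u v j s t
      by (rule RR[OF that(1), unfolded Q_def, THEN conjunct2, rule_format]) (fact that)+
    define R1 where "R1 = (\<Sum>A\<in>Pow J. R A)"
    have R1: "R1 \<ge> 0" unfolding R1_def by (intro sum_nonneg R0)
    have RR1: "R A \<le> R1" if "A \<subset> J" for A
      unfolding R1_def using that R0 by (intro member_le_sum) auto
    \<comment> \<open>If two parts are at distance \<open>D\<close> and no vortex moves by more than
      \<open>R1\<close>, the distance remains at least 2, the strong bound of the bootstrap.\<close>
    define D where "D = 2 + 2 * R1"
    have D: "D \<ge> 2" using R1 by (simp add: D_def)
    define \<Gamma> where "\<Gamma> = \<bar>\<Sum>j\<in>J. g j\<bar>"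
    have \<Gamma>: "\<Gamma> > 0" using nz[OF False] by (simp add: \<Gamma>_def)
    \<comment> \<open>Two deviations from the centre of vorticity, each at most
      \<open>G * (card J * D)\<close>, plus the drift of that centre, divided by the total
      intensity.\<close>
    define R2 where "R2 = (2 * G * (card J * D) + C * G * T) / \<Gamma>"
    have R2: "R2 \<ge> 0" unfolding R2_def using G D C' psubset.prems \<Gamma> T by auto
    have "norm (X j t - X j s) \<le> R1 + R2"
      if odd: "\<And>y. K (- y) = - K y" and far: "\<And>y. norm y \<ge> 1 \<Longrightarrow> norm (K y) \<le> C0"
        and uv: "v - u \<le> T" and drv: "driven_cluster g J K C X u v"
        and j: "j \<in> J" and s: "s \<in> {u..v}" and t: "t \<in> {u..v}"
      for K :: "'a \<Rightarrow> 'a" and X u v j s t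
    proof (cases "\<exists>r\<in>{u..v}. \<exists>A. A \<subset> J \<and> A \<noteq> {} \<and> (\<forall>a\<in>A. \<forall>b\<in>J - A. norm (X a r - X b r) \<ge> D)")
      case True
      then obtain r A where r: "r \<in> {u..v}" and A: "A \<subset> J" "A \<noteq> {}"
        and sep: "\<And>a b. a \<in> A \<Longrightarrow> b \<in> J - A \<Longrightarrow> norm (X a r - X b r) \<ge> D" by blast
      have A': "J - A \<subset> J" using A by auto
      \<comment> \<open>On any subinterval where the two parts stay at distance 1, the induction
        hypothesis applies to both of them.\<close>
      have disp: "norm (X k w - X k z) \<le> R1"
        if "u \<le> a" "b \<le> v" "k \<in> J" "w \<in> {a..b}" "z \<in> {a..b}"
          and sep1: "\<And>k l w. k \<in> A \<Longrightarrow> l \<in> J - A \<Longrightarrow> w \<in> {a..b} \<Longrightarrow> norm (X k w - X l w) \<ge> 1" for a b k w z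
      proof -
        have ab: "driven_cluster g J K C X a b" by (rule driven_cluster_subinterval[OF drv that(1,2)])
        have dA: "driven_cluster g A K ?C X a b"
          unfolding G_def using A by (intro driven_cluster_subset[OF ab _ _ far C0] sep1) auto
        have dA': "driven_cluster g (J - A) K ?C X a b"
          unfolding G_def
        proof (rule driven_cluster_subset[OF ab _ _ far C0])
          fix k l w assume "k \<in> J - A" "l \<in> J - (J - A)" "w \<in> {a..b}"
          then show "norm (X k w - X l w) \<ge> 1" using sep1[of l k w] by (auto simp: norm_minus_commute)
        qed auto
        have T': "b - a \<le> T" using that uv by linarith
        show ?thesis
        proof (cases "k \<in> A")
          case True
          then show ?thesis using R[OF A(1) odd far T' dA True that(5,4)] RR1[OF A(1)] by linarith
        next
          case False
          then have "k \<in> J - A" using that by auto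
          then show ?thesis using R[OF A' odd far T' dA' _ that(5,4)] RR1[OF A'] by fastforce
        qed
      qed
      have sep1: "norm (X a w - X b w) \<ge> 1" if ab: "a \<in> A" "b \<in> J - A" and w: "w \<in> {u..v}" for a b w
      proof -
        have "(\<lambda>p w. norm (X (fst p) w - X (snd p) w)) (a, b) w \<ge> 1"
        proof (rule barrier[where f="\<lambda>p w. norm (X (fst p) w - X (snd p) w)" and P="A \<times> (J - A)" and u=u and v=v and s=r])
          fix p assume "p \<in> A \<times> (J - A)"
          then show "continuous_on {u..v} (\<lambda>w. norm (X (fst p) w - X (snd p) w))"
            using A by (intro continuous_intros driven_cluster_continuous[OF drv]) auto
          show "2 \<le> norm (X (fst p) r - X (snd p) r)"
            using sep[of "fst p" "snd p"] D \<open>p \<in> _\<close> by auto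
        next
          fix a b p w assume a: "u \<le> a" "a \<le> r" "r \<le> b" "b \<le> v" "p \<in> A \<times> (J - A)" "w \<in> {a..b}"
            and *: "\<forall>q\<in>A \<times> (J - A). \<forall>t\<in>{a..b}. 1 \<le> norm (X (fst q) t - X (snd q) t)"
          have "norm (X k w - X k r) \<le> R1" if "k \<in> J" for k
            using that a * by (intro disp[of a b]) auto
          then have "norm (X (fst p) w - X (fst p) r) \<le> R1" "norm (X (snd p) w - X (snd p) r) \<le> R1"
            using a A by auto
          moreover have "norm (X (fst p) r - X (snd p) r) \<ge> D" using sep a by auto
          ultimately show "2 \<le> norm (X (fst p) w - X (snd p) w)"
            unfolding D_def by norm
        qed (use r ab w in auto)
        then show ?thesis by simp
      qed
      have "norm (X j t - X j s) \<le> R1" by (rule disp[OF _ _ j t s sep1]) auto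
      then show ?thesis using R2 by simp
    next
      case False
      \<comment> \<open>At no time is there a gap of width \<open>D\<close>, so the cluster is
        chained together at every time.\<close>
      have diam: "norm (X i w - X k w) \<le> card J * D" if "i \<in> J" "k \<in> J" "w \<in> {u..v}" for i k w
      proof (rule connected_cluster_diameter[of J D i k "\<lambda>i. X i w"])
        show "\<exists>a\<in>A. \<exists>b\<in>J - A. norm (X a w - X b w) < D" if "A \<subset> J" "A \<noteq> {}" for A
          using False that \<open>w \<in> {u..v}\<close> by (meson not_le)
      qed (use that D in auto)
      define B where "B w = (\<Sum>j\<in>J. g j *\<^sub>R X j w)" for w
      have near: "norm ((\<Sum>j\<in>J. g j) *\<^sub>R X j w - B w) \<le> G * (card J * D)" if w: "w \<in> {u..v}" for w
      proof -
        have "(\<Sum>j\<in>J. g j) *\<^sub>R X j w - B w = (\<Sum>k\<in>J. g k *\<^sub>R (X j w - X k w))"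
          by (simp add: B_def scaleR_sum_left scaleR_diff_right sum_subtractf)
        also have "norm \<dots> \<le> (\<Sum>k\<in>J. \<bar>g k\<bar> * (card J * D))"
          by (rule sum_norm_le) (use diam j w in \<open>auto intro!: mult_left_mono\<close>)
        finally show ?thesis by (simp add: G_def sum_distrib_right)
      qed
      have "norm (B t - B s) \<le> (C * G) * norm (t - s)"
        unfolding B_def G_def by (rule centre_of_vorticity_displacement[OF drv _ odd s t]) simp
      also have "\<dots> \<le> C * G * T" using s t uv G psubset.prems by (intro mult_left_mono) auto
      finally have Bts: "norm (B t - B s) \<le> C * G * T" .
      define Y where "Y w = (\<Sum>j\<in>J. g j) *\<^sub>R X j w" for w
      have "\<Gamma> * norm (X j t - X j s) = norm (Y t - Y s)"
        by (simp add: \<Gamma>_def Y_def flip: scaleR_diff_right)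
      also have "\<dots> \<le> norm (Y t - B t) + norm (Y s - B s) + norm (B t - B s)" by norm
      also have "\<dots> \<le> 2 * G * (card J * D) + C * G * T"
        using near[OF s] near[OF t] Bts unfolding Y_def by linarith
      finally have "norm (X j t - X j s) \<le> R2" using \<Gamma> by (simp add: R2_def field_simps)
      then show ?thesis using R1 by simp
    qed
    note main = this
    show ?thesis
    proof (intro exI[of _ "R1 + R2"] conjI allI impI ballI)
      fix K :: "'a \<Rightarrow> 'a" and X u v j s t
      assume "\<forall>y. K (- y) = - K y" "\<forall>y. norm y \<ge> 1 \<longrightarrow> norm (K y) \<le> C0" "v - u \<le> T"
        "driven_cluster g J K C X u v" "j \<in> J" "s \<in> {u..v}" "t \<in> {u..v}"
      then show "norm (X j t - X j s) \<le> R1 + R2"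
        by (intro main[of K v u X j s t]) blast+
    qed (use R1 R2 in simp)
  qed
qed

section \<open>The regularised kernel and vector field\<close>

definition rot :: "real^2 \<Rightarrow> real^2" where
  "rot y = (\<chi> i. if i = 1 then - y $ 2 else y $ 1)"

lemma rot_nth [simp]: "rot y $ 1 = - y $ 2" "rot y $ 2 = y $ 1"
  by (simp_all add: rot_def)

lemma inner_rot_self [simp]: "y \<bullet> rot y = 0"
  by (simp add: inner_vec_def sum_2)

lemma norm_rot [simp]: "norm (rot y) = norm y"
  by (simp add: norm_eq_sqrt_inner inner_vec_def sum_2)

lemma bounded_linear_rot: "bounded_linear rot"
  by (rule bounded_linear_intro[where K=1]) (auto simp: vec_eq_iff forall_2)

lemma rot_minus: "rot (- y) = - rot y"
  by (simp add: vec_eq_iff forall_2)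

text \<open>To be applied to the squared distance, so that the kernel is differentiable at 0 as
  well. The affine continuation below \<open>e\<close> is the one that keeps the derivative
  continuous; membership in \<open>{e..}\<close> matches the rule for gluing derivatives.\<close>

definition reg_powr :: "real \<Rightarrow> real \<Rightarrow> real \<Rightarrow> real" where
  "reg_powr a e s = (if s \<in> {e..} then s powr - a else e powr - a - a * e powr (- a - 1) * (s - e))"

lemma reg_powr_deriv:
  assumes "e > 0"
  shows "(reg_powr a e has_real_derivative - a * max s e powr (- a - 1)) (at s)"
proof -
  let ?f' = "\<lambda>s. (*) (- a * s powr (- a - 1))" and ?g' = "\<lambda>s::real. (*) (- a * e powr (- a - 1))"
  have cl: "closure {e..} \<inter> closure {..<e} = {e}" by auto
  have "((\<lambda>s. if s \<in> {e..} then s powr - a else e powr - a - a * e powr (- a - 1) * (s - e)) has_derivative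
      (if s \<in> {e..} then ?f' s else ?g' s)) (at s within {e..} \<union> {..<e})"
  proof (rule has_derivative_If_within_closures)
    show "((\<lambda>s. s powr - a) has_derivative ?f' s) (at s within {e..} \<union> closure {e..} \<inter> closure {..<e})"
      if "s \<in> {e..} \<union> closure {e..} \<inter> closure {..<e}"
      using that assms has_real_derivative_powr[of s "-a"]
      by (auto simp: has_field_derivative_def intro: has_derivative_at_withinI)
    show "((\<lambda>s. e powr - a - a * e powr (- a - 1) * (s - e)) has_derivative ?g' s)
        (at s within {..<e} \<union> closure {e..} \<inter> closure {..<e})"
      by (auto intro!: derivative_eq_intros simp: fun_eq_iff)
  qed auto
  moreover have "{e..} \<union> {..<e} = UNIV" by auto
  ultimately show ?thesis
    unfolding reg_powr_def[abs_def] has_field_derivative_def by (auto simp: max_def split: if_splits)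
qed

lemma reg_powr_eq: "s \<ge> e \<Longrightarrow> reg_powr a e s = s powr - a"
  by (simp add: reg_powr_def)

lemma reg_powr_nonneg: "e > 0 \<Longrightarrow> a > 0 \<Longrightarrow> reg_powr a e s \<ge> 0"
  by (auto simp: reg_powr_def intro!: add_nonneg_nonneg order_trans[OF mult_nonneg_nonpos])

text \<open>Below \<open>e\<close> the regularised power is the tangent at \<open>e\<close> of the convex function \<open>s powr - a\<close>.\<close>

lemma reg_powr_le_powr:
  assumes "e > 0" "a > 0" "s > 0"
  shows "reg_powr a e s \<le> s powr - a"
proof (cases "s \<ge> e")
  case False
  let ?h = "\<lambda>s. s powr - a - reg_powr a e s"
  have "?h e \<le> ?h s"
  proof (rule DERIV_nonpos_imp_nonincreasing[of s e])
    fix x assume x: "s \<le> x" "x \<le> e"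
    have "(?h has_real_derivative - a * x powr (- a - 1) - (- a * max x e powr (- a - 1))) (at x)"
      using x assms by (intro DERIV_diff reg_powr_deriv has_real_derivative_powr) auto
    moreover have "max x e powr (- a - 1) \<le> x powr (- a - 1)"
      using x assms by (intro powr_mono2') auto
    then have "- a * x powr (- a - 1) - (- a * max x e powr (- a - 1)) \<le> 0"
      using assms by simp
    ultimately show "\<exists>y. (?h has_real_derivative y) (at x) \<and> y \<le> 0" by blast
  qed (use False in auto)
  then show ?thesis by (simp add: reg_powr_eq)
qed (simp add: reg_powr_eq)

text \<open>On \<open>{0..e}\<close> the tangent is largest at 0, where its value is
  \<open>(1 + a) * e powr - a\<close>. Unlike the bound by \<open>s powr - a\<close>, this one stays
  finite at 0.\<close>

lemma reg_powr_le:
  assumes "e > 0" "a > 0" "s \<ge> 0"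
  shows "reg_powr a e s \<le> (1 + a) * max s e powr - a"
proof (cases "s \<ge> e")
  case True
  then show ?thesis using assms by (simp add: reg_powr_eq max_def mult_right_mono[of 1])
next
  case False
  have "e powr (- a - 1) * e = e powr - a" using assms by (simp add: powr_diff)
  moreover have "a * (e powr (- a - 1) * (e - s)) \<le> a * (e powr (- a - 1) * e)"
    using assms by (intro mult_left_mono) auto
  ultimately show ?thesis using False by (simp add: reg_powr_def max_def algebra_simps)
qed

definition reg_kernel :: "real \<Rightarrow> real \<Rightarrow> real^2 \<Rightarrow> real^2" where
  "reg_kernel a e y = reg_powr a e (y \<bullet> y) *\<^sub>R rot y"

definition reg_kernel' :: "real \<Rightarrow> real \<Rightarrow> real^2 \<Rightarrow> real^2 \<Rightarrow> real^2" where
  "reg_kernel' a e y v = (- a * max (y \<bullet> y) e powr (- a - 1) * (2 * (y \<bullet> v))) *\<^sub>R rot y + reg_powr a e (y \<bullet> y) *\<^sub>R rot v"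

lemma reg_kernel_odd: "reg_kernel a e (- y) = - reg_kernel a e y"
  by (simp add: reg_kernel_def rot_minus)

lemma inner_reg_kernel_self [simp]: "y \<bullet> reg_kernel a e y = 0"
  by (simp add: reg_kernel_def)

lemma reg_kernel_has_derivative:
  assumes "e > 0"
  shows "(reg_kernel a e has_derivative reg_kernel' a e y) (at y)"
proof -
  have 1: "((\<lambda>y. y \<bullet> y) has_derivative (\<lambda>v. 2 * (y \<bullet> v))) (at y)"
    by (auto intro!: derivative_eq_intros simp: inner_commute)
  have 2: "((\<lambda>y. reg_powr a e (y \<bullet> y)) has_derivative (\<lambda>v. (- a * max (y \<bullet> y) e powr (- a - 1)) * (2 * (y \<bullet> v)))) (at y)"
    by (rule has_derivative_compose[OF 1 reg_powr_deriv[OF assms, of a "y \<bullet> y", unfolded has_field_derivative_def]])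
  have 3: "(rot has_derivative rot) (at y)"
    by (rule bounded_linear_imp_has_derivative[OF bounded_linear_rot])
  show ?thesis
    using has_derivative_scaleR[OF 2 3]
    unfolding reg_kernel_def[abs_def] reg_kernel'_def[abs_def] by (simp add: add.commute)
qed

text \<open>The product \<open>\<bar>y \<bullet> v\<bar> * norm y\<close> is at most
  \<open>max (y \<bullet> y) e * norm v\<close>, which uses up one power of the maximum. The bound
  blows up as \<open>e\<close> tends to 0 and is used only at fixed \<open>e\<close>.\<close>

lemma reg_kernel'_bound:
  assumes "e > 0" "a > 0"
  shows "norm (reg_kernel' a e y v) \<le> (1 + 3 * a) * e powr - a * norm v"
proof -
  let ?s = "y \<bullet> y" and ?m = "max (y \<bullet> y) e"
  have m: "?m > 0" using assms by auto
  have me: "?m powr - a \<le> e powr - a" using assms by (intro powr_mono2') auto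
  have "norm ((- a * ?m powr (- a - 1) * (2 * (y \<bullet> v))) *\<^sub>R rot y)
      = a * ?m powr (- a - 1) * 2 * (\<bar>y \<bullet> v\<bar> * norm y)"
    using assms by (simp add: abs_mult)
  also have "\<dots> \<le> a * ?m powr (- a - 1) * 2 * (?m * norm v)"
  proof (intro mult_left_mono)
    have "\<bar>y \<bullet> v\<bar> * norm y \<le> (norm y * norm v) * norm y"
      by (intro mult_right_mono Cauchy_Schwarz_ineq2) auto
    also have "\<dots> = ?s * norm v" by (simp add: power2_norm_eq_inner[symmetric] power2_eq_square)
    also have "\<dots> \<le> ?m * norm v" by (intro mult_right_mono) auto
    finally show "\<bar>y \<bullet> v\<bar> * norm y \<le> ?m * norm v" .
  qed (use assms in auto)
  also have "\<dots> = 2 * a * ?m powr - a * norm v"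
    using m by (simp add: powr_diff)
  also have "\<dots> \<le> 2 * a * e powr - a * norm v"
    using me assms by (intro mult_right_mono mult_left_mono) auto
  finally have A: "norm ((- a * ?m powr (- a - 1) * (2 * (y \<bullet> v))) *\<^sub>R rot y) \<le> 2 * a * e powr - a * norm v" .
  have "norm (reg_powr a e ?s *\<^sub>R rot v) = reg_powr a e ?s * norm v"
    using reg_powr_nonneg[OF assms] by simp
  also have "\<dots> \<le> (1 + a) * e powr - a * norm v"
    using reg_powr_le[OF assms, of ?s] me assms
    by (intro mult_right_mono) (auto intro: order_trans mult_left_mono)
  finally have B: "norm (reg_powr a e ?s *\<^sub>R rot v) \<le> (1 + a) * e powr - a * norm v" .
  have "norm (reg_kernel' a e y v) \<le> 2 * a * e powr - a * norm v + (1 + a) * e powr - a * norm v"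
    unfolding reg_kernel'_def by (rule norm_triangle_le[OF add_mono[OF A B]])
  also have "\<dots> = (1 + 3 * a) * e powr - a * norm v" by (simp add: algebra_simps)
  finally show ?thesis .
qed

text \<open>Divergence freeness: differentiating the radial factor gives a multiple of
  \<open>y \<bullet> rot y\<close>, which vanishes, and a rotation by a right angle has trace
  zero.\<close>

lemma reg_kernel'_trace: "(\<Sum>c\<in>UNIV. reg_kernel' a e y (axis c 1) $ c) = 0"
  by (simp add: reg_kernel'_def sum_2 inner_axis) (simp add: axis_def)

lemma powr_inner_self: "(y \<bullet> y) powr p = norm y powr (2 * p)"
  by (cases "y = 0") (simp_all add: powr_def power2_norm_eq_inner[symmetric] ln_realpow)

text \<open>This bound is uniform in \<open>e\<close>. Both the unit bound beyond distance 1 and the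
  comparison with the triple interaction rest on it.\<close>

lemma norm_reg_kernel_le_powr:
  assumes "e > 0" "a > 0" "y \<noteq> 0"
  shows "norm (reg_kernel a e y) \<le> norm y powr (1 - 2 * a)"
proof -
  have "norm (reg_kernel a e y) = reg_powr a e (y \<bullet> y) * norm y"
    using reg_powr_nonneg[OF assms(1,2)] by (simp add: reg_kernel_def)
  also have "\<dots> \<le> (y \<bullet> y) powr - a * norm y"
    using assms by (intro mult_right_mono reg_powr_le_powr) auto
  also have "\<dots> = norm y powr (1 - 2 * a)"
    using assms by (simp add: powr_inner_self powr_diff powr_minus field_simps)
  finally show ?thesis .
qed

lemma norm_reg_kernel_bounded:
  assumes "e > 0" "a \<ge> 1/2"
  shows "norm (reg_kernel a e y) \<le> (1 + a) * e powr (1/2 - a)"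
proof -
  let ?m = "max (y \<bullet> y) e"
  have m: "?m > 0" using assms by auto
  have "norm (reg_kernel a e y) = reg_powr a e (y \<bullet> y) * norm y"
    using reg_powr_nonneg[of e a] assms by (simp add: reg_kernel_def)
  also have "\<dots> \<le> ((1 + a) * ?m powr - a) * ?m powr (1/2)"
    using assms reg_powr_nonneg[of e a] reg_powr_le[of e a "y \<bullet> y"]
    by (intro mult_mono) (auto simp: norm_eq_sqrt_inner powr_half_sqrt)
  also have "\<dots> = (1 + a) * ?m powr (1/2 - a)"
    by (simp add: powr_add[symmetric])
  also have "\<dots> \<le> (1 + a) * e powr (1/2 - a)"
    using assms by (intro mult_left_mono powr_mono2') auto
  finally show ?thesis .
qed

section \<open>The regularised vortex field on configuration space\<close>

definition reg_field :: "('n::finite \<Rightarrow> real) \<Rightarrow> real \<Rightarrow> real \<Rightarrow> (real^2)^'n \<Rightarrow> (real^2)^'n" where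
  "reg_field g a e X = (\<chi> j. \<Sum>k\<in>UNIV - {j}. g k *\<^sub>R reg_kernel a e (X $ j - X $ k))"

definition reg_field' :: "('n::finite \<Rightarrow> real) \<Rightarrow> real \<Rightarrow> real \<Rightarrow> (real^2)^'n \<Rightarrow> (real^2)^'n \<Rightarrow> (real^2)^'n" where
  "reg_field' g a e X W = (\<chi> j. \<Sum>k\<in>UNIV - {j}. g k *\<^sub>R reg_kernel' a e (X $ j - X $ k) (W $ j - W $ k))"

lemma has_derivative_vec_lambda:
  fixes f :: "'a::real_normed_vector \<Rightarrow> 'n::finite \<Rightarrow> 'b::euclidean_space"
  assumes "\<And>i. ((\<lambda>x. f x i) has_derivative f' i) (at x within S)"
  shows "((\<lambda>x. \<chi> i. f x i) has_derivative (\<lambda>h. \<chi> i. f' i h)) (at x within S)"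
proof (rule has_derivative_componentwise_within[THEN iffD2], rule ballI)
  fix b :: "'b^'n" assume "b \<in> Basis"
  then obtain i u where b: "b = axis i u" by (auto simp: Basis_vec_def)
  show "((\<lambda>x. (\<chi> i. f x i) \<bullet> b) has_derivative (\<lambda>h. (\<chi> i. f' i h) \<bullet> b)) (at x within S)"
    unfolding b inner_axis by (auto intro!: derivative_eq_intros assms)
qed

lemma norm_vec_le_sum: "norm (X :: 'a::euclidean_space^'n) \<le> (\<Sum>i\<in>UNIV. norm (X $ i))"
  unfolding norm_vec_def by (rule L2_set_le_sum) auto

lemma reg_field_has_derivative:
  assumes "e > 0"
  shows "(reg_field g a e has_derivative reg_field' g a e X) (at X)"
proof -
  have "((\<lambda>X. g k *\<^sub>R reg_kernel a e (X $ j - X $ k)) has_derivative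
      (\<lambda>W. g k *\<^sub>R reg_kernel' a e (X $ j - X $ k) (W $ j - W $ k))) (at X)" for j k
  proof -
    have "((\<lambda>X. X $ j - X $ k) has_derivative (\<lambda>W. W $ j - W $ k)) (at X)"
      by (intro has_derivative_diff bounded_linear_imp_has_derivative bounded_linear_vec_nth)
    from has_derivative_compose[OF this reg_kernel_has_derivative[OF assms]]
    show ?thesis by (intro has_derivative_scaleR_right) simp
  qed
  then show ?thesis
    unfolding reg_field_def[abs_def] reg_field'_def[abs_def]
    by (intro has_derivative_vec_lambda has_derivative_sum) auto
qed

lemma reg_field'_bound:
  fixes g :: "'n::finite \<Rightarrow> real"
  assumes "e > 0" "a > 0"
  shows "norm (reg_field' g a e X W) \<le> (2 * CARD('n) * (\<Sum>k\<in>UNIV. \<bar>g k\<bar>) * ((1 + 3 * a) * e powr - a)) * norm (W :: (real^2)^'n)"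
proof -
  let ?c = "(1 + 3 * a) * e powr - a"
  have c: "?c \<ge> 0" using assms by simp
  have "norm (reg_field' g a e X W $ j) \<le> (\<Sum>k\<in>UNIV. \<bar>g k\<bar>) * (?c * (2 * norm W))" for j
  proof -
    have "norm (reg_field' g a e X W $ j) \<le> (\<Sum>k\<in>UNIV - {j}. \<bar>g k\<bar> * (?c * (2 * norm W)))"
      unfolding reg_field'_def vec_lambda_beta
    proof (rule sum_norm_le)
      fix k
      have "norm (W $ j - W $ k) \<le> norm (W $ j) + norm (W $ k)" by (rule norm_triangle_ineq4)
      also have "\<dots> \<le> 2 * norm W" using Finite_Cartesian_Product.norm_nth_le[of W j] Finite_Cartesian_Product.norm_nth_le[of W k] by simp
      finally have "?c * norm (W $ j - W $ k) \<le> ?c * (2 * norm W)" using c by (rule mult_left_mono)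
      then show "norm (g k *\<^sub>R reg_kernel' a e (X $ j - X $ k) (W $ j - W $ k)) \<le> \<bar>g k\<bar> * (?c * (2 * norm W))"
        using order_trans[OF reg_kernel'_bound[OF assms]] by (auto intro!: mult_left_mono)
    qed
    also have "\<dots> \<le> (\<Sum>k\<in>UNIV. \<bar>g k\<bar> * (?c * (2 * norm W)))"
      using c by (intro sum_mono2) auto
    finally show ?thesis by (simp only: sum_distrib_right)
  qed
  then have "(\<Sum>j\<in>UNIV. norm (reg_field' g a e X W $ j)) \<le> (\<Sum>j\<in>(UNIV::'n set). (\<Sum>k\<in>UNIV. \<bar>g k\<bar>) * (?c * (2 * norm W)))"
    by (rule sum_mono)
  then show ?thesis
    using norm_vec_le_sum[of "reg_field' g a e X W"] by (simp add: algebra_simps)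
qed

text \<open>The velocity of vortex \<open>j\<close> depends on \<open>X $ j\<close> only through the
  arguments of the kernels, so each diagonal block is a combination of traceless matrices.\<close>

lemma reg_field'_trace:
  "(\<Sum>j\<in>UNIV. \<Sum>c\<in>UNIV. reg_field' g a e X (axis j (axis c 1)) $ j $ c) = 0"
proof -
  have "(\<Sum>c\<in>UNIV. reg_field' g a e X (axis j (axis c 1)) $ j $ c) = 0" for j
  proof -
    have "(\<Sum>c\<in>UNIV. reg_field' g a e X (axis j (axis c 1)) $ j $ c)
      = (\<Sum>c\<in>UNIV. \<Sum>k\<in>UNIV - {j}. g k * reg_kernel' a e (X $ j - X $ k) (axis c 1) $ c)"
      by (intro sum.cong refl) (auto simp: reg_field'_def axis_def intro!: sum.cong)
    also have "\<dots> = (\<Sum>k\<in>UNIV - {j}. g k * (\<Sum>c\<in>UNIV. reg_kernel' a e (X $ j - X $ k) (axis c 1) $ c))"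
      by (subst sum.swap) (simp add: sum_distrib_left)
    finally show ?thesis by (simp add: reg_kernel'_trace)
  qed
  then show ?thesis by simp
qed

lemma reg_field_bounded:
  fixes g :: "'n::finite \<Rightarrow> real"
  assumes "e > 0" "a \<ge> 1/2"
  shows "norm (reg_field g a e (X :: (real^2)^'n)) \<le> CARD('n) * ((\<Sum>k\<in>UNIV. \<bar>g k\<bar>) * ((1 + a) * e powr (1/2 - a)))"
proof -
  let ?c = "(1 + a) * e powr (1/2 - a)"
  have c: "?c \<ge> 0" using assms by simp
  have "norm (reg_field g a e X $ j) \<le> (\<Sum>k\<in>UNIV. \<bar>g k\<bar>) * ?c" for j
  proof -
    have "norm (reg_field g a e X $ j) \<le> (\<Sum>k\<in>UNIV - {j}. \<bar>g k\<bar> * ?c)"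
      unfolding reg_field_def vec_lambda_beta
      using norm_reg_kernel_bounded[OF assms] by (intro sum_norm_le) (auto intro!: mult_left_mono)
    also have "\<dots> \<le> (\<Sum>k\<in>UNIV. \<bar>g k\<bar> * ?c)"
      using c by (intro sum_mono2) auto
    finally show ?thesis by (simp only: sum_distrib_right)
  qed
  then have "(\<Sum>j\<in>UNIV. norm (reg_field g a e X $ j)) \<le> (\<Sum>j\<in>(UNIV::'n set). (\<Sum>k\<in>UNIV. \<bar>g k\<bar>) * ?c)"
    by (rule sum_mono)
  then show ?thesis
    using norm_vec_le_sum[of "reg_field g a e X"] by simp
qed

lemma reg_field_lipschitz:
  fixes g :: "'n::finite \<Rightarrow> real"
  assumes e: "e > 0" and a: "a > 0"
  shows "\<exists>L>0. (\<forall>X W. norm (reg_field' g a e X W) \<le> L * norm W) \<and>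
    (\<forall>X Y. norm (reg_field g a e X - reg_field g a e Y) \<le> L * norm (X - Y))"
proof -
  define L where "L = 2 * CARD('n) * (\<Sum>k\<in>UNIV. \<bar>g k\<bar>) * ((1 + 3 * a) * e powr - a) + 1"
  have L: "L > 0" unfolding L_def using a by (intro add_nonneg_pos mult_nonneg_nonneg sum_nonneg) auto
  have bd: "norm (reg_field' g a e X W) \<le> L * norm W" for X W
    by (rule order_trans[OF reg_field'_bound[OF e a]]) (auto simp: L_def intro!: mult_right_mono)
  have "norm (reg_field g a e X - reg_field g a e Y) \<le> L * norm (X - Y)" for X Y
    by (rule differentiable_bound[of UNIV _ "reg_field' g a e"])
      (auto intro!: reg_field_has_derivative[OF e] onorm_le bd has_derivative_at_withinI)
  then show ?thesis using L bd by blast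
qed

section \<open>Integrability of the triple interaction\<close>

text \<open>Makes Fubini's theorem available one vortex at a time rather than one scalar coordinate
  at a time.\<close>

lemma lborel_vec_eq_PiM:
  "(lborel :: ('a::euclidean_space^'n) measure) = distr (\<Pi>\<^sub>M i\<in>(UNIV::'n set). lborel) borel (\<lambda>f. \<chi> i. f i)"
proof (rule lborel_eqI)
  interpret product_sigma_finite "\<lambda>i::'n. lborel :: 'a measure" by standard
  have [measurable]: "(\<lambda>f. \<chi> i. f i) \<in> borel_measurable (\<Pi>\<^sub>M i\<in>(UNIV::'n set). lborel :: 'a measure)"
    by (subst borel_measurable_euclidean_space) (auto simp: Basis_vec_def inner_axis)
  fix l u :: "'a^'n" assume le: "\<And>b. b \<in> Basis \<Longrightarrow> l \<bullet> b \<le> u \<bullet> b"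
  have le': "l $ i \<bullet> b \<le> u $ i \<bullet> b" if "b \<in> Basis" for i b
  proof -
    have "axis i b \<in> Basis" using that by (auto simp: Basis_vec_def)
    from le[OF this] show ?thesis by (simp add: inner_axis)
  qed
  have "(\<lambda>f. \<chi> i. f i) -` box l u \<inter> space (\<Pi>\<^sub>M i\<in>(UNIV::'n set). lborel :: 'a measure) = (\<Pi>\<^sub>E i\<in>UNIV. box (l $ i) (u $ i))"
    by (auto simp: space_PiM PiE_iff mem_box Basis_vec_def inner_axis)
  then have "emeasure (distr (\<Pi>\<^sub>M i\<in>(UNIV::'n set). lborel :: 'a measure) borel (\<lambda>f. \<chi> i. f i)) (box l u)
    = emeasure (\<Pi>\<^sub>M i\<in>(UNIV::'n set). lborel :: 'a measure) (\<Pi>\<^sub>E i\<in>UNIV. box (l $ i) (u $ i))"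
    by (subst emeasure_distr) auto
  also have "\<dots> = (\<Prod>i\<in>UNIV. emeasure lborel (box (l $ i) (u $ i)))"
    by (rule emeasure_PiM) auto
  also have "\<dots> = (\<Prod>i\<in>UNIV. ennreal (\<Prod>b\<in>Basis. (u $ i - l $ i) \<bullet> b))"
    by (intro prod.cong refl emeasure_lborel_box le')
  also have "\<dots> = ennreal (\<Prod>i\<in>UNIV. \<Prod>b\<in>Basis. (u $ i - l $ i) \<bullet> b)"
    by (intro prod_ennreal prod_nonneg) (auto simp: inner_diff_left le')
  also have "(\<Prod>i\<in>UNIV. \<Prod>b\<in>Basis. (u $ i - l $ i) \<bullet> b) = (\<Prod>b\<in>Basis. (u - l) \<bullet> b)"
  proof -
    have B: "(Basis :: ('a^'n) set) = (\<lambda>p. axis (fst p) (snd p)) ` (UNIV \<times> Basis)"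
      unfolding Basis_vec_def image_def by auto
    have inj: "inj_on (\<lambda>p. axis (fst p) (snd p) :: 'a^'n) (UNIV \<times> Basis)"
      by (auto simp: inj_on_def axis_eq_axis)
    show ?thesis
      unfolding B prod.reindex[OF inj]
      by (simp add: prod.cartesian_product inner_axis case_prod_beta)
  qed
  finally show "emeasure (distr (\<Pi>\<^sub>M i\<in>(UNIV::'n set). lborel :: 'a measure) borel (\<lambda>f. \<chi> i. f i)) (box l u)
    = ennreal (\<Prod>b\<in>Basis. (u - l) \<bullet> b)" .
qed simp

lemma nn_integral_lborel_shift:
  fixes f :: "'a::euclidean_space \<Rightarrow> ennreal"
  assumes [measurable]: "f \<in> borel_measurable borel"
  shows "(\<integral>\<^sup>+x. f (x - c) \<partial>lborel) = (\<integral>\<^sup>+x. f x \<partial>lborel)"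
proof -
  have "distr lborel borel (\<lambda>x. - c + x) = (lborel :: 'a measure)"
    using lborel_affine[of 1 "-c"] by (simp add: density_1)
  then have "(\<integral>\<^sup>+x. f x \<partial>lborel) = (\<integral>\<^sup>+x. f x \<partial>distr lborel borel (\<lambda>x. - c + x))" by simp
  then show ?thesis by (subst (asm) nn_integral_distr) (auto simp: algebra_simps)
qed

text \<open>Once the variable \<open>X $ i\<close> is frozen, translation turns the differences into
  independent variables and the integral factorises.\<close>

lemma nn_integral_prod_differences:
  fixes f :: "'n::finite \<Rightarrow> 'a::euclidean_space \<Rightarrow> ennreal"
  assumes [measurable]: "\<And>l. f l \<in> borel_measurable borel" "f0 \<in> borel_measurable borel"
  shows "(\<integral>\<^sup>+X. f0 (X $ i) * (\<Prod>l\<in>UNIV - {i}. f l (X $ l - X $ i)) \<partial>(lborel :: ('a^'n) measure))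
    = (\<integral>\<^sup>+y. f0 y \<partial>lborel) * (\<Prod>l\<in>UNIV - {i}. \<integral>\<^sup>+y. f l y \<partial>lborel)"
proof -
  interpret product_sigma_finite "\<lambda>i::'n. lborel :: 'a measure" by standard
  have [measurable]: "(\<lambda>f. \<chi> i. f i) \<in> borel_measurable (\<Pi>\<^sub>M i\<in>(UNIV::'n set). lborel :: 'a measure)"
    by (subst borel_measurable_euclidean_space) (auto simp: Basis_vec_def inner_axis)
  have nth[measurable]: "(\<lambda>X. X $ l) \<in> borel_measurable (borel :: ('a^'n) measure)" for l
    by (intro borel_measurable_continuous_onI continuous_intros)
  let ?F = "\<lambda>x. f0 (x i) * (\<Prod>l\<in>UNIV - {i}. f l (x l - x i))"
  have U: "insert i (UNIV - {i}) = UNIV" by auto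
  have "(\<integral>\<^sup>+X. f0 (X $ i) * (\<Prod>l\<in>UNIV - {i}. f l (X $ l - X $ i)) \<partial>(lborel :: ('a^'n) measure))
    = (\<integral>\<^sup>+x. ?F x \<partial>(\<Pi>\<^sub>M i\<in>(UNIV::'n set). lborel))"
    by (subst lborel_vec_eq_PiM, subst nn_integral_distr) auto
  also have "\<dots> = (\<integral>\<^sup>+x. ?F x \<partial>(\<Pi>\<^sub>M i\<in>insert i (UNIV - {i}). lborel))" by (simp add: U)
  also have "\<dots> = (\<integral>\<^sup>+y. \<integral>\<^sup>+x. ?F (x(i := y)) \<partial>(\<Pi>\<^sub>M i\<in>UNIV - {i}. lborel) \<partial>lborel)"
    by (rule product_nn_integral_insert_rev) (simp_all add: U)
  also have "\<dots> = (\<integral>\<^sup>+y. f0 y * (\<Prod>l\<in>UNIV - {i}. \<integral>\<^sup>+x. f l x \<partial>lborel) \<partial>lborel)"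
  proof (intro nn_integral_cong)
    fix y
    have "(\<integral>\<^sup>+x. ?F (x(i := y)) \<partial>(\<Pi>\<^sub>M i\<in>UNIV - {i}. lborel))
      = (\<integral>\<^sup>+x. f0 y * (\<Prod>l\<in>UNIV - {i}. f l (x l - y)) \<partial>(\<Pi>\<^sub>M i\<in>UNIV - {i}. lborel))"
      by (intro nn_integral_cong arg_cong2[where f="(*)"] prod.cong) auto
    also have "\<dots> = f0 y * (\<integral>\<^sup>+x. (\<Prod>l\<in>UNIV - {i}. f l (x l - y)) \<partial>(\<Pi>\<^sub>M i\<in>UNIV - {i}. lborel))"
      by (rule nn_integral_cmult) measurable
    also have "(\<integral>\<^sup>+x. (\<Prod>l\<in>UNIV - {i}. f l (x l - y)) \<partial>(\<Pi>\<^sub>M i\<in>UNIV - {i}. lborel))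
      = (\<Prod>l\<in>UNIV - {i}. \<integral>\<^sup>+x. f l (x - y) \<partial>lborel)"
      by (rule product_nn_integral_prod) auto
    finally show "(\<integral>\<^sup>+x. ?F (x(i := y)) \<partial>(\<Pi>\<^sub>M i\<in>UNIV - {i}. lborel)) = f0 y * (\<Prod>l\<in>UNIV - {i}. \<integral>\<^sup>+x. f l x \<partial>lborel)"
      by (simp add: nn_integral_lborel_shift)
  qed
  also have "\<dots> = (\<integral>\<^sup>+y. f0 y \<partial>lborel) * (\<Prod>l\<in>UNIV - {i}. \<integral>\<^sup>+x. f l x \<partial>lborel)"
    by (rule nn_integral_multc) simp
  finally show ?thesis .
qed

text \<open>Dyadic decomposition: the ball of radius \<open>r k\<close> has area
  \<open>pi * (r k)\<^sup>2\<close>, so the shells are dominated by a geometric series of ratio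
  \<open>2 powr p / 4\<close>, which is below 1 exactly for \<open>p < 2\<close>.\<close>

lemma nn_integral_norm_powr_finite:
  assumes p: "0 \<le> p" "p < 2" and R: "R > 0"
  shows "(\<integral>\<^sup>+y. ennreal (norm y powr - p) * indicator (cball 0 R) y \<partial>(lborel :: (real^2) measure)) < \<infinity>"
proof -
  have [measurable]: "cball (0 :: real^2) s \<in> sets borel" for s by simp
  define r where "r k = R * (1/2) ^ k" for k :: nat
  have r: "r k > 0" for k using R by (simp add: r_def)
  have "(\<integral>\<^sup>+y. ennreal (norm y powr - p) * indicator (cball 0 R) y \<partial>(lborel :: (real^2) measure))
    \<le> (\<integral>\<^sup>+y. (\<Sum>k. ennreal (r (Suc k) powr - p) * indicator (cball 0 (r k)) y) \<partial>(lborel :: (real^2) measure))"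
  proof (rule nn_integral_mono)
    fix y :: "real^2"
    show "ennreal (norm y powr - p) * indicator (cball 0 R) y \<le> (\<Sum>k. ennreal (r (Suc k) powr - p) * indicator (cball 0 (r k)) y)"
    \<comment> \<open>At the origin the integrand is 0 because \<open>0 powr x = 0\<close>; every
      other point of the ball lies in one of the shells.\<close>
    proof (cases "y \<noteq> 0 \<and> norm y \<le> R")
      case True
      have "r \<longlonglongrightarrow> R * 0" unfolding r_def by (intro tendsto_intros LIMSEQ_power_zero) auto
      then have "\<forall>\<^sub>F k in sequentially. r k < norm y" using True by (intro order_tendstoD(2)) auto
      then have ex: "\<exists>k. r k < norm y" by (auto simp: eventually_sequentially)
      define n where "n = (LEAST k. r k < norm y)"
      have n: "r n < norm y" unfolding n_def using ex by (rule LeastI_ex)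
      have "n \<noteq> 0"
      proof
        assume "n = 0"
        then show False using n True by (simp add: r_def)
      qed
      then obtain k where k: "n = Suc k" by (cases n) auto
      have "\<not> r k < norm y" using not_less_Least[of k "\<lambda>k. r k < norm y"] k by (simp add: n_def)
      then have "norm y powr - p \<le> r (Suc k) powr - p" "y \<in> cball 0 (r k)"
        using n r p unfolding k by (auto intro!: powr_mono2')
      then have "ennreal (norm y powr - p) * indicator (cball 0 R) y \<le> ennreal (r (Suc k) powr - p) * indicator (cball 0 (r k)) y"
        by (auto simp: indicator_def intro!: ennreal_leI)
      also have "\<dots> \<le> (\<Sum>k. ennreal (r (Suc k) powr - p) * indicator (cball 0 (r k)) y)"
        using sum_le_suminf[of "\<lambda>k. ennreal (r (Suc k) powr - p) * indicator (cball 0 (r k)) y" "{k}"]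
        by (simp del: sum_mult_indicator)
      finally show ?thesis .
    qed auto
  qed
  also have "\<dots> = (\<Sum>k. \<integral>\<^sup>+y. ennreal (r (Suc k) powr - p) * indicator (cball 0 (r k)) y \<partial>(lborel :: (real^2) measure))"
    by (rule nn_integral_suminf) measurable
  also have "\<dots> = (\<Sum>k. ennreal (r (Suc k) powr - p * (pi * (r k)\<^sup>2)))"
  proof (intro suminf_cong)
    fix k
    show "(\<integral>\<^sup>+y. ennreal (r (Suc k) powr - p) * indicator (cball 0 (r k)) y \<partial>(lborel :: (real^2) measure))
      = ennreal (r (Suc k) powr - p * (pi * (r k)\<^sup>2))"
    proof -
      have "emeasure lborel (cball (0 :: real^2) (r k)) = ennreal (pi * (r k)\<^sup>2)"
        using emeasure_cball[of "r k" "0 :: real^2"] r[of k] by (simp add: unit_ball_vol_2)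
      then show ?thesis by (subst nn_integral_cmult_indicator) (simp_all add: ennreal_mult)
    qed
  qed
  also have "(\<lambda>k. r (Suc k) powr - p * (pi * (r k)\<^sup>2)) = (\<lambda>k. (R powr - p * 2 powr p * pi * R\<^sup>2) * (2 powr p / 4) ^ k)"
  proof
    fix k
    have "r (Suc k) powr - p = R powr - p * (2 powr p * (2 powr p) ^ k)"
    proof -
      have "(1/2) ^ Suc k = (2::real) powr - real (Suc k)"
        by (simp only: powr_minus powr_realpow zero_less_numeral) (simp add: power_one_over inverse_eq_divide)
      then have "r (Suc k) powr - p = R powr - p * 2 powr (p + p * real k)"
        using R by (simp only: r_def powr_mult powr_powr) (simp add: algebra_simps)
      also have "2 powr (p * real k) = (2 powr p) ^ k"
        by (simp only: powr_powr[symmetric]) (simp add: powr_realpow)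
      then have "2 powr (p + p * real k) = 2 powr p * (2 powr p) ^ k" by (simp add: powr_add)
      finally show ?thesis .
    qed
    moreover have "(r k)\<^sup>2 = R\<^sup>2 * (1/4)^k"
      by (simp add: r_def power_mult_distrib power_divide flip: power_mult) (simp add: mult.commute[of k] power_mult)
    ultimately show "r (Suc k) powr - p * (pi * (r k)\<^sup>2) = (R powr - p * 2 powr p * pi * R\<^sup>2) * (2 powr p / 4) ^ k"
      by (simp add: power_divide field_simps)
  qed
  also have "(\<Sum>k. ennreal ((R powr - p * 2 powr p * pi * R\<^sup>2) * (2 powr p / 4) ^ k)) < \<infinity>"
  proof -
    have "2 powr p < 2 powr 2" using p by (intro powr_less_mono) auto
    then have "summable (\<lambda>k. (R powr - p * 2 powr p * pi * R\<^sup>2) * (2 powr p / 4) ^ k)"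
      by (intro summable_mult summable_geometric) auto
    then have "(\<Sum>k. ennreal ((R powr - p * 2 powr p * pi * R\<^sup>2) * (2 powr p / 4) ^ k)) \<noteq> top"
      by (rule ennreal_suminf_neq_top) auto
    then show ?thesis by (simp add: less_top)
  qed
  finally show ?thesis .
qed

text \<open>With the shared vortex \<open>i\<close> as origin, the two singular factors depend on
  different variables, since \<open>j \<noteq> k\<close>. Each is integrated separately, so the
  condition is \<open>p < 2\<close> and not \<open>2 * p < 2\<close>.\<close>

lemma nn_integral_pair_interaction_finite:
  fixes i j k :: "'n::finite"
  assumes p: "0 \<le> p" "p < 2" and R: "R > 0" and d: "j \<noteq> i" "k \<noteq> i" "j \<noteq> k"
  shows "(\<integral>\<^sup>+X. ennreal (norm (X $ i - X $ j) powr - p * norm (X $ i - X $ k) powr - p) * indicator (cball 0 R) X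
      \<partial>(lborel :: ((real^2)^'n) measure)) < \<infinity>"
proof -
  \<comment> \<open>The remaining vortices receive only a cutoff, which keeps their factors finite;
    in the ball of radius \<open>R\<close> all mutual distances are at most
    \<open>2*R\<close>.\<close>
  define f where "f l y = (if l = j \<or> l = k then ennreal (norm y powr - p) else 1) * indicator (cball 0 (2*R)) y"
    for l and y :: "real^2"
  have [measurable]: "cball (0 :: real^2) r \<in> sets borel" for r by simp
  have [measurable]: "f l \<in> borel_measurable borel" for l
    unfolding f_def by (cases "l = j \<or> l = k") (simp_all, measurable)
  let ?f0 = "indicator (cball 0 R) :: real^2 \<Rightarrow> ennreal"
  have "(\<integral>\<^sup>+X. ennreal (norm (X $ i - X $ j) powr - p * norm (X $ i - X $ k) powr - p) * indicator (cball 0 R) X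
      \<partial>(lborel :: ((real^2)^'n) measure)) \<le> (\<integral>\<^sup>+X. ?f0 (X $ i) * (\<Prod>l\<in>UNIV - {i}. f l (X $ l - X $ i)) \<partial>lborel)"
  proof (rule nn_integral_mono)
    fix X :: "(real^2)^'n"
    show "ennreal (norm (X $ i - X $ j) powr - p * norm (X $ i - X $ k) powr - p) * indicator (cball 0 R) X
      \<le> ?f0 (X $ i) * (\<Prod>l\<in>UNIV - {i}. f l (X $ l - X $ i))"
    proof (cases "norm X \<le> R")
      case True
      have c: "norm (X $ l) \<le> R" for l
        using Finite_Cartesian_Product.norm_nth_le[of X l] True by simp
      have c2: "norm (X $ l - X $ i) \<le> 2 * R" for l
        using norm_triangle_ineq4[of "X $ l" "X $ i"] c[of l] c[of i] by linarith
      have "(\<Prod>l\<in>UNIV - {i}. f l (X $ l - X $ i)) = f j (X $ j - X $ i) * (f k (X $ k - X $ i) * (\<Prod>l\<in>UNIV - {i} - {j} - {k}. f l (X $ l - X $ i)))"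
        using d by (subst prod.remove[of _ j], simp, simp, subst prod.remove[of _ k]) auto
      also have "(\<Prod>l\<in>UNIV - {i} - {j} - {k}. f l (X $ l - X $ i)) = 1"
        by (rule prod.neutral) (use c2 in \<open>auto simp: f_def\<close>)
      finally have "(\<Prod>l\<in>UNIV - {i}. f l (X $ l - X $ i)) = f j (X $ j - X $ i) * f k (X $ k - X $ i)" by simp
      moreover have "f l (X $ l - X $ i) = ennreal (norm (X $ i - X $ l) powr - p)" if "l = j \<or> l = k" for l
        using c2[of l] that by (simp add: f_def indicator_def norm_minus_commute)
      ultimately show ?thesis using True c[of i] by (simp add: ennreal_mult)
    qed auto
  qed
  also have "\<dots> = (\<integral>\<^sup>+y. ?f0 y \<partial>lborel) * (\<Prod>l\<in>UNIV - {i}. \<integral>\<^sup>+y. f l y \<partial>lborel)"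
    by (rule nn_integral_prod_differences) measurable
  also have "\<dots> < \<infinity>"
  proof -
    have fl: "(\<integral>\<^sup>+y. f l y \<partial>lborel) < \<infinity>" for l
    proof (cases "l = j \<or> l = k")
      case True
      then have "f l = (\<lambda>y. ennreal (norm y powr - p) * indicator (cball 0 (2*R)) y)" by (auto simp: f_def)
      then show ?thesis using nn_integral_norm_powr_finite[OF p, of "2*R"] R by simp
    next
      case False
      then have "f l = indicator (cball 0 (2*R))" by (auto simp: f_def)
      then show ?thesis using emeasure_lborel_cball_finite[of "0 :: real^2" "2*R"] by simp
    qed
    have "(\<Prod>l\<in>A. \<integral>\<^sup>+y. f l y \<partial>lborel) < \<infinity>" for A
      using fl by (induction A rule: infinite_finite_induct) (auto simp: ennreal_mult_less_top)
    moreover have "(\<integral>\<^sup>+y. ?f0 y \<partial>lborel) < \<infinity>"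
      using emeasure_lborel_cball_finite[of "0 :: real^2" R] by simp
    ultimately show ?thesis
      by (simp add: ennreal_mult_less_top)
  qed
  finally show ?thesis .
qed

section \<open>The regularised flow\<close>

definition flat :: "(real^2)^'n::finite \<Rightarrow> real^(('n \<times> 2) wo)" where
  "flat X = (\<chi> k. X $ fst (Rep_wo k) $ snd (Rep_wo k))"

definition unflat :: "real^(('n \<times> 2) wo) \<Rightarrow> (real^2)^'n::finite" where
  "unflat z = (\<chi> i c. z $ Abs_wo (i, c))"

lemma Rep_Abs_wo [simp]: "Rep_wo (Abs_wo x) = x"
  by (simp add: Abs_wo_inverse)

lemma unflat_flat [simp]: "unflat (flat X) = X"
  by (simp add: flat_def unflat_def vec_eq_iff)

lemma flat_unflat [simp]: "flat (unflat z) = z"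
  by (simp add: flat_def unflat_def vec_eq_iff Rep_wo_inverse)

lemma flat_linear: "flat (X + Y) = flat X + flat Y" "flat (c *\<^sub>R X) = c *\<^sub>R flat X"
  by (simp_all add: flat_def vec_eq_iff)

lemma unflat_linear: "unflat (y + z) = unflat y + unflat z" "unflat (c *\<^sub>R z) = c *\<^sub>R unflat z"
  by (simp_all add: unflat_def vec_eq_iff)

lemma bounded_linear_flat: "bounded_linear flat"
  by (auto simp: linear_conv_bounded_linear[symmetric] flat_linear intro!: linearI)

lemma bounded_linear_unflat: "bounded_linear unflat"
  by (auto simp: linear_conv_bounded_linear[symmetric] unflat_linear intro!: linearI)

lemma unflat_axis: "unflat (axis k 1) = axis (fst (Rep_wo k)) (axis (snd (Rep_wo k)) 1)"
proof -
  have "Abs_wo (i, c) = k \<longleftrightarrow> i = fst (Rep_wo k) \<and> c = snd (Rep_wo k)" for i c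
    by (metis Rep_Abs_wo Rep_wo_inverse fst_conv snd_conv prod.collapse)
  then show ?thesis by (auto simp: unflat_def axis_def vec_eq_iff)
qed

lemma bij_Rep_wo: "bij Rep_wo"
  by (metis Rep_Abs_wo Rep_wo_inverse bijI')

text \<open>The map only relabels coordinates, so boxes correspond to boxes with the same side
  lengths.\<close>

lemma distr_unflat: "distr lborel borel unflat = (lborel :: ((real^2)^'n::finite) measure)"
proof (rule sym, rule lborel_eqI)
  have [measurable]: "unflat \<in> borel_measurable borel"
    by (intro borel_measurable_continuous_onI linear_continuous_on bounded_linear_unflat)
  fix l u :: "(real^2)^'n" assume le: "\<And>b. b \<in> Basis \<Longrightarrow> l \<bullet> b \<le> u \<bullet> b"
  have B: "(Basis :: ((real^2)^'n) set) = (\<lambda>p. axis (fst p) (axis (snd p) 1)) ` UNIV"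
    by (auto simp: Basis_vec_def image_def)
  have inj: "inj (\<lambda>p. axis (fst p) (axis (snd p) 1) :: (real^2)^'n)"
    by (auto simp: inj_on_def axis_eq_axis)
  have B': "(Basis :: (real^(('n \<times> 2) wo)) set) = (\<lambda>k. axis k 1) ` UNIV"
    by (auto simp: Basis_vec_def)
  have inj': "inj (\<lambda>k. axis k 1 :: real^(('n \<times> 2) wo))"
    by (auto simp: inj_on_def axis_eq_axis)
  have le': "l $ i $ c \<le> u $ i $ c" for i c
  proof -
    have "axis i (axis c 1) \<in> (Basis :: ((real^2)^'n) set)" by (auto simp: Basis_vec_def)
    from le[OF this] show ?thesis by (simp add: inner_axis)
  qed
  have "unflat -` box l u = box (flat l) (flat u)"
  proof -
    have "unflat z \<in> box l u \<longleftrightarrow> z \<in> box (flat l) (flat u)" for z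
    proof -
      have "unflat z \<in> box l u \<longleftrightarrow> (\<forall>p. l $ fst p $ snd p < z $ Abs_wo p \<and> z $ Abs_wo p < u $ fst p $ snd p)"
        unfolding mem_box B by (simp add: inner_axis unflat_def)
      also have "\<dots> \<longleftrightarrow> (\<forall>k. flat l $ k < z $ k \<and> z $ k < flat u $ k)"
        unfolding flat_def vec_lambda_beta by (metis Rep_Abs_wo Rep_wo_inverse)
      finally show ?thesis by (simp add: mem_box_cart)
    qed
    then show ?thesis by auto
  qed
  then have "emeasure (distr lborel borel unflat) (box l u) = emeasure lborel (box (flat l) (flat u))"
    by (subst emeasure_distr) auto
  also have "\<dots> = (\<Prod>b\<in>Basis. (flat u - flat l) \<bullet> b)"
    by (rule emeasure_lborel_box) (auto simp: B' inner_axis flat_def le')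
  also have "\<dots> = (\<Prod>b\<in>Basis. (u - l) \<bullet> b)"
    unfolding B B' prod.reindex[OF inj] prod.reindex[OF inj']
    by (simp add: inner_axis flat_def prod.reindex_bij_betw[OF bij_Rep_wo, of "\<lambda>p. u $ fst p $ snd p - l $ fst p $ snd p"])
  finally show "emeasure (distr lborel borel unflat) (box l u) = (\<Prod>b\<in>Basis. (u - l) \<bullet> b)" .
qed simp

text \<open>The constant is independent of the step length, which allows the steps to be iterated.
  The restriction on \<open>h\<close> makes \<open>h\<close> times the field a contraction of factor
  1/2, hence the step injective, and makes the derivative small enough for the determinant
  estimate.\<close>

lemma euler_step_emeasure:
  fixes V :: "(real^2)^'n::finite \<Rightarrow> (real^2)^'n"
  assumes der: "\<And>X. (V has_derivative V' X) (at X)"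
    and bd: "\<And>X W. norm (V' X W) \<le> L * norm W" and L: "L > 0"
    and tr: "\<And>X. (\<Sum>j\<in>UNIV. \<Sum>c\<in>UNIV. V' X (axis j (axis c 1)) $ j $ c) = 0"
  shows "\<exists>c\<ge>0. \<forall>h B. 0 < h \<and> h < 1 / (2 * L) \<and> B \<in> sets borel \<longrightarrow>
    ennreal (1 - c * h\<^sup>2) * emeasure lborel ((\<lambda>X. X + h *\<^sub>R V X) -` B) \<le> emeasure lborel B"
proof -
  define c where "c = real (2 * CARD(('n \<times> 2) wo) + card {p. p permutes (UNIV::('n \<times> 2) wo set)} * 2 ^ CARD(('n \<times> 2) wo))"
  have [measurable]: "unflat \<in> borel_measurable borel"
    by (intro borel_measurable_continuous_onI linear_continuous_on bounded_linear_unflat)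
  have lip: "norm (V X - V Y) \<le> L * norm (X - Y)" for X Y
    by (rule differentiable_bound[of UNIV V V'])
      (auto intro!: der onorm_le bd has_derivative_at_withinI)
  define U where "U z = flat (V (unflat z))" for z
  define U' where "U' z v = flat (V' (unflat z) (unflat v))" for z v
  have dU: "(U has_derivative U' z) (at z)" for z
  proof -
    have "((\<lambda>z. V (unflat z)) has_derivative (\<lambda>v. V' (unflat z) (unflat v))) (at z)"
      by (rule has_derivative_compose[OF bounded_linear_imp_has_derivative[OF bounded_linear_unflat] der])
    from bounded_linear.has_derivative[OF bounded_linear_flat this]
    show ?thesis by (simp add: U_def[abs_def] U'_def[abs_def])
  qed
  have bdU: "\<bar>U' z (axis j 1) $ i\<bar> \<le> L" for z i j
  proof -
    let ?W = "V' (unflat z) (unflat (axis j 1))"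
    have "\<bar>U' z (axis j 1) $ i\<bar> \<le> norm (?W $ fst (Rep_wo i))"
      using component_le_norm_cart[of "?W $ fst (Rep_wo i)"] by (simp add: U'_def flat_def)
    also have "\<dots> \<le> norm ?W" by (rule Finite_Cartesian_Product.norm_nth_le)
    also have "\<dots> \<le> L * norm (unflat (axis j 1) :: (real^2)^'n)" by (rule bd)
    also have "norm (unflat (axis j 1) :: (real^2)^'n) = 1"       by (simp add: unflat_axis norm_eq_sqrt_inner inner_axis_axis)
    finally show ?thesis by simp
  qed
  have trU: "(\<Sum>i\<in>UNIV. U' z (axis i 1) $ i) = 0" for z
  proof -
    have "(\<Sum>i\<in>UNIV. U' z (axis i 1) $ i)
      = (\<Sum>i\<in>UNIV. (\<lambda>p. V' (unflat z) (axis (fst p) (axis (snd p) 1)) $ fst p $ snd p) (Rep_wo i))"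
      by (simp add: U'_def flat_def unflat_axis)
    also have "\<dots> = (\<Sum>p\<in>UNIV. V' (unflat z) (axis (fst p) (axis (snd p) 1)) $ fst p $ snd p)"
      by (rule sum.reindex_bij_betw[OF bij_Rep_wo])
    also have "\<dots> = (\<Sum>j\<in>UNIV. \<Sum>c\<in>UNIV. V' (unflat z) (axis j (axis c 1)) $ j $ c)"
      unfolding UNIV_Times_UNIV[symmetric] by (simp add: sum.cartesian_product case_prod_beta)
    finally show ?thesis using tr by simp
  qed
  have "ennreal (1 - (c * L\<^sup>2) * h\<^sup>2) * emeasure lborel ((\<lambda>X. X + h *\<^sub>R V X) -` B) \<le> emeasure lborel B"
    if h: "0 < h" "h < 1 / (2 * L)" and B[measurable]: "B \<in> sets borel" for h B
  proof -
    have hL: "h * L \<le> 1/2" using h L by (simp add: field_simps)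
    have injV: "inj (\<lambda>X. X + h *\<^sub>R V X)"
    proof (rule injI)
      fix X Y assume "X + h *\<^sub>R V X = Y + h *\<^sub>R V Y"
      then have "X - Y = h *\<^sub>R (V Y - V X)" by (simp add: algebra_simps)
      then have "norm (X - Y) = h * norm (V Y - V X)" using h by simp
      also have "\<dots> \<le> h * (L * norm (X - Y))" using lip[of Y X] h by (simp add: norm_minus_commute)
      also have "\<dots> \<le> 1/2 * norm (X - Y)" using mult_right_mono[OF hL, of "norm (X - Y)"] by (simp add: mult.assoc)
      finally show "X = Y" by simp
    qed
    have E: "unflat (z + h *\<^sub>R U z) = unflat z + h *\<^sub>R V (unflat z)" for z
      by (simp add: U_def unflat_linear)
    have inj: "inj (\<lambda>z. z + h *\<^sub>R U z)"
    proof (rule injI)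
      fix y z assume "y + h *\<^sub>R U y = z + h *\<^sub>R U z"
      then have "unflat y + h *\<^sub>R V (unflat y) = unflat z + h *\<^sub>R V (unflat z)" by (metis E)
      then have "unflat y = (unflat z :: (real^2)^'n)" using injV by (auto dest: injD)
      then show "y = z" by (metis flat_unflat)
    qed
    have Vm: "(\<lambda>X. X + h *\<^sub>R V X) -` B \<in> sets borel"
    proof -
      have "continuous_on UNIV V" using has_derivative_continuous[OF der] by (auto simp: continuous_on_eq_continuous_at)
      then have "(\<lambda>X. X + h *\<^sub>R V X) \<in> borel_measurable borel"
        by (intro borel_measurable_continuous_onI continuous_intros)
      from measurable_sets[OF this B] show ?thesis by simp
    qed
    have em: "emeasure lborel A = emeasure lborel (unflat -` A)" if "A \<in> sets borel" for A :: "((real^2)^'n) set"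
      using emeasure_distr[of unflat lborel borel A] that by (simp add: distr_unflat)
    have "ennreal (1 - c * (h * L)\<^sup>2) * emeasure lborel ((\<lambda>z. z + h *\<^sub>R U z) -` (unflat -` B)) \<le> emeasure lborel (unflat -` B)"
      unfolding c_def
      using measurable_sets[OF \<open>unflat \<in> _\<close> B] h hL
      by (intro euler_step_emeasure_vec[OF dU bdU trU _ _ inj]) auto
    also have "(\<lambda>z. z + h *\<^sub>R U z) -` (unflat -` B) = unflat -` ((\<lambda>X. X + h *\<^sub>R V X) -` B)"
      by (auto simp: E)
    finally show ?thesis using em[OF B] em[OF Vm] by (simp add: power_mult_distrib mult_ac)
  qed
  moreover have "c * L\<^sup>2 \<ge> 0" by (simp add: c_def)
  ultimately show ?thesis by blast
qed

text \<open>The clause with \<open>max 0\<close> extends the flow constantly to negative times, so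
  that joint continuity, and later joint measurability, can be stated on the whole product space.
  The last clause is the inequality half of Liouville's theorem.\<close>

lemma reg_flow_exists:
  fixes g :: "'n::finite \<Rightarrow> real"
  assumes e: "e > 0" and a: "a \<ge> 1/2"
  shows "\<exists>\<phi> :: real \<Rightarrow> (real^2)^'n \<Rightarrow> (real^2)^'n. (\<forall>x. \<phi> 0 x = x) \<and>
    (\<forall>x. \<forall>t\<ge>0. ((\<lambda>s. \<phi> s x) has_vector_derivative reg_field g a e (\<phi> t x)) (at t within {0..})) \<and>
    continuous_on UNIV (\<lambda>p. \<phi> (max 0 (fst p)) (snd p)) \<and>
    (\<forall>t\<ge>0. \<forall>f\<in>borel_measurable borel. (\<integral>\<^sup>+x. f (\<phi> t x) \<partial>lborel) \<le> (\<integral>\<^sup>+x. f x \<partial>lborel))"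
proof -
  let ?V = "reg_field g a e"
  have a0: "a > 0" using a by simp
  obtain L where L: "L > 0" and bd: "\<And>X W. norm (reg_field' g a e X W) \<le> L * norm W"
    and lip: "\<And>X Y. norm (?V X - ?V Y) \<le> L * norm (X - Y)"
    using reg_field_lipschitz[OF e a0, of g] by blast
  define M where "M = CARD('n) * ((\<Sum>k\<in>UNIV. \<bar>g k\<bar>) * ((1 + a) * e powr (1/2 - a)))"
  have bnd: "norm (?V X) \<le> M" for X
    unfolding M_def by (rule reg_field_bounded[OF e a])
  define S where "S x X \<longleftrightarrow> X 0 = x \<and> (\<forall>t\<ge>0. (X has_vector_derivative ?V (X t)) (at t within {0..}))" for x X
  define \<phi> where "\<phi> t x = (SOME X. S x X) t" for t x
  have "S x (SOME X. S x X)" for x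
    using lipschitz_flow_exists[of L ?V x, OF L lip] unfolding S_def[symmetric] by (rule someI_ex)
  then have "S x (\<lambda>t. \<phi> t x)" for x by (simp add: \<phi>_def)
  then have \<phi>0: "\<phi> 0 x = x" and \<phi>: "\<And>t. t \<ge> 0 \<Longrightarrow> ((\<lambda>s. \<phi> s x) has_vector_derivative ?V (\<phi> t x)) (at t within {0..})" for x
    by (auto simp: S_def)
  have space: "norm (\<phi> t x - \<phi> t y) \<le> exp (L * t) * norm (x - y)" if "t \<ge> 0" for t x y
  proof -
    have "((\<lambda>s. \<phi> s z) has_vector_derivative ?V (\<phi> s z)) (at s within {0..t})" if "s \<in> {0..t}" for s z
      using that by (intro has_vector_derivative_within_subset[OF \<phi>]) auto
    from lipschitz_flow_dependence[of t ?V "\<lambda>t. \<phi> t x" "\<lambda>t. \<phi> t y" L t, OF lip this this]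
    show ?thesis using that by (simp add: \<phi>0)
  qed
  have time: "norm (\<phi> t x - \<phi> s x) \<le> M * \<bar>t - s\<bar>" if "t \<ge> 0" "s \<ge> 0" for t s x
    using vector_derivative_bound[of "{0..}" "\<lambda>s. \<phi> s x" "\<lambda>t. ?V (\<phi> t x)" M t s] \<phi> bnd that by auto
  have M: "M \<ge> 0" using bnd[of 0] norm_ge_zero order_trans by blast
  have cont: "continuous_on UNIV (\<lambda>p. \<phi> (max 0 (fst p)) (snd p))"
    unfolding continuous_on_eq_continuous_at[OF open_UNIV]
  proof
    fix p :: "real \<times> ((real^2)^'n)"
    obtain t x where p: "p = (t, x)" by (cases p)
    let ?t = "max 0 t"
    have "((\<lambda>q. \<phi> (max 0 (fst q)) (snd q) - \<phi> ?t x) \<longlongrightarrow> 0) (at p)"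
    proof (rule Lim_null_comparison)
      show "\<forall>\<^sub>F q in at p. norm (\<phi> (max 0 (fst q)) (snd q) - \<phi> ?t x)
         \<le> M * \<bar>max 0 (fst q) - ?t\<bar> + exp (L * ?t) * norm (snd q - x)"
      proof (rule always_eventually, rule allI)
        fix q :: "real \<times> ((real^2)^'n)"
        have "norm (\<phi> (max 0 (fst q)) (snd q) - \<phi> ?t (snd q)) \<le> M * \<bar>max 0 (fst q) - ?t\<bar>"
          by (rule time) auto
        moreover have "norm (\<phi> ?t (snd q) - \<phi> ?t x) \<le> exp (L * ?t) * norm (snd q - x)"
          by (rule space) auto
        ultimately show "norm (\<phi> (max 0 (fst q)) (snd q) - \<phi> ?t x)
         \<le> M * \<bar>max 0 (fst q) - ?t\<bar> + exp (L * ?t) * norm (snd q - x)"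
          by (rule norm_diff_triangle_le)
      qed
      have "((\<lambda>q. M * \<bar>max 0 (fst q) - ?t\<bar> + exp (L * ?t) * norm (snd q - x)) \<longlongrightarrow>
         M * \<bar>max 0 (fst p) - ?t\<bar> + exp (L * ?t) * norm (snd p - x)) (at p)"
        by (intro tendsto_intros)
      then show "((\<lambda>q. M * \<bar>max 0 (fst q) - ?t\<bar> + exp (L * ?t) * norm (snd q - x)) \<longlongrightarrow> 0) (at p)"
        by (simp add: p)
    qed
    then show "isCont (\<lambda>p. \<phi> (max 0 (fst p)) (snd p)) p"
      unfolding isCont_def by (simp add: p LIM_zero_iff)
  qed
  have meas: "\<phi> t \<in> borel_measurable borel" if "t \<ge> 0" for t
  proof -
    have "continuous_on UNIV (\<lambda>x. \<phi> (max 0 (fst (t, x))) (snd (t, x)))"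
      by (rule continuous_on_compose2[OF cont]) (auto intro!: continuous_intros)
    then show ?thesis using that by (intro borel_measurable_continuous_onI) (simp add: max_def)
  qed
  obtain c where c: "c \<ge> 0" and step: "\<And>h B. 0 < h \<Longrightarrow> h < 1 / (2 * L) \<Longrightarrow> B \<in> sets borel \<Longrightarrow>
    ennreal (1 - c * h\<^sup>2) * emeasure lborel ((\<lambda>X. X + h *\<^sub>R ?V X) -` B) \<le> emeasure lborel B"
    using euler_step_emeasure[OF reg_field_has_derivative[OF e] bd L reg_field'_trace] by blast
  have "(\<integral>\<^sup>+x. f (\<phi> t x) \<partial>lborel) \<le> (\<integral>\<^sup>+x. f x \<partial>lborel)" if t: "t \<ge> 0" and f: "f \<in> borel_measurable borel" for t f
  proof (rule flow_nn_integral_le[OF _ meas[OF t] f])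
    show "emeasure lborel (\<phi> t -` B) \<le> emeasure lborel B" if "B \<in> sets borel" for B
      using L c t meas[OF t] that
      by (intro flow_emeasure_le[where ?h0.0="1 / (2 * L)", OF lip L bnd \<phi>0 \<phi> step]) auto
  qed
  then show ?thesis using \<phi>0 \<phi> cont by (intro exI[of _ \<phi>]) auto
qed

section \<open>Near collisions\<close>

text \<open>The terms with \<open>k = j\<close> are left out: for \<open>p > 1\<close> they would
  destroy local integrability.\<close>

definition triple_interaction :: "real \<Rightarrow> (real^2)^'n::finite \<Rightarrow> real" where
  "triple_interaction p X = (\<Sum>i\<in>UNIV. \<Sum>j\<in>UNIV - {i}. \<Sum>k\<in>UNIV - {i, j}.
     norm (X $ i - X $ j) powr - p * norm (X $ i - X $ k) powr - p)"

lemma triple_interaction_nonneg: "triple_interaction p X \<ge> 0"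
  unfolding triple_interaction_def by (intro sum_nonneg) auto

lemma triple_interaction_ge:
  assumes "i \<noteq> j"
  shows "(\<Sum>k\<in>UNIV - {i, j}. norm (X $ i - X $ j) powr - p * norm (X $ i - X $ k) powr - p) \<le> triple_interaction p X"
proof -
  have "(\<Sum>k\<in>UNIV - {i, j}. norm (X $ i - X $ j) powr - p * norm (X $ i - X $ k) powr - p)
    \<le> (\<Sum>j\<in>UNIV - {i}. \<Sum>k\<in>UNIV - {i, j}. norm (X $ i - X $ j) powr - p * norm (X $ i - X $ k) powr - p)"
    using assms by (intro member_le_sum[of j "UNIV - {i}" "\<lambda>j. \<Sum>k\<in>UNIV - {i, j}. norm (X $ i - X $ j) powr - p * norm (X $ i - X $ k) powr - p"])
      (auto intro!: sum_nonneg)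
  also have "\<dots> \<le> triple_interaction p X"
    unfolding triple_interaction_def
    by (intro member_le_sum[of i UNIV "\<lambda>i. \<Sum>j\<in>UNIV - {i}. \<Sum>k\<in>UNIV - {i, j}. norm (X $ i - X $ j) powr - p * norm (X $ i - X $ k) powr - p"])
      (auto intro!: sum_nonneg)
  finally show ?thesis .
qed

lemma borel_measurable_vec_nth [measurable]:
  "(\<lambda>X. X $ l) \<in> borel_measurable (borel :: ('a::euclidean_space^'n) measure)"
  by (intro borel_measurable_continuous_onI continuous_intros)

lemma borel_measurable_triple_interaction [measurable]: "triple_interaction p \<in> borel_measurable borel"
  unfolding triple_interaction_def[abs_def] by measurable

lemma nn_integral_triple_interaction_finite:
  assumes p: "0 \<le> p" "p < 2" and R: "R > 0"
  shows "(\<integral>\<^sup>+X. ennreal (triple_interaction p X) * indicator (cball 0 R) X \<partial>(lborel :: ((real^2)^'n::finite) measure)) < \<infinity>"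
proof -
  have [measurable]: "cball (0 :: (real^2)^'n) R \<in> sets borel" by simp
  let ?h = "\<lambda>i j k X. ennreal (norm (X $ i - X $ j) powr - p * norm (X $ i - X $ k) powr - p) * indicator (cball 0 R) (X :: (real^2)^'n)"
  have "ennreal (triple_interaction p X) * indicator (cball 0 R) X = (\<Sum>i\<in>UNIV. \<Sum>j\<in>UNIV - {i}. \<Sum>k\<in>UNIV - {i, j}. ?h i j k X)" for X :: "(real^2)^'n"
    unfolding triple_interaction_def sum_distrib_right[symmetric]
    by (simp add: sum_nonneg)
  then have "(\<integral>\<^sup>+X. ennreal (triple_interaction p X) * indicator (cball 0 R) X \<partial>(lborel :: ((real^2)^'n) measure))
    = (\<Sum>i\<in>UNIV. \<Sum>j\<in>UNIV - {i}. \<Sum>k\<in>UNIV - {i, j}. \<integral>\<^sup>+X. ?h i j k X \<partial>lborel)"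
    by (simp only:) (subst nn_integral_sum, measurable)+
  also have "\<dots> < \<infinity>"
    using nn_integral_pair_interaction_finite[OF p R] by auto
  finally show ?thesis .
qed

text \<open>The summand \<open>k = j\<close> of the field is perpendicular to
  \<open>X $ i - X $ j\<close> even after regularisation, and the others are bounded by the singular
  kernel, hence uniformly in \<open>e\<close>.\<close>

lemma inner_reg_field_le:
  fixes g :: "'n::finite \<Rightarrow> real"
  assumes e: "e > 0" and a: "a > 0" and ij: "i \<noteq> j"
    and ne: "\<And>i j. i \<noteq> j \<Longrightarrow> X $ i \<noteq> X $ j"
  shows "\<bar>(X $ i - X $ j) \<bullet> reg_field g a e X $ i\<bar> \<le>
    norm (X $ i - X $ j) * ((\<Sum>k\<in>UNIV. \<bar>g k\<bar>) * (\<Sum>k\<in>UNIV - {i, j}. norm (X $ i - X $ k) powr - (2 * a - 1)))"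
proof -
  let ?K = "reg_kernel a e" and ?G = "\<Sum>k\<in>UNIV. \<bar>g k\<bar>"
  have "(X $ i - X $ j) \<bullet> reg_field g a e X $ i = (\<Sum>k\<in>UNIV - {i}. g k * ((X $ i - X $ j) \<bullet> ?K (X $ i - X $ k)))"
    by (simp add: reg_field_def inner_sum_right)
  also have "\<dots> = (\<Sum>k\<in>UNIV - {i, j}. g k * ((X $ i - X $ j) \<bullet> ?K (X $ i - X $ k)))"
    by (rule sum.mono_neutral_right) (use ij in auto)
  also have "\<bar>\<dots>\<bar> \<le> (\<Sum>k\<in>UNIV - {i, j}. ?G * (norm (X $ i - X $ j) * norm (X $ i - X $ k) powr - (2 * a - 1)))"
  proof (rule order_trans[OF sum_abs], rule sum_mono)
    fix k assume k: "k \<in> UNIV - {i, j}"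
    have "\<bar>(X $ i - X $ j) \<bullet> ?K (X $ i - X $ k)\<bar> \<le> norm (X $ i - X $ j) * norm (?K (X $ i - X $ k))"
      by (rule Cauchy_Schwarz_ineq2)
    also have "\<dots> \<le> norm (X $ i - X $ j) * norm (X $ i - X $ k) powr (1 - 2 * a)"
      using k ne[of i k] by (intro mult_left_mono norm_reg_kernel_le_powr e a) auto
    finally have 1: "\<bar>(X $ i - X $ j) \<bullet> ?K (X $ i - X $ k)\<bar> \<le> norm (X $ i - X $ j) * norm (X $ i - X $ k) powr - (2 * a - 1)"
      by simp
    have "\<bar>g k\<bar> \<le> ?G" by (rule member_le_sum) auto
    with 1 show "\<bar>g k * ((X $ i - X $ j) \<bullet> ?K (X $ i - X $ k))\<bar> \<le> ?G * (norm (X $ i - X $ j) * norm (X $ i - X $ k) powr - (2 * a - 1))"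
      unfolding abs_mult by (intro mult_mono) (auto intro: sum_nonneg)
  qed
  also have "\<dots> = norm (X $ i - X $ j) * (?G * (\<Sum>k\<in>UNIV - {i, j}. norm (X $ i - X $ k) powr - (2 * a - 1)))"
    by (simp add: sum_distrib_left mult_ac)
  finally show ?thesis .
qed

text \<open>The interaction within the pair is orthogonal to its separation, so only products of
  two distances sharing a vortex occur; their powers are locally integrable as \<open>2 * a - 1 < 2\<close>.\<close>

lemma pair_potential_growth:
  fixes g :: "'n::finite \<Rightarrow> real" and x :: "real \<Rightarrow> (real^2)^'n"
  assumes e: "e > 0" and a: "a > 1" and ij: "i \<noteq> j" and \<tau>: "\<tau> \<ge> 0"
    and x: "\<And>t. t \<in> {0..\<tau>} \<Longrightarrow> (x has_vector_derivative reg_field g a e (x t)) (at t within {0..\<tau>})"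
    and ne: "\<And>t i j. t \<in> {0..\<tau>} \<Longrightarrow> i \<noteq> j \<Longrightarrow> x t $ i \<noteq> x t $ j"
  shows "ennreal ((norm (x \<tau> $ i - x \<tau> $ j))\<^sup>2 powr - (a - 1)) \<le> ennreal ((norm (x 0 $ i - x 0 $ j))\<^sup>2 powr - (a - 1))
    + (\<integral>\<^sup>+t. ennreal (4 * (a - 1) * (\<Sum>k\<in>UNIV. \<bar>g k\<bar>) * triple_interaction (2 * a - 1) (x t)) * indicator {0..\<tau>} t \<partial>lborel)"
proof -
  let ?G = "\<Sum>k\<in>UNIV. \<bar>g k\<bar>" and ?p = "2 * a - 1" and ?b = "a - 1"
  define d where "d t = (x t $ i - x t $ j) \<bullet> (x t $ i - x t $ j)" for t
  define d' where "d' t = 2 * ((x t $ i - x t $ j) \<bullet> (reg_field g a e (x t) $ i - reg_field g a e (x t) $ j))" for t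
  have G: "?G \<ge> 0" by (intro sum_nonneg) auto
  have nx: "((\<lambda>t. x t $ l) has_vector_derivative reg_field g a e (x t) $ l) (at t within {0..\<tau>})" if "t \<in> {0..\<tau>}" for t l
    by (rule bounded_linear.has_vector_derivative[OF bounded_linear_vec_nth x[OF that]])
  have dpos: "d t > 0" if "t \<in> {0..\<tau>}" for t
    using ne[OF that ij] by (simp add: d_def)
  have dd: "(d has_real_derivative d' t) (at t within {0..\<tau>})" if t: "t \<in> {0..\<tau>}" for t
  proof -
    note [derivative_intros] = nx[OF t, unfolded has_vector_derivative_def]
    show ?thesis
      unfolding d_def d'_def has_field_derivative_def
      by (rule derivative_eq_intros | rule refl)+
        (auto simp: fun_eq_iff algebra_simps inner_commute)
  qed
  let ?u' = "\<lambda>t. - ?b * d t powr (- ?b - 1) * d' t"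
  have du: "((\<lambda>t. d t powr - ?b) has_real_derivative ?u' t) (at t within {0..\<tau>})" if "t \<in> {0..\<tau>}" for t
    using DERIV_chain2[OF has_real_derivative_powr[OF dpos[OF that], of "- ?b"] dd[OF that]] by simp
  have u'_le: "?u' t \<le> 4 * ?b * ?G * triple_interaction ?p (x t)" if t: "t \<in> {0..\<tau>}" for t
  proof -
    let ?X = "x t" let ?V = "reg_field g a e (x t)" let ?r = "norm (x t $ i - x t $ j)"
    have r: "?r > 0" using ne[OF t ij] by simp
    let ?si = "\<Sum>k\<in>UNIV - {i, j}. norm (?X $ i - ?X $ k) powr - ?p"
    let ?sj = "\<Sum>k\<in>UNIV - {j, i}. norm (?X $ j - ?X $ k) powr - ?p"
    have "\<bar>(?X $ i - ?X $ j) \<bullet> ?V $ i\<bar> \<le> ?r * (?G * ?si)"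
      using a by (intro inner_reg_field_le e ij ne[OF t]) auto
    moreover have "\<bar>(?X $ j - ?X $ i) \<bullet> ?V $ j\<bar> \<le> norm (?X $ j - ?X $ i) * (?G * ?sj)"
      using a ij by (intro inner_reg_field_le e ne[OF t]) auto
    moreover have "(?X $ i - ?X $ j) \<bullet> (?V $ i - ?V $ j) = (?X $ i - ?X $ j) \<bullet> ?V $ i + (?X $ j - ?X $ i) \<bullet> ?V $ j"
      by (simp add: algebra_simps)
    ultimately have "\<bar>d' t\<bar> \<le> 2 * (?r * (?G * (?si + ?sj)))"
      by (simp add: d'_def norm_minus_commute[of "?X $ j" "?X $ i"] algebra_simps)
    then have bound: "\<bar>?u' t\<bar> \<le> ?b * d t powr (- ?b - 1) * (2 * (?r * (?G * (?si + ?sj))))"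
      unfolding abs_mult using a by (intro mult_mono) (auto intro!: mult_nonneg_nonneg sum_nonneg)
    have regroup: "B * D * (2 * (r * (H * (s + s')))) = 2 * B * H * (P * s + P * s')" if "D * r = P" for B D r H s s' P :: real
      unfolding that[symmetric] by (simp add: algebra_simps)
    note bound
    \<comment> \<open>Since \<open>d\<close> is a squared distance, the exponents add up to
      \<open>2 * (- ?b - 1) + 1 = - ?p\<close>: the power from the chain rule and the factor from
      Cauchy-Schwarz combine to the exponent of the kernel.\<close>
    also have "d t powr (- ?b - 1) * ?r = ?r powr - ?p"
      using r unfolding d_def powr_inner_self by (simp add: powr_mult_base algebra_simps)
    then have "?b * d t powr (- ?b - 1) * (2 * (?r * (?G * (?si + ?sj)))) = 2 * ?b * ?G * (?r powr - ?p * ?si + ?r powr - ?p * ?sj)"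
      by (rule regroup)
    also have "\<dots> \<le> 2 * ?b * ?G * (triple_interaction ?p ?X + triple_interaction ?p ?X)"
    proof (intro mult_left_mono add_mono)
      show "?r powr - ?p * ?si \<le> triple_interaction ?p ?X"
        using triple_interaction_ge[OF ij, where X="?X" and p="?p"] by (simp add: sum_distrib_left)
      show "?r powr - ?p * ?sj \<le> triple_interaction ?p ?X"
        using triple_interaction_ge[OF ij[symmetric], where X="?X" and p="?p"]
        by (simp add: sum_distrib_left norm_minus_commute[of "?X $ j" "?X $ i"])
    qed (use a G in auto)
    also have "\<dots> = 4 * ?b * ?G * triple_interaction ?p ?X" by (simp add: algebra_simps)
    finally show ?thesis by (rule order_trans[OF abs_ge_self])
  qed
  let ?f = "\<lambda>t. 4 * ?b * ?G * triple_interaction ?p (x t)"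
  have cx: "continuous_on {0..\<tau>} (\<lambda>t. x t $ l)" for l
    unfolding continuous_on_eq_continuous_within by (intro ballI has_vector_derivative_continuous[OF nx])
  have cp: "continuous_on {0..\<tau>} (\<lambda>t. norm (x t $ k - x t $ l) powr - ?p)" if "k \<noteq> l" for k l
  proof (intro continuous_on_powr continuous_on_const continuous_on_norm continuous_on_diff cx ballI)
    show "norm (x t $ k - x t $ l) \<noteq> 0" if "t \<in> {0..\<tau>}" for t using ne[OF that \<open>k \<noteq> l\<close>] by simp
  qed
  have cf: "continuous_on {0..\<tau>} ?f"
    unfolding triple_interaction_def
    by (intro continuous_on_mult continuous_on_const continuous_on_sum cp) auto
  have "(?u' has_integral (d \<tau> powr - ?b - d 0 powr - ?b)) {0..\<tau>}"
    using \<tau> du by (intro fundamental_theorem_of_calculus) (auto simp: has_real_derivative_iff_has_vector_derivative)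
  moreover have fi: "(?f has_integral integral {0..\<tau>} ?f) {0..\<tau>}"
    by (intro integrable_integral integrable_continuous_interval cf)
  ultimately have le: "d \<tau> powr - ?b - d 0 powr - ?b \<le> integral {0..\<tau>} ?f"
    by (rule has_integral_le) (rule u'_le)
  have nn: "?f t \<ge> 0" for t using a G triple_interaction_nonneg by (intro mult_nonneg_nonneg) auto
  have I: "(\<integral>\<^sup>+t. ennreal (?f t) * indicator {0..\<tau>} t \<partial>lborel) = ennreal (integral {0..\<tau>} ?f)"
    using nn_integral_has_integral_lebesgue[OF nn fi] nn
    by (simp add: ennreal_mult ennreal_indicator mult.commute)
  have "ennreal (d \<tau> powr - ?b) \<le> ennreal (d 0 powr - ?b + integral {0..\<tau>} ?f)"
    using le by (intro ennreal_leI) linarith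
  also have "\<dots> = ennreal (d 0 powr - ?b) + ennreal (integral {0..\<tau>} ?f)"
    using has_integral_nonneg[OF fi nn] by (intro ennreal_plus) auto
  finally show ?thesis unfolding I by (simp add: d_def power2_norm_eq_inner)
qed

text \<open>The full system is a cluster without external velocity. The values \<open>C = 0\<close>
  and \<open>C0 = 1\<close> serve for every \<open>e\<close>, the kernel being at most 1 beyond
  distance 1; hence one \<open>R\<close> for all regularisations.\<close>

lemma reg_flow_displacement:
  fixes g :: "'n::finite \<Rightarrow> real"
  assumes nz: "\<And>J. J \<noteq> {} \<Longrightarrow> (\<Sum>j\<in>J. g j) \<noteq> 0" and a: "a \<ge> 1/2" and T: "T \<ge> 0"
  shows "\<exists>R\<ge>0. \<forall>e>0. \<forall>x :: real \<Rightarrow> (real^2)^'n.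
    (\<forall>t\<in>{0..T}. (x has_vector_derivative reg_field g a e (x t)) (at t within {0..T})) \<longrightarrow>
    (\<forall>t\<in>{0..T}. norm (x t - x 0) \<le> R)"
proof -
  obtain R where R0: "R \<ge> 0" and R: "\<forall>(K :: real^2 \<Rightarrow> real^2) X u v. (\<forall>y. K (- y) = - K y) \<longrightarrow>
     (\<forall>y. norm y \<ge> 1 \<longrightarrow> norm (K y) \<le> 1) \<longrightarrow> v - u \<le> T \<longrightarrow> driven_cluster g UNIV K 0 X u v \<longrightarrow>
     (\<forall>j\<in>UNIV. \<forall>s\<in>{u..v}. \<forall>t\<in>{u..v}. norm (X j t - X j s) \<le> R)"
    using cluster_displacement_bounded[OF nz, of 1 T 0 UNIV] T by auto
  have "norm (x t - x 0) \<le> CARD('n) * R"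
    if e: "e > 0" and t: "t \<in> {0..T}"
      and x: "\<forall>t\<in>{0..T}. (x has_vector_derivative reg_field g a e (x t)) (at t within {0..T})"
    for e t and x :: "real \<Rightarrow> (real^2)^'n"
  proof -
    have far: "norm (reg_kernel a e y) \<le> 1" if y: "norm y \<ge> 1" for y
    proof -
      have "norm (reg_kernel a e y) \<le> norm y powr (1 - 2 * a)"
        using y a by (intro norm_reg_kernel_le_powr e) auto
      also have "\<dots> \<le> 1" using powr_mono2'[of "1 - 2 * a" 1 "norm y"] y a by simp
      finally show ?thesis .
    qed
    have "driven_cluster g UNIV (reg_kernel a e) 0 (\<lambda>j t. x t $ j) 0 T"
      unfolding driven_cluster_def
    proof (intro ballI exI[of _ 0] conjI)
      fix j t assume "t \<in> {0..T}"
      with x have "(x has_vector_derivative reg_field g a e (x t)) (at t within {0..T})" by blast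
      from bounded_linear.has_vector_derivative[OF bounded_linear_vec_nth this, of j]
      show "((\<lambda>t. x t $ j) has_vector_derivative (\<Sum>k\<in>UNIV - {j}. g k *\<^sub>R reg_kernel a e (x t $ j - x t $ k)) + 0) (at t within {0..T})"
        by (simp add: reg_field_def)
    qed simp
    from R[rule_format, OF reg_kernel_odd far _ this] have "norm (x t $ j - x 0 $ j) \<le> R" for j
      using t by auto
    then have "(\<Sum>j\<in>UNIV. norm ((x t - x 0) $ j)) \<le> (\<Sum>j\<in>(UNIV::'n set). R)"
      by (intro sum_mono) auto
    then show ?thesis using norm_vec_le_sum[of "x t - x 0"] by simp
  qed
  then show ?thesis using R0 by (intro exI[of _ "CARD('n) * R"]) auto
qed

text \<open>The parameter \<open>e\<close> is compared with the squared distance, which is the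
  argument of \<open>reg_powr\<close>, so such a solution never meets the modified part of the
  kernel.\<close>

definition collision_free_reg_solution where
  "collision_free_reg_solution g a e T x X \<longleftrightarrow> X 0 = x \<and>
     (\<forall>t\<in>{0..T}. (X has_vector_derivative reg_field g a e (X t)) (at t within {0..T})) \<and>
     (\<forall>t\<in>{0..T}. \<forall>i j. i \<noteq> j \<longrightarrow> e < (norm (X t $ i - X t $ j))\<^sup>2)"

text \<open>Markov's inequality for the growth of the pair potential. The bound \<open>A\<close>
  does not depend on \<open>e\<close> or \<delta>, while the factor in front of the measure tends to
  infinity as \<open>e\<close> tends to 0.\<close>

lemma near_collision_emeasure_bound:
  fixes g :: "'n::finite \<Rightarrow> real"
  assumes nz: "\<And>J. J \<noteq> {} \<Longrightarrow> (\<Sum>j\<in>J. g j) \<noteq> 0" and a: "1 < a" "a < 3/2"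
    and T: "T > 0" and R0: "R0 > 0"
  shows "\<exists>A<\<infinity>. \<forall>e \<delta>. 0 < e \<and> e < \<delta> \<longrightarrow> (\<exists>M\<in>sets borel.
    ennreal (e powr - (a - 1) - \<delta> powr - (a - 1)) * emeasure lborel M \<le> A \<and>
    (\<forall>x :: (real^2)^'n. norm x \<le> R0 \<and> (\<forall>i j. i \<noteq> j \<longrightarrow> \<delta> \<le> (norm (x $ i - x $ j))\<^sup>2) \<and> x \<notin> M \<longrightarrow>
      (\<exists>X. collision_free_reg_solution g a e T x X)))"
proof -
  define G where "G = 4 * (a - 1) * (\<Sum>k\<in>UNIV. \<bar>g k\<bar>)"
  have G: "G \<ge> 0" using a by (auto simp: G_def intro!: mult_nonneg_nonneg sum_nonneg)
  let ?p = "2 * a - 1" and ?b = "a - 1"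
  obtain R1 where R1: "R1 \<ge> 0" and disp: "\<And>e (x :: real \<Rightarrow> (real^2)^'n) t. e > 0 \<Longrightarrow>
    (\<And>t. t \<in> {0..T} \<Longrightarrow> (x has_vector_derivative reg_field g a e (x t)) (at t within {0..T})) \<Longrightarrow>
    t \<in> {0..T} \<Longrightarrow> norm (x t - x 0) \<le> R1"
    using reg_flow_displacement[OF nz, of a T] a T by force
  define R where "R = R0 + R1"
  have R: "R > 0" using R0 R1 by (simp add: R_def)
  define \<Psi> where "\<Psi> X = ennreal (G * triple_interaction ?p X)" for X :: "(real^2)^'n"
  have [measurable]: "\<Psi> \<in> borel_measurable borel" unfolding \<Psi>_def[abs_def] by measurable
  have [measurable]: "cball (0 :: (real^2)^'n) r \<in> sets borel" for r by simp
  define A where "A = ennreal T * (\<integral>\<^sup>+X. \<Psi> X * indicator (cball 0 R) X \<partial>lborel)"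
  have "(\<integral>\<^sup>+X. \<Psi> X * indicator (cball 0 R) X \<partial>lborel)
      = ennreal G * (\<integral>\<^sup>+X. ennreal (triple_interaction ?p X) * indicator (cball 0 R) X \<partial>(lborel :: ((real^2)^'n) measure))"
    by (subst nn_integral_cmult[symmetric]) (auto simp: \<Psi>_def G ennreal_mult triple_interaction_nonneg mult.assoc)
  then have A: "A < \<infinity>"
    using nn_integral_triple_interaction_finite[of ?p R, where 'n='n] a R
    by (simp add: A_def ennreal_mult_less_top)
  have "\<exists>M\<in>sets borel. ennreal (e powr - ?b - \<delta> powr - ?b) * emeasure lborel M \<le> A \<and>
    (\<forall>x :: (real^2)^'n. norm x \<le> R0 \<and> (\<forall>i j. i \<noteq> j \<longrightarrow> \<delta> \<le> (norm (x $ i - x $ j))\<^sup>2) \<and> x \<notin> M \<longrightarrow>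
      (\<exists>X. collision_free_reg_solution g a e T x X))"
    if e: "0 < e" "e < \<delta>" for e \<delta>
  proof -
    have a': "a \<ge> 1/2" using a by simp
    obtain \<phi> :: "real \<Rightarrow> (real^2)^'n \<Rightarrow> (real^2)^'n" where flow: "(\<forall>x. \<phi> 0 x = x) \<and>
      (\<forall>x. \<forall>t\<ge>0. ((\<lambda>s. \<phi> s x) has_vector_derivative reg_field g a e (\<phi> t x)) (at t within {0..})) \<and>
      continuous_on UNIV (\<lambda>p. \<phi> (max 0 (fst p)) (snd p)) \<and>
      (\<forall>t\<ge>0. \<forall>f\<in>borel_measurable borel. (\<integral>\<^sup>+x. f (\<phi> t x) \<partial>lborel) \<le> (\<integral>\<^sup>+x. f x \<partial>lborel))"
      by (rule exE[OF reg_flow_exists[OF e(1) a', where g=g]])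
    have \<phi>0: "\<phi> 0 x = x" for x using flow by (elim conjE) (erule spec)
    have \<phi>: "((\<lambda>s. \<phi> s x) has_vector_derivative reg_field g a e (\<phi> t x)) (at t within {0..})" if "t \<ge> 0" for x t
      using flow that by simp
    have cont: "continuous_on UNIV (\<lambda>p. \<phi> (max 0 (fst p)) (snd p))" using flow by (elim conjE)
    have liou: "(\<integral>\<^sup>+x. f (\<phi> t x) \<partial>lborel) \<le> (\<integral>\<^sup>+x. f x \<partial>lborel)"
      if "t \<ge> 0" "f \<in> borel_measurable borel" for t f
      using flow that by simp
    have \<phi>T: "((\<lambda>s. \<phi> s x) has_vector_derivative reg_field g a e (\<phi> t x)) (at t within {0..\<tau>})"
      if "t \<in> {0..\<tau>}" for x t \<tau>
      using that by (intro has_vector_derivative_within_subset[OF \<phi>]) auto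
    have "(\<lambda>p. \<phi> (max 0 (fst p)) (snd p)) \<in> borel_measurable (borel \<Otimes>\<^sub>M borel)"
      unfolding borel_prod by (rule borel_measurable_continuous_onI[OF cont])
    from measurable_compose[OF measurable_Pair[OF measurable_snd measurable_fst] this]
    have [measurable]: "(\<lambda>p. \<phi> (max 0 (snd p)) (fst p)) \<in> borel_measurable (borel \<Otimes>\<^sub>M borel)"
      by simp
    define h where "h x s = \<Psi> (\<phi> (max 0 s) x) * (indicator {0..T} s * indicator (cball 0 R0) x)" for x s
    have h[measurable]: "case_prod h \<in> borel_measurable (borel \<Otimes>\<^sub>M borel)"
      unfolding h_def case_prod_beta by measurable
    define I where "I x = (\<integral>\<^sup>+s. h x s \<partial>lborel)" for x
    have [measurable]: "I \<in> borel_measurable borel"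
      unfolding I_def[abs_def] by (rule lborel.borel_measurable_nn_integral) simp
    \<comment> \<open>The least amount by which the potential of a pair must grow for its squared
      distance to fall from \<delta> to \<open>e\<close>.\<close>
    define \<kappa> where "\<kappa> = ennreal (e powr - ?b - \<delta> powr - ?b)"
    define M where "M = {x. \<kappa> \<le> I x}"
    have M[measurable]: "M \<in> sets borel" unfolding M_def by measurable
    have "\<kappa> * emeasure lborel M = (\<integral>\<^sup>+x. \<kappa> * indicator M x \<partial>lborel)"
      by (simp add: nn_integral_cmult_indicator)
    also have "\<dots> \<le> (\<integral>\<^sup>+x. I x \<partial>lborel)"
      by (rule nn_integral_mono) (auto simp: M_def indicator_def)
    also have "\<dots> = (\<integral>\<^sup>+s. \<integral>\<^sup>+x. h x s \<partial>lborel \<partial>lborel)"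
      unfolding I_def by (rule lborel_pair.Fubini'[symmetric]) simp
    \<comment> \<open>At each time \<open>s\<close> the flow is at most \<open>R1\<close> away from
      its start, and the transport inequality turns the integral over initial data into one over the
      ball of radius \<open>R\<close>.\<close>
    also have "\<dots> \<le> (\<integral>\<^sup>+s. (\<integral>\<^sup>+X. \<Psi> X * indicator (cball 0 R) X \<partial>lborel) * indicator {0..T} s \<partial>lborel)"
    proof (rule nn_integral_mono)
      fix s :: real
      show "(\<integral>\<^sup>+x. h x s \<partial>lborel) \<le> (\<integral>\<^sup>+X. \<Psi> X * indicator (cball 0 R) X \<partial>lborel) * indicator {0..T} s"
      proof (cases "s \<in> {0..T}")
        case True
        have "(\<integral>\<^sup>+x. h x s \<partial>lborel) \<le> (\<integral>\<^sup>+x. (\<lambda>X. \<Psi> X * indicator (cball 0 R) X) (\<phi> s x) \<partial>lborel)"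
        proof (rule nn_integral_mono)
          fix x :: "(real^2)^'n"
          have "\<phi> s x \<in> cball 0 R" if "x \<in> cball 0 R0"
          proof -
            have "norm (\<phi> s x - \<phi> 0 x) \<le> R1" by (rule disp[OF e(1) \<phi>T True])
            then show ?thesis using that norm_triangle_sub[of "\<phi> s x" x] by (simp add: \<phi>0 R_def)
          qed
          then show "h x s \<le> \<Psi> (\<phi> s x) * indicator (cball 0 R) (\<phi> s x)"
            using True by (auto simp: h_def indicator_def max_def)
        qed
        also have "\<dots> \<le> (\<integral>\<^sup>+X. \<Psi> X * indicator (cball 0 R) X \<partial>lborel)"
          using True by (intro liou) auto
        finally show ?thesis using True by simp
      qed (simp add: h_def)
    qed
    also have "\<dots> = A"
      using T by (subst nn_integral_cmult_indicator) (auto simp: A_def mult.commute)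
    finally have Markov: "\<kappa> * emeasure lborel M \<le> A" .
    have good: "e < (norm (\<phi> t x $ i - \<phi> t x $ j))\<^sup>2"
      if x: "norm x \<le> R0" "\<forall>i j. i \<noteq> j \<longrightarrow> \<delta> \<le> (norm (x $ i - x $ j))\<^sup>2" "x \<notin> M"
        and t: "t \<in> {0..T}" and ij: "i \<noteq> j" for x t i j
    proof (rule ccontr)
      assume neg: "\<not> e < (norm (\<phi> t x $ i - \<phi> t x $ j))\<^sup>2"
      let ?P = "{q :: 'n \<times> 'n. fst q \<noteq> snd q}"
      define f where "f q t = (norm (\<phi> t x $ fst q - \<phi> t x $ snd q))\<^sup>2" for q t
      have "continuous_on {0..T} (\<lambda>t. \<phi> t x)"
        unfolding continuous_on_eq_continuous_within by (intro ballI has_vector_derivative_continuous[OF \<phi>T])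
      then have fc: "continuous_on {0..T} (f q)" for q
        unfolding f_def by (intro continuous_intros)
      \<comment> \<open>Taking the first time over all pairs ensures that no two vortices meet up to
        \<tau>, as the growth estimate requires.\<close>
      have "\<exists>\<tau>\<in>{0..T}. \<exists>q\<in>?P. f q \<tau> = e \<and> (\<forall>r\<in>?P. \<forall>u\<in>{0..\<tau>}. f r u \<ge> e)"
      proof (rule first_hitting_time[where p="(i, j)" and t=t])
        show "e < f p 0" if "p \<in> ?P" for p
          using x(2) that e by (force simp: f_def \<phi>0 intro: less_le_trans)
        show "f (i, j) t \<le> e" using neg by (simp add: f_def)
      qed (use fc ij t in auto)
      then obtain \<tau> q where \<tau>: "\<tau> \<in> {0..T}" and q: "q \<in> ?P" "f q \<tau> = e"
        and before: "\<And>r u. r \<in> ?P \<Longrightarrow> u \<in> {0..\<tau>} \<Longrightarrow> f r u \<ge> e" by blast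
      have "ennreal (e powr - ?b) = ennreal ((norm (\<phi> \<tau> x $ fst q - \<phi> \<tau> x $ snd q))\<^sup>2 powr - ?b)"
        using q(2) by (simp add: f_def)
      also have "\<dots> \<le> ennreal ((norm (\<phi> 0 x $ fst q - \<phi> 0 x $ snd q))\<^sup>2 powr - ?b)
        + (\<integral>\<^sup>+t. ennreal (4 * (a - 1) * (\<Sum>k\<in>UNIV. \<bar>g k\<bar>) * triple_interaction (2 * a - 1) (\<phi> t x)) * indicator {0..\<tau>} t \<partial>lborel)"
      proof (rule pair_potential_growth[OF e(1) a(1)])
        fix u k l assume "u \<in> {0..\<tau>}" "(k::'n) \<noteq> l"
        then show "\<phi> u x $ k \<noteq> \<phi> u x $ l"
          using before[of "(k, l)" u] e(1) by (auto simp: f_def)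
      qed (use q \<tau> \<phi>T in auto)
      also have "\<dots> \<le> ennreal (\<delta> powr - ?b) + I x"
      proof (rule add_mono)
        show "ennreal ((norm (\<phi> 0 x $ fst q - \<phi> 0 x $ snd q))\<^sup>2 powr - ?b) \<le> ennreal (\<delta> powr - ?b)"
          using x(2) q(1) a e by (intro ennreal_leI powr_mono2') (auto simp: \<phi>0)
        show "(\<integral>\<^sup>+t. ennreal (4 * (a - 1) * (\<Sum>k\<in>UNIV. \<bar>g k\<bar>) * triple_interaction (2 * a - 1) (\<phi> t x)) * indicator {0..\<tau>} t \<partial>lborel) \<le> I x"
          unfolding I_def h_def \<Psi>_def G_def[symmetric]
          using x(1) \<tau> by (intro nn_integral_mono) (auto simp: indicator_def max_def)
      qed
      finally have "\<kappa> \<le> I x"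
        unfolding \<kappa>_def by (cases "I x") (auto simp flip: ennreal_plus)
      then show False using x(3) by (simp add: M_def)
    qed
    show ?thesis
    proof (intro bexI[OF _ M] conjI allI impI)
      show "ennreal (e powr - ?b - \<delta> powr - ?b) * emeasure lborel M \<le> A" using Markov by (simp add: \<kappa>_def)
      fix x assume "norm x \<le> R0 \<and> (\<forall>i j. i \<noteq> j \<longrightarrow> \<delta> \<le> (norm (x $ i - x $ j))\<^sup>2) \<and> x \<notin> M"
      then show "\<exists>X. collision_free_reg_solution g a e T x X"
        unfolding collision_free_reg_solution_def using \<phi>0 \<phi>T good by (intro exI[of _ "\<lambda>t. \<phi> t x"]) auto
    qed
  qed
  then show ?thesis using A by blast
qed

section \<open>Global smooth solutions\<close>

text \<open>The exceptional sets depend on \<open>e\<close>, but a point outside their intersection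
  is good for at least one \<open>e\<close>, and the measure of the intersection is below that of
  each of them.\<close>

lemma collision_free_off_null_set_bounded:
  fixes g :: "'n::finite \<Rightarrow> real"
  assumes nz: "\<And>J. J \<noteq> {} \<Longrightarrow> (\<Sum>j\<in>J. g j) \<noteq> 0" and a: "1 < a" "a < 3/2"
    and T: "T > 0" and R0: "R0 > 0" and \<delta>: "\<delta> > 0"
  shows "\<exists>N\<in>null_sets lborel. \<forall>x. norm x \<le> R0 \<and> (\<forall>i j. i \<noteq> j \<longrightarrow> \<delta> \<le> (norm (x $ i - x $ j))\<^sup>2) \<and> x \<notin> N \<longrightarrow>
    (\<exists>e>0. \<exists>X. collision_free_reg_solution g a e T x X)"
proof -
  obtain A where A: "A < \<infinity>" and bad: "\<forall>e \<delta>. 0 < e \<and> e < \<delta> \<longrightarrow> (\<exists>M\<in>sets borel.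
    ennreal (e powr - (a - 1) - \<delta> powr - (a - 1)) * emeasure lborel M \<le> A \<and>
    (\<forall>x. norm x \<le> R0 \<and> (\<forall>i j. i \<noteq> j \<longrightarrow> \<delta> \<le> (norm (x $ i - x $ j))\<^sup>2) \<and> x \<notin> M \<longrightarrow>
      (\<exists>X. collision_free_reg_solution g a e T x X)))"
    using near_collision_emeasure_bound[OF nz a T R0] by blast
  define Q where "Q n M \<longleftrightarrow> M \<in> sets borel \<and> ennreal (real n) * emeasure lborel M \<le> A \<and>
    (\<forall>x. norm x \<le> R0 \<and> (\<forall>i j. i \<noteq> j \<longrightarrow> \<delta> \<le> (norm (x $ i - x $ j))\<^sup>2) \<and> x \<notin> M \<longrightarrow>
      (\<exists>e>0. \<exists>X. collision_free_reg_solution g a e T x X))" for n M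
  have "\<exists>M. Q (Suc n) M" for n
  proof -
    let ?b = "a - 1"
    \<comment> \<open>Chosen so that the gap in the potential is exactly \<open>Suc n\<close>; the
      exceptional set then has measure at most \<open>A / Suc n\<close>.\<close>
    define e where "e = (\<delta> powr - ?b + real (Suc n)) powr (- 1 / ?b)"
    have pos: "\<delta> powr - ?b + real (Suc n) > 0" using \<delta> by (intro add_nonneg_pos) auto
    then have e0: "e > 0" by (simp add: e_def)
    have eb: "e powr - ?b = \<delta> powr - ?b + real (Suc n)"
    proof -
      have "- 1 / ?b * - ?b = 1" using a by (simp add: field_simps)
      then show ?thesis unfolding e_def powr_powr using pos by (simp only: powr_one less_imp_le)
    qed
    have el: "e < \<delta>"
    proof (rule ccontr)
      assume "\<not> e < \<delta>"
      then have "e powr - ?b \<le> \<delta> powr - ?b" using a \<delta> by (intro powr_mono2') auto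
      then show False using eb by simp
    qed
    obtain M where M: "M \<in> sets borel"
      "ennreal (e powr - ?b - \<delta> powr - ?b) * emeasure lborel M \<le> A \<and>
       (\<forall>x. norm x \<le> R0 \<and> (\<forall>i j. i \<noteq> j \<longrightarrow> \<delta> \<le> (norm (x $ i - x $ j))\<^sup>2) \<and> x \<notin> M \<longrightarrow>
      (\<exists>X. collision_free_reg_solution g a e T x X))"
      by (rule bexE[OF bad[THEN spec, THEN spec, THEN mp, OF conjI[OF e0 el]]])
    have "Q (Suc n) M"
      unfolding Q_def
    proof (intro conjI allI impI)
      show "ennreal (real (Suc n)) * emeasure lborel M \<le> A" using M(2) unfolding eb by simp
      fix x assume "norm x \<le> R0 \<and> (\<forall>i j. i \<noteq> j \<longrightarrow> \<delta> \<le> (norm (x $ i - x $ j))\<^sup>2) \<and> x \<notin> M"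
      then have "\<exists>X. collision_free_reg_solution g a e T x X" using M(2) by blast
      then show "\<exists>e>0. \<exists>X. collision_free_reg_solution g a e T x X" using e0 by blast
    qed (rule M)
    then show ?thesis by blast
  qed
  then obtain M where M: "\<And>n. Q (Suc n) (M n)" by metis
  define N where "N = (\<Inter>n. M n)"
  have N: "N \<in> sets borel" unfolding N_def using M by (auto simp: Q_def)
  have Nb: "ennreal (real (Suc n)) * emeasure lborel N \<le> A" for n
  proof -
    have "emeasure lborel N \<le> emeasure lborel (M n)"
      using M[of n] by (intro emeasure_mono) (auto simp: N_def Q_def)
    then show ?thesis using M[of n] unfolding Q_def by (meson mult_left_mono order_trans zero_le)
  qed
  have "emeasure lborel N = 0"
  proof (cases "emeasure lborel N")
    case (real r)
    obtain \<alpha> where \<alpha>: "A = ennreal \<alpha>" "\<alpha> \<ge> 0" using A by (cases A) auto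
    have mult_le: "real (Suc n) * r \<le> \<alpha>" for n
      using Nb[of n] real \<alpha> by (simp add: ennreal_mult[symmetric] del: of_nat_Suc)
    have "r \<le> 0"
    proof (rule ccontr)
      assume "\<not> r \<le> 0"
      then obtain k :: nat where "\<alpha> < real k * r" using reals_Archimedean3[of r] by auto
      moreover have "real k * r \<le> real (Suc k) * r" using \<open>\<not> r \<le> 0\<close> by simp
      ultimately show False using mult_le[of k] by linarith
    qed
    then show ?thesis using real by simp
  next
    case top
    then show ?thesis using Nb[of 0] A by simp
  qed
  then have "N \<in> null_sets lborel" using N by (simp add: null_sets_def)
  moreover have "\<exists>e>0. \<exists>X. collision_free_reg_solution g a e T x X"
    if "norm x \<le> R0 \<and> (\<forall>i j. i \<noteq> j \<longrightarrow> \<delta> \<le> (norm (x $ i - x $ j))\<^sup>2) \<and> x \<notin> N" for x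
  proof -
    from that obtain n where "x \<notin> M n" by (auto simp: N_def)
    then show ?thesis using M[of n] that unfolding Q_def by blast
  qed
  ultimately show ?thesis by blast
qed

text \<open>Equality of the first coordinates alone already confines \<open>x\<close> to a
  hyperplane.\<close>

lemma null_sets_coincidence:
  fixes i j :: "'n::finite"
  assumes "i \<noteq> j"
  shows "{x :: (real^2)^'n. x $ i = x $ j} \<in> null_sets lebesgue"
proof -
  let ?v = "axis i (axis 1 1) - axis j (axis 1 1) :: (real^2)^'n"
  have "?v $ i $ 1 = 1" using assms by (simp add: axis_def)
  then have "?v \<noteq> 0" by (metis zero_index zero_neq_one)
  then have "negligible {x. ?v \<bullet> x = 0}" by (intro negligible_hyperplane) simp
  moreover have "{x :: (real^2)^'n. x $ i = x $ j} \<subseteq> {x. ?v \<bullet> x = 0}"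
    by (auto simp: inner_diff_left inner_axis')
  ultimately show ?thesis
    unfolding negligible_iff_null_sets[symmetric] using negligible_subset by blast
qed

text \<open>Radius, initial separation and time horizon are exhausted by countably many values; data
  with coinciding vortices, which have no positive separation, form a further null set.\<close>

lemma collision_free_off_null_set:
  fixes g :: "'n::finite \<Rightarrow> real"
  assumes nz: "\<And>J. J \<noteq> {} \<Longrightarrow> (\<Sum>j\<in>J. g j) \<noteq> 0" and a: "1 < a" "a < 3/2"
  shows "\<exists>N\<in>null_sets lebesgue. \<forall>x. x \<notin> N \<longrightarrow> (\<forall>n::nat. \<exists>e>0. \<exists>X. collision_free_reg_solution g a e (real (Suc n)) x X)"
proof -
  define Q where "Q r q n N \<longleftrightarrow> N \<in> null_sets lborel \<and> (\<forall>x. norm x \<le> real (Suc r) \<and>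
    (\<forall>i j. i \<noteq> j \<longrightarrow> 1 / real (Suc q) \<le> (norm (x $ i - x $ j))\<^sup>2) \<and> x \<notin> N \<longrightarrow>
    (\<exists>e>0. \<exists>X. collision_free_reg_solution g a e (real (Suc n)) x X))" for r q n N
  define N where "N r q n = (SOME N. Q r q n N)" for r q n
  have Q: "Q r q n (N r q n)" for r q n
  proof -
    have "\<exists>N. Q r q n N"
      using collision_free_off_null_set_bounded[OF nz a, of "real (Suc n)" "real (Suc r)" "1 / real (Suc q)"]
      unfolding Q_def by auto
    then show ?thesis unfolding N_def by (rule someI_ex)
  qed
  define D where "D = (\<Union>p\<in>{p :: 'n \<times> 'n. fst p \<noteq> snd p}. {x :: (real^2)^'n. x $ fst p = x $ snd p})"
  have D: "D \<in> null_sets lebesgue"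
    unfolding D_def by (intro null_sets_UN') (auto intro: null_sets_coincidence countable_finite)
  define NN where "NN = D \<union> (\<Union>r. \<Union>q. \<Union>n. N r q n)"
  have "(\<Union>r. \<Union>q. \<Union>n. N r q n) \<in> null_sets lebesgue"
    using Q unfolding Q_def by (intro null_sets_UN null_sets_completionI) auto
  then have "NN \<in> null_sets lebesgue" unfolding NN_def using D by auto
  moreover have "\<exists>e>0. \<exists>X. collision_free_reg_solution g a e (real (Suc n)) x X" if x: "x \<notin> NN" for x and n :: nat
  proof -
    obtain r :: nat where "norm x \<le> real r" using real_arch_simple by blast
    then have r: "norm x \<le> real (Suc r)" by simp
    have "\<exists>q::nat. \<forall>p\<in>{p :: 'n \<times> 'n. fst p \<noteq> snd p}. 1 / real (Suc q) \<le> (norm (x $ fst p - x $ snd p))\<^sup>2"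
    proof -
      let ?P = "{p :: 'n \<times> 'n. fst p \<noteq> snd p}"
      have "\<forall>\<^sub>F q in sequentially. 1 / real (Suc q) < (norm (x $ fst p - x $ snd p))\<^sup>2" if "p \<in> ?P" for p
      proof (rule order_tendstoD(2)[OF LIMSEQ_Suc[OF lim_1_over_n]])
        show "0 < (norm (x $ fst p - x $ snd p))\<^sup>2" using x that by (auto simp: NN_def D_def)
      qed
      then have "\<forall>\<^sub>F q in sequentially. \<forall>p\<in>?P. 1 / real (Suc q) < (norm (x $ fst p - x $ snd p))\<^sup>2"
        by (intro eventually_ball_finite) auto
      then obtain q where "\<forall>p\<in>?P. 1 / real (Suc q) < (norm (x $ fst p - x $ snd p))\<^sup>2"
        unfolding eventually_sequentially by blast
      then show ?thesis by (meson less_imp_le)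
    qed
    then obtain q where q: "\<And>i j. i \<noteq> j \<Longrightarrow> 1 / real (Suc q) \<le> (norm (x $ i - x $ j))\<^sup>2" by fastforce
    have "x \<notin> N r q n" using x by (auto simp: NN_def)
    then show ?thesis using Q[of r q n] r q unfolding Q_def by blast
  qed
  ultimately show ?thesis by blast
qed

section \<open>The Green function and the singular vortex field\<close>

definition green_const :: "real \<Rightarrow> real" where
  "green_const m = Gamma ((2 - m) / 2) / (2 powr (m / 2) * pi * \<bar>Gamma (m / 2)\<bar>)"

lemma G_frac_has_derivative:
  fixes y :: "real^2"
  assumes "y \<noteq> 0"
  shows "(G_frac m has_derivative (\<lambda>v. green_const m * (m - 2) * norm y powr (m - 4) * (y \<bullet> v))) (at y)"
proof -
  have 1: "((\<lambda>y. y \<bullet> y) has_derivative (\<lambda>v. 2 * (y \<bullet> v))) (at y)"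
    by (auto intro!: derivative_eq_intros simp: inner_commute)
  have "((\<lambda>s. s powr ((m - 2) / 2)) has_derivative (*) ((m - 2) / 2 * (y \<bullet> y) powr ((m - 2) / 2 - 1))) (at (y \<bullet> y))"
    using has_real_derivative_powr[of "y \<bullet> y" "(m - 2) / 2"] assms by (simp add: has_field_derivative_def)
  from has_derivative_mult_right[OF has_derivative_compose[OF 1 this], of "green_const m"]
  have "((\<lambda>y. green_const m * (y \<bullet> y) powr ((m - 2) / 2)) has_derivative
      (\<lambda>v. green_const m * ((m - 2) / 2 * (y \<bullet> y) powr ((m - 2) / 2 - 1) * (2 * (y \<bullet> v))))) (at y)" .
  moreover have "(\<lambda>y. green_const m * (y \<bullet> y) powr ((m - 2) / 2)) = G_frac m"
  proof -
    have "2 * ((m - 2) / 2) = m - 2" by (simp add: field_simps)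
    then show ?thesis unfolding powr_inner_self by (simp only: G_frac_def[abs_def] green_const_def)
  qed
  moreover have "(y \<bullet> y) powr ((m - 2) / 2 - 1) = norm y powr (m - 4)"
  proof -
    have "2 * ((m - 2) / 2 - 1) = m - 4" by (simp add: field_simps)
    then show ?thesis unfolding powr_inner_self by (simp only:)
  qed
  ultimately show ?thesis by (simp add: mult_ac)
qed

lemma nabla_perp_G_frac:
  fixes y :: "real^2"
  assumes "y \<noteq> 0"
  shows "nabla_perp (G_frac m) y = (green_const m * (m - 2) * norm y powr (m - 4)) *\<^sub>R rot y"
proof -
  have "partial2 (G_frac m) i y = green_const m * (m - 2) * norm y powr (m - 4) * y $ i" for i
    unfolding partial2_def frechet_derivative_at[OF G_frac_has_derivative[OF assms(1)], symmetric]
    by (simp add: inner_axis)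
  then show ?thesis by (simp add: nabla_perp_def rot_def vec_eq_iff)
qed

lemma reg_field_eq_vortex_field:
  fixes \<gamma> :: "'n::finite \<Rightarrow> real"
  assumes e: "e > 0" and sep: "\<And>i j. i \<noteq> j \<Longrightarrow> e < (norm (X $ i - X $ j))\<^sup>2"
  shows "reg_field (\<lambda>k. green_const m * (m - 2) * \<gamma> k) ((4 - m) / 2) e X = vortex_field m \<gamma> X"
proof -
  have eq: "(green_const m * (m - 2) * \<gamma> k) *\<^sub>R reg_kernel ((4 - m) / 2) e (X $ j - X $ k) = \<gamma> k *\<^sub>R nabla_perp (G_frac m) (X $ j - X $ k)"
    if "k \<noteq> j" for j k
  proof -
    let ?y = "X $ j - X $ k"
    have s: "e < ?y \<bullet> ?y" using sep[of j k] that by (simp add: power2_norm_eq_inner)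
    then have "?y \<noteq> 0" using e by auto
    moreover have "reg_powr ((4 - m) / 2) e (?y \<bullet> ?y) = norm ?y powr (m - 4)"
    proof -
      have "2 * - ((4 - m) / 2) = m - 4" by (simp add: field_simps)
      then show ?thesis using s by (simp only: reg_powr_eq[OF less_imp_le] powr_inner_self)
    qed
    ultimately show ?thesis
      by (simp add: nabla_perp_G_frac reg_kernel_def mult_ac)
  qed
  show ?thesis
    unfolding reg_field_def vortex_field_def by (rule Cart_lambda_cong, rule sum.cong[OF refl], rule eq) simp
qed

text \<open>Powers of squared distances are generators of the algebra used for smoothness, and this
  explicit form shows that the velocity components lie in it.\<close>

lemma vortex_field_eq:
  assumes "\<And>i j. i \<noteq> j \<Longrightarrow> X $ i \<noteq> X $ j"
  shows "vortex_field m \<gamma> X = (\<chi> j. \<Sum>k\<in>UNIV - {j}. (green_const m * (m - 2) * \<gamma> k *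
    ((X $ j - X $ k) \<bullet> (X $ j - X $ k)) powr ((m - 4) / 2)) *\<^sub>R rot (X $ j - X $ k))"
proof -
  have "2 * ((m - 4) / 2) = m - 4" by (simp add: field_simps)
  then have pw: "norm y powr (m - 4) = (y \<bullet> y) powr ((m - 4) / 2)" for y :: "real^2"
    unfolding powr_inner_self by (simp only:)
  have eq: "\<gamma> k *\<^sub>R nabla_perp (G_frac m) (X $ j - X $ k) = (green_const m * (m - 2) * \<gamma> k *
    ((X $ j - X $ k) \<bullet> (X $ j - X $ k)) powr ((m - 4) / 2)) *\<^sub>R rot (X $ j - X $ k)" if "k \<noteq> j" for j k
    using assms[OF that] by (simp add: nabla_perp_G_frac pw mult_ac)
  show ?thesis
    unfolding vortex_field_def by (rule Cart_lambda_cong, rule sum.cong[OF refl], rule eq) simp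
qed

text \<open>The algebra generated by the coordinates and the powers of the mutual distances along a
  solution is closed under differentiation in time, which yields derivatives of all orders.\<close>

inductive trajectory_algebra :: "(real \<Rightarrow> (real^2)^'n) \<Rightarrow> (real \<Rightarrow> real) \<Rightarrow> bool"
  for X :: "real \<Rightarrow> (real^2)^'n" where
  const: "trajectory_algebra X (\<lambda>t. c)"
| coord: "trajectory_algebra X (\<lambda>t. X t $ i $ c)"
| dist: "i \<noteq> j \<Longrightarrow> trajectory_algebra X (\<lambda>t. ((X t $ i - X t $ j) \<bullet> (X t $ i - X t $ j)) powr p)"
| add: "trajectory_algebra X f \<Longrightarrow> trajectory_algebra X h \<Longrightarrow> trajectory_algebra X (\<lambda>t. f t + h t)"
| mult: "trajectory_algebra X f \<Longrightarrow> trajectory_algebra X h \<Longrightarrow> trajectory_algebra X (\<lambda>t. f t * h t)"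

lemma trajectory_algebra_diff:
  assumes "trajectory_algebra X f" "trajectory_algebra X h"
  shows "trajectory_algebra X (\<lambda>t. f t - h t)"
  using trajectory_algebra.add[OF assms(1) trajectory_algebra.mult[OF trajectory_algebra.const[of X "-1"] assms(2)]]
  by simp

lemma trajectory_algebra_sum:
  assumes "\<And>k. k \<in> A \<Longrightarrow> trajectory_algebra X (f k)"
  shows "trajectory_algebra X (\<lambda>t. \<Sum>k\<in>A. f k t)"
  using assms by (induction A rule: infinite_finite_induct) (auto intro: trajectory_algebra.intros)

lemma trajectory_algebra_deriv:
  fixes X :: "real \<Rightarrow> (real^2)^'n::finite"
  assumes X: "\<And>t. t \<ge> 0 \<Longrightarrow> (X has_vector_derivative W t) (at t within {0..})"
    and W: "\<And>i c. trajectory_algebra X (\<lambda>t. W t $ i $ c)"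
    and ne: "\<And>t i j. t \<ge> 0 \<Longrightarrow> i \<noteq> j \<Longrightarrow> X t $ i \<noteq> X t $ j"
    and f: "trajectory_algebra X f"
  shows "\<exists>f'. trajectory_algebra X f' \<and> (\<forall>t\<ge>0. (f has_real_derivative f' t) (at t within {0..}))"
  using f
proof induction
  case (const c)
  have "trajectory_algebra X (\<lambda>t. 0)" by (rule trajectory_algebra.const)
  then show ?case by (intro exI[of _ "\<lambda>t. 0"]) auto
next
  case (coord i c)
  have "((\<lambda>t. X t $ i $ c) has_real_derivative W t $ i $ c) (at t within {0..})" if "t \<ge> 0" for t
    unfolding has_real_derivative_iff_has_vector_derivative
    by (intro bounded_linear.has_vector_derivative[OF bounded_linear_vec_nth] X that)
  then show ?case using W by (intro exI[of _ "\<lambda>t. W t $ i $ c"]) auto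
next
  case (dist i j p)
  define d where "d t = (X t $ i - X t $ j) \<bullet> (X t $ i - X t $ j)" for t
  \<comment> \<open>Written out in coordinates, because the generators of the algebra are
    scalar.\<close>
  define d' where "d' t = 2 * ((X t $ i $ 1 - X t $ j $ 1) * (W t $ i $ 1 - W t $ j $ 1)
     + (X t $ i $ 2 - X t $ j $ 2) * (W t $ i $ 2 - W t $ j $ 2))" for t
  have "(d has_real_derivative d' t) (at t within {0..})" if t: "t \<ge> 0" for t
  proof -
    have x: "((\<lambda>t. X t $ k $ c) has_real_derivative W t $ k $ c) (at t within {0..})" for k c
      unfolding has_real_derivative_iff_has_vector_derivative
      by (intro bounded_linear.has_vector_derivative[OF bounded_linear_vec_nth] X t)
    have d_eq: "d = (\<lambda>t. (X t $ i $ 1 - X t $ j $ 1)\<^sup>2 + (X t $ i $ 2 - X t $ j $ 2)\<^sup>2)"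
      by (simp add: d_def fun_eq_iff inner_vec_def sum_2 power2_eq_square)
    show ?thesis
      unfolding d_eq d'_def by (auto intro!: derivative_eq_intros x simp: algebra_simps)
  qed
  moreover have "d t > 0" if "t \<ge> 0" for t using ne[OF that dist] by (simp add: d_def)
  ultimately have "((\<lambda>t. d t powr p) has_real_derivative p * d t powr (p - 1) * d' t) (at t within {0..})" if "t \<ge> 0" for t
    using that by (intro DERIV_chain2[OF has_real_derivative_powr]) auto
  moreover have "trajectory_algebra X (\<lambda>t. p * d t powr (p - 1) * d' t)"
    unfolding d_def d'_def
    by (intro trajectory_algebra.intros(1,2,4,5) trajectory_algebra.dist[OF dist] trajectory_algebra_diff W)
  ultimately show ?case unfolding d_def by blast
next
  case (add f h)
  then obtain f' h' where "trajectory_algebra X f'" "trajectory_algebra X h'"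
    "\<And>t. t \<ge> 0 \<Longrightarrow> (f has_real_derivative f' t) (at t within {0..})"
    "\<And>t. t \<ge> 0 \<Longrightarrow> (h has_real_derivative h' t) (at t within {0..})" by blast
  then show ?case
    by (intro exI[of _ "\<lambda>t. f' t + h' t"]) (auto intro: trajectory_algebra.add DERIV_add)
next
  case (mult f h)
  then obtain f' h' where "trajectory_algebra X f'" "trajectory_algebra X h'"
    "\<And>t. t \<ge> 0 \<Longrightarrow> (f has_real_derivative f' t) (at t within {0..})"
    "\<And>t. t \<ge> 0 \<Longrightarrow> (h has_real_derivative h' t) (at t within {0..})" by blast
  then show ?case using mult.hyps
    by (intro exI[of _ "\<lambda>t. f' t * h t + h' t * f t"])
      (auto intro!: trajectory_algebra.add trajectory_algebra.mult DERIV_mult)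
qed

text \<open>The hypothesis on \<open>W\<close> closes the loop: the velocity lies again in the
  algebra, so a derivative within the algebra exists at each stage and repeated choice builds the
  whole sequence.\<close>

lemma smooth_on_halfline_trajectory:
  fixes X :: "real \<Rightarrow> (real^2)^'n::finite"
  assumes X: "\<And>t. t \<ge> 0 \<Longrightarrow> (X has_vector_derivative W t) (at t within {0..})"
    and W: "\<And>i c. trajectory_algebra X (\<lambda>t. W t $ i $ c)"
    and ne: "\<And>t i j. t \<ge> 0 \<Longrightarrow> i \<noteq> j \<Longrightarrow> X t $ i \<noteq> X t $ j"
  shows "smooth_on_halfline X"
proof -
  define alg where "alg Y \<longleftrightarrow> (\<forall>i c. trajectory_algebra X (\<lambda>t. Y t $ i $ c))" for Y :: "real \<Rightarrow> (real^2)^'n"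
  define der where "der Y Y' \<longleftrightarrow> (\<forall>t\<ge>0. (Y has_vector_derivative Y' t) (at t within {0..}))"
    for Y Y' :: "real \<Rightarrow> (real^2)^'n"
  have step: "\<exists>Y'. alg Y' \<and> der Y Y'" if "alg Y" for Y
  proof -
    have "\<forall>i c. \<exists>f'. trajectory_algebra X f' \<and> (\<forall>t\<ge>0. ((\<lambda>t. Y t $ i $ c) has_real_derivative f' t) (at t within {0..}))"
      using that trajectory_algebra_deriv[OF X W ne] unfolding alg_def by blast
    then obtain F where F: "\<And>i c. trajectory_algebra X (F i c)"
      "\<And>i c t. t \<ge> 0 \<Longrightarrow> ((\<lambda>t. Y t $ i $ c) has_real_derivative F i c t) (at t within {0..})" by metis
    define Y' where "Y' t = (\<chi> i c. F i c t)" for t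
    have "(Y has_vector_derivative Y' t) (at t within {0..})" if "t \<ge> 0" for t
    proof -
      have "((\<lambda>t. \<chi> i. \<chi> c. Y t $ i $ c) has_derivative (\<lambda>h. \<chi> i. \<chi> c. F i c t * h)) (at t within {0..})"
        using F(2)[OF that] unfolding has_field_derivative_def by (intro has_derivative_vec_lambda)
      moreover have "(\<lambda>h. \<chi> i. \<chi> c. F i c t * h) = (\<lambda>h. h *\<^sub>R Y' t)"
        by (simp add: fun_eq_iff vec_eq_iff Y'_def)
      ultimately show ?thesis unfolding has_vector_derivative_def by simp
    qed
    moreover have "alg Y'" using F(1) by (simp add: alg_def Y'_def)
    ultimately show ?thesis unfolding der_def by blast
  qed
  have "alg X" unfolding alg_def by (auto intro: trajectory_algebra.coord)
  define D where "D = rec_nat X (\<lambda>k Y. SOME Y'. alg Y' \<and> der Y Y')"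
  have D0: "D 0 = X" and DS: "D (Suc k) = (SOME Y'. alg Y' \<and> der (D k) Y')" for k
    by (simp_all add: D_def)
  have next_D: "alg (D (Suc k)) \<and> der (D k) (D (Suc k))" if "alg (D k)" for k
    unfolding DS using step[OF that] by (rule someI_ex)
  have "alg (D k)" for k
    by (induction k) (use \<open>alg X\<close> D0 next_D in auto)
  then have "der (D k) (D (Suc k))" for k using next_D by blast
  then show ?thesis
    unfolding smooth_on_halfline_def der_def using D0 by (intro exI[of _ D]) auto
qed

theorem theorem3p1:
  fixes m :: real and \<gamma> :: "'n::finite \<Rightarrow> real"
  assumes "1 < m" and "m < 2"
    and "\<And>J. J \<noteq> {} \<Longrightarrow> (\<Sum>j\<in>J. \<gamma> j) \<noteq> 0"
  shows "\<exists>\<N> :: ((real^2)^'n) set. \<N> \<in> null_sets lebesgue \<and>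
    (\<forall>x0. x0 \<notin> \<N> \<longrightarrow>
      (\<exists>X :: real \<Rightarrow> (real^2)^'n.
         X 0 = x0 \<and>
         smooth_on_halfline X \<and>
         (\<forall>t\<ge>0. \<forall>i j. i \<noteq> j \<longrightarrow> X t $ i \<noteq> X t $ j) \<and>
         (\<forall>t\<ge>0. (X has_vector_derivative vortex_field m \<gamma> (X t)) (at t within {0..}))))"
proof -
  define a where "a = (4 - m) / 2"
  \<comment> \<open>The constant of the Green function, with the negative factor
    \<open>m - 2\<close>, is absorbed into the intensities; being nonzero, it preserves the
    condition on partial sums.\<close>
  define g where "g k = green_const m * (m - 2) * \<gamma> k" for k
  have a: "1 < a" "a < 3/2" using assms(1,2) by (simp_all add: a_def)
  have "green_const m > 0"
    using assms(1,2) by (auto simp: green_const_def intro!: divide_pos_pos mult_pos_pos Gamma_real_pos)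
  then have nz: "(\<Sum>j\<in>J. g j) \<noteq> 0" if "J \<noteq> {}" for J
    using assms(2) assms(3)[OF that] by (simp add: g_def flip: sum_distrib_left)
  obtain N where N: "N \<in> null_sets lebesgue"
    and sol: "\<And>x n. x \<notin> N \<Longrightarrow> \<exists>e>0. \<exists>X. collision_free_reg_solution g a e (real (Suc n)) x X"
    using collision_free_off_null_set[OF nz a] by blast
  have "\<exists>X. X 0 = x0 \<and> smooth_on_halfline X \<and> (\<forall>t\<ge>0. \<forall>i j. i \<noteq> j \<longrightarrow> X t $ i \<noteq> X t $ j) \<and>
         (\<forall>t\<ge>0. (X has_vector_derivative vortex_field m \<gamma> (X t)) (at t within {0..}))"
    if x0: "x0 \<notin> N" for x0
  proof -
    obtain E Y where E: "\<And>n. E n > 0" and Y: "\<And>n. collision_free_reg_solution g a (E n) (real (Suc n)) x0 (Y n)"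
      using sol[OF x0] by metis
    have Y0: "Y n 0 = x0" for n using Y[of n] by (simp add: collision_free_reg_solution_def)
    have sep: "E n < (norm (Y n t $ i - Y n t $ j))\<^sup>2" if "t \<in> {0..real (Suc n)}" "i \<noteq> j" for n t i j
      using Y[of n] that unfolding collision_free_reg_solution_def by blast
    have reg: "reg_field g a e (Y n t) = vortex_field m \<gamma> (Y n t)"
      if "0 < e" "e \<le> E n" "t \<in> {0..real (Suc n)}" for n t e
      unfolding g_def a_def by (rule reg_field_eq_vortex_field[OF that(1)]) (rule le_less_trans[OF that(2) sep[OF that(3)]])
    have dY: "(Y n has_vector_derivative vortex_field m \<gamma> (Y n t)) (at t within {0..real (Suc n)})"
      if "t \<in> {0..real (Suc n)}" for n t
      using Y[of n] that reg[OF E order_refl that] unfolding collision_free_reg_solution_def by metis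
    have uniq: "Y n t = Y k t" if t: "t \<in> {0..real (Suc n)}" "t \<in> {0..real (Suc k)}" for n k t
    proof -
      \<comment> \<open>The singular field is not globally Lipschitz, but at the smaller parameter
        both curves solve one and the same regularised equation, whose field is.\<close>
      define e where "e = min (E n) (E k)"
      have e: "e > 0" "e \<le> E n" "e \<le> E k" using E by (auto simp: e_def)
      obtain L where lip: "\<And>X Y. norm (reg_field g a e X - reg_field g a e Y) \<le> L * norm (X - Y)"
        using reg_field_lipschitz[OF e(1), of a g] a by auto
      have d: "(Y l has_vector_derivative reg_field g a e (Y l s)) (at s within {0..t})"
        if "s \<in> {0..t}" "t \<le> real (Suc l)" "e \<le> E l" for l s
      proof -
        have s: "s \<in> {0..real (Suc l)}" using that by auto
        show ?thesis
          unfolding reg[OF e(1) that(3) s]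
          by (rule has_vector_derivative_within_subset[OF dY[OF s]]) (use that in auto)
      qed
      have "norm (Y n t - Y k t) \<le> exp (L * t) * norm (Y n 0 - Y k 0)"
        using t e by (intro lipschitz_flow_dependence[of t "reg_field g a e" "Y n" "Y k" L t] lip d) auto
      then show ?thesis by (simp add: Y0)
    qed
    \<comment> \<open>The horizon of the solution used at \<open>t\<close> exceeds \<open>t\<close>
      strictly, so a neighbourhood of \<open>t\<close> in the half-line lies in its domain.\<close>
    define X where "X t = Y (nat \<lfloor>t\<rfloor>) t" for t
    have XY: "X t = Y n t" if "t \<in> {0..real (Suc n)}" for n t
      unfolding X_def using that by (intro uniq) (auto, linarith)
    have own: "t \<in> {0..real (Suc (nat \<lfloor>t\<rfloor>))}" "t < real (Suc (nat \<lfloor>t\<rfloor>))" if "t \<ge> 0" for t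
      using that by (auto, linarith+)
    have dX: "(X has_vector_derivative vortex_field m \<gamma> (X t)) (at t within {0..})" if t: "t \<ge> 0" for t
    proof -
      let ?n = "nat \<lfloor>t\<rfloor>"
      have "(X has_vector_derivative vortex_field m \<gamma> (Y ?n t)) (at t within {0..real (Suc ?n)})"
        by (rule has_vector_derivative_transform[OF own(1)[OF t] XY dY[OF own(1)[OF t]]])
      moreover have "at t within {0..real (Suc ?n)} = at t within {0..}"
        by (rule at_within_nhd[of _ "{..<real (Suc ?n)}"]) (use own(2)[OF t] in auto)
      ultimately show ?thesis by (simp add: XY[OF own(1)[OF t]])
    qed
    have ne: "X t $ i \<noteq> X t $ j" if "t \<ge> 0" "i \<noteq> j" for t i j
      using sep[OF own(1)[OF that(1)] that(2)] E[of "nat \<lfloor>t\<rfloor>"] by (auto simp: X_def)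
    have "smooth_on_halfline X"
    proof (rule smooth_on_halfline_trajectory[OF _ _ ne])
      define W where "W t = (\<chi> j. \<Sum>k\<in>UNIV - {j}. (green_const m * (m - 2) * \<gamma> k *
        ((X t $ j - X t $ k) \<bullet> (X t $ j - X t $ k)) powr ((m - 4) / 2)) *\<^sub>R rot (X t $ j - X t $ k))" for t
      show "(X has_vector_derivative W t) (at t within {0..})" if "t \<ge> 0" for t
      proof -
        have "vortex_field m \<gamma> (X t) = W t"
          unfolding W_def by (rule vortex_field_eq) (rule ne[OF that])
        then show ?thesis using dX[OF that] by simp
      qed
      have rot: "trajectory_algebra X (\<lambda>t. rot (X t $ j - X t $ k) $ c)" for j k c
      proof -
        have "trajectory_algebra X (\<lambda>t. X t $ k $ 2 - X t $ j $ 2)" "trajectory_algebra X (\<lambda>t. X t $ j $ 1 - X t $ k $ 1)"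
          by (intro trajectory_algebra_diff trajectory_algebra.coord)+
        then show ?thesis using exhaust_2[of c] by auto
      qed
      show "trajectory_algebra X (\<lambda>t. W t $ j $ c)" for j c
        unfolding W_def vec_lambda_beta sum_component vector_scaleR_component
        by (intro trajectory_algebra_sum)
          (auto intro!: trajectory_algebra.mult rot trajectory_algebra.const trajectory_algebra.dist)
    qed
    then show ?thesis using dX ne XY[of 0 0] Y0 by (intro exI[of _ X]) auto
  qed
  then show ?thesis using N by blast
qed

end
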